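(* The number of $k$-holes in the double chain $DC(n)$ on $n$ points is at least $$\binom{\frac{n-4}{2}}{\frac{n-k}{2}}\cdot\frac{n-k+2}{2}\cdot\Omega(4.64^k).$$
   Context: For a finite point set $S$ in the plane in general position (no three collinear), a $k$-gon of $S$ is a simple polygon whose vertex set consists of exactly $k$ points of $S$ (distinct simple polygons on the same vertex set count separately), and a $k$-hole is a $k$-gon whose interior contains no point of $S$. The double chain $DC(n)$ (for even $n$) consists of two chains of $n/2$ points each, an upper chain and a lower chain, in general position, such that: each chain is in convex position with its two endpoints being the only points of the chain on the convex hull of $DC(n)$ (so the convex hull of $DC(n)$ is a quadrilateral formed by the four chain endpoints, and each chain bends toward the other chain), and every line through two points of one chain leaves all points of the other chain on the same side. The factor $\Omega(4.64^k)$ denotes a quantity depending only on $k$ that is bounded below by a positive constant times $4.64^k$. *)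

theory Defs
  imports "HOL-Analysis.Analysis"
begin

text \<open>The plane is modelled by the type \<^typ>\<open>complex\<close>, for which the library proves
  the Jordan curve theorem.\<close>

definition general_position :: "complex set \<Rightarrow> bool" where
  "general_position S \<longleftrightarrow> (\<forall>T\<subseteq>S. card T = 3 \<longrightarrow> \<not> collinear T)"

definition convex_position :: "complex set \<Rightarrow> bool" where
  "convex_position S \<longleftrightarrow> (\<forall>p\<in>S. p \<notin> convex hull (S - {p}))"

text \<open>A polygon is represented by its set of edges, each edge being the set of its two endpoints.
  Hence the listings of the vertices of a polygon that differ only in the starting point or the
  sense of traversal yield one and the same polygon, while different polygons on the same vertex
  set stay different.\<close>

definition cyclic_edges :: "complex list \<Rightarrow> complex set set" where
  "cyclic_edges vs = (\<lambda>i. {vs ! i, vs ! ((i + 1) mod length vs)}) ` {..<length vs}"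

definition simple_polygon :: "complex set set \<Rightarrow> bool" where
  "simple_polygon P \<longleftrightarrow>
     (\<exists>vs. distinct vs \<and> 3 \<le> length vs \<and> P = cyclic_edges vs) \<and>
     (\<forall>e\<in>P. \<forall>f\<in>P. e \<noteq> f \<longrightarrow> convex hull e \<inter> convex hull f = e \<inter> f)"

definition polygon_boundary :: "complex set set \<Rightarrow> complex set" where
  "polygon_boundary P = (\<Union>e\<in>P. convex hull e)"

definition k_gon :: "complex set \<Rightarrow> nat \<Rightarrow> complex set set \<Rightarrow> bool" where
  "k_gon S k P \<longleftrightarrow> simple_polygon P \<and> \<Union>P \<subseteq> S \<and> card (\<Union>P) = k"

definition k_hole :: "complex set \<Rightarrow> nat \<Rightarrow> complex set set \<Rightarrow> bool" where
  "k_hole S k P \<longleftrightarrow> k_gon S k P \<and> inside (polygon_boundary P) \<inter> S = {}"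

definition on_one_side_of_line :: "complex \<Rightarrow> complex \<Rightarrow> complex set \<Rightarrow> bool" where
  "on_one_side_of_line p q A \<longleftrightarrow>
     (\<exists>a b. affine hull {p, q} = {x. a \<bullet> x = b} \<and> A \<subseteq> {x. a \<bullet> x < b})"

text \<open>The endpoints of a chain \<open>C\<close> of \<open>S\<close> are its two points on the boundary of the
  convex hull of \<open>S\<close>. The remaining points of \<open>C\<close> lie in the interior of the hull. By the
  condition on lines, the endpoints of \<open>C\<close> are neighbours on the hull, so that \<open>C\<close> bends
  towards the other chain \<open>D\<close>.\<close>

definition chain_facing :: "complex set \<Rightarrow> complex set \<Rightarrow> complex set \<Rightarrow> bool" where
  "chain_facing S C D \<longleftrightarrow>
     convex_position C \<and>
     card (C \<inter> frontier (convex hull S)) = 2 \<and>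
     (\<forall>p\<in>C. \<forall>q\<in>C. p \<noteq> q \<longrightarrow> on_one_side_of_line p q D)"

text \<open>The predicate holds for every realization of the double chain on \<open>n\<close> points; it forces
  \<open>n\<close> to be even and at least 4.\<close>

definition double_chain :: "nat \<Rightarrow> complex set \<Rightarrow> bool" where
  "double_chain n S \<longleftrightarrow>
     finite S \<and> general_position S \<and>
     (\<exists>U L. S = U \<union> L \<and> U \<inter> L = {} \<and> 2 * card U = n \<and> 2 * card L = n \<and>
        chain_facing S U L \<and> chain_facing S L U)"

end

(* Number the points of each chain from left to right. Edges joining the two chains never cross
   edges within a chain, and two edges joining the chains cross only if their endpoints appear in
   opposite orders. A polygon is therefore given by a noncrossing system of paths on each chain,
   whose endpoints are joined in left-to-right order. If consecutive endpoints are paired up by the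
   paths on the upper chain, and by those on the lower chain with a shift by one, the result is a
   single cycle.

   Systems whose paths join consecutive endpoints are counted by a recursive decomposition into
   spirals. Their generating function diverges at 1/4.641, and concatenation makes the counts
   supermultiplicative, so there are at least c * 4.6405^N of them on N points. The
   surplus over 4.64 absorbs the polynomial loss from fixing the number r of paths and the number d
   of gaps lying between the two endpoints of some path.

   A point between two consecutive vertices of the polygon on a chain lies outside the polygon iff
   an even number of joining edges precede it. This makes exactly the gaps of the first kind on one
   chain and of the second kind on the other usable. Using two systems with the same d balances the
   two numbers of usable gaps, which gives the binomial factors. *)

theory Submission
  imports Defs
begin

text \<open>Only systems whose paths pair up neighbouring endpoints are counted. For arbitrary
  noncrossing systems the joining edges may close several cycles; here the cycle can be listed
  explicitly as an alternation of upper and lower paths. If F and A denote the generating functions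
  of systems and of spirals, the constructors give F = 1 + x F + x A F + x A^2 F^2 and A = x + x A +
  x F A. Eliminating A leaves a cubic equation in F, and 4.641 comes from the place where its
  solution stops existing. Exact asymptotics are avoided: it suffices that the two equations,
  weakened to inequalities, have no solution at x = 1000/4641. Each chain carries a system on N =
  k/2 - 2 points and two auxiliary vertices, so a pair of systems contributes 4.64^(2N), which is
  4.64^k up to a constant.\<close>

(* Codes for path systems on consecutive points. Isolated t puts a one-point path before t. A spiral
   is the part of a path grown outwards from one of its endpoints, with tip the last vertex reached.
   For a left spiral, Inner appends the next vertex on the right, and Outer F A puts the next vertex
   on the left, separated from A by a nested system F; right spirals are mirror images.
   The layout of Closed A is [A][v] with v joined to the tip of A, and the layout of Joined A B F is
   [A][B][F][v] with v joined to the tips of the left spiral A and of the right spiral B. *)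
datatype sys = Empty | Isolated sys | Closed spiral sys | Joined spiral spiral sys sys
and spiral = Start | Inner spiral | Outer sys spiral

primrec ssize :: "sys \<Rightarrow> nat" and spsize :: "spiral \<Rightarrow> nat" where
  "ssize Empty = 0"
| "ssize (Isolated t) = ssize t + 1"
| "ssize (Closed A t) = spsize A + 1 + ssize t"
| "ssize (Joined A B F t) = spsize A + spsize B + ssize F + 1 + ssize t"
| "spsize Start = 1"
| "spsize (Inner A) = spsize A + 1"
| "spsize (Outer F A) = spsize A + ssize F + 1"

primrec ltip :: "nat \<Rightarrow> spiral \<Rightarrow> nat" where
  "ltip l Start = l"
| "ltip l (Inner A) = l + spsize A"
| "ltip l (Outer F A) = l"

primrec rtip :: "nat \<Rightarrow> spiral \<Rightarrow> nat" where
  "rtip l Start = l"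
| "rtip l (Inner B) = l"
| "rtip l (Outer F B) = l + spsize B + ssize F"

fun sarcs :: "nat \<Rightarrow> sys \<Rightarrow> (nat \<times> nat) set"
  and larcs :: "nat \<Rightarrow> spiral \<Rightarrow> (nat \<times> nat) set"
  and rarcs :: "nat \<Rightarrow> spiral \<Rightarrow> (nat \<times> nat) set" where
  "sarcs l Empty = {}"
| "sarcs l (Isolated t) = sarcs (Suc l) t"
| "sarcs l (Closed A t) = insert (ltip l A, l + spsize A) (larcs l A) \<union> sarcs (Suc (l + spsize A)) t"
| "sarcs l (Joined A B F t) =
     {(ltip l A, l + spsize A + spsize B + ssize F), (rtip (l + spsize A) B, l + spsize A + spsize B + ssize F)}
     \<union> (larcs l A \<union> (rarcs (l + spsize A) B \<union> sarcs (l + spsize A + spsize B) F))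
     \<union> sarcs (Suc (l + spsize A + spsize B + ssize F)) t"
| "larcs l Start = {}"
| "larcs l (Inner A) = insert (ltip l A, l + spsize A) (larcs l A)"
| "larcs l (Outer F A) = insert (l, ltip (Suc (l + ssize F)) A) (sarcs (Suc l) F \<union> larcs (Suc (l + ssize F)) A)"
| "rarcs l Start = {}"
| "rarcs l (Inner B) = insert (l, rtip (Suc l) B) (rarcs (Suc l) B)"
| "rarcs l (Outer F B) = insert (rtip l B, l + spsize B + ssize F) (rarcs l B \<union> sarcs (l + spsize B) F)"

section \<open>Arc sets of codes: absence of crossings and unique decoding\<close>

definition arcs :: "nat \<Rightarrow> nat \<Rightarrow> (nat \<times> nat) set" where
  "arcs l h = {(i, j). l \<le> i \<and> i < j \<and> j < h}"

definition noncrossing :: "(nat \<times> nat) set \<Rightarrow> bool" where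
  "noncrossing E \<longleftrightarrow> (\<forall>(i, j)\<in>E. \<forall>(g, h)\<in>E. \<not> (i < g \<and> g < j \<and> j < h))"

text \<open>\<open>c\<close> stands for the cut between \<open>c - 1\<close> and \<open>c\<close>. A
  covered block has no free inner cut, so its end can be read off from the arc set alone.\<close>

definition covers :: "nat \<Rightarrow> nat \<Rightarrow> (nat \<times> nat) set \<Rightarrow> bool" where
  "covers l h E \<longleftrightarrow> (\<forall>c. l < c \<longrightarrow> c < h \<longrightarrow> (\<exists>(i, j)\<in>E. i < c \<and> c \<le> j))"

lemma spsize_pos [simp]: "0 < spsize A" "spsize A \<noteq> 0"
  by (cases A; auto)+

text \<open>The tip is always an extreme vertex of the block of its spiral. This invariant lets the
  next arc leave the block without crossing it.\<close>

lemma ltip_cases: "ltip l A = l \<or> ltip l A = l + spsize A - 1"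
  by (cases A) auto

lemma rtip_cases: "rtip l A = l \<or> rtip l A = l + spsize A - 1"
  by (cases A) auto

lemma ltip_bounds: "l \<le> ltip l A" "ltip l A < l + spsize A"
  using ltip_cases[of l A] spsize_pos(1)[of A] by linarith+

lemma rtip_bounds: "l \<le> rtip l A" "rtip l A < l + spsize A"
  using rtip_cases[of l A] spsize_pos(1)[of A] by linarith+

lemma arcs_bounds: "E \<subseteq> arcs l h \<Longrightarrow> (i, j) \<in> E \<Longrightarrow> l \<le> i \<and> i < j \<and> j < h"
  by (auto simp: arcs_def)

lemma in_arcs: "(i, j) \<in> arcs l h \<longleftrightarrow> l \<le> i \<and> i < j \<and> j < h"
  by (auto simp: arcs_def)

lemma edges_arcs:
  "sarcs l t \<subseteq> arcs l (l + ssize t)"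
  "larcs l A \<subseteq> arcs l (l + spsize A)"
  "rarcs l A \<subseteq> arcs l (l + spsize A)"
proof (induction l t and l A and l A rule: sarcs_larcs_rarcs.induct)
  case (2 l t) then show ?case by (auto simp: arcs_def)
next
  case (3 l A t)
  show ?case using ltip_bounds[of l A]
    by (auto simp: in_arcs dest!: arcs_bounds[OF "3.IH"(1)] arcs_bounds[OF "3.IH"(2)])
next
  case (4 l A B F t)
  show ?case using ltip_bounds[of l A] rtip_bounds[of "l + spsize A" B]
    by (auto simp: in_arcs dest!: arcs_bounds[OF "4.IH"(1)] arcs_bounds[OF "4.IH"(2)]
        arcs_bounds[OF "4.IH"(3)] arcs_bounds[OF "4.IH"(4)])
next
  case (6 l A) show ?case using ltip_bounds[of l A]
    by (auto simp: in_arcs dest!: arcs_bounds[OF "6.IH"])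
next
  case (7 l F A) show ?case using ltip_bounds[of "Suc (l + ssize F)" A]
    by (auto simp: in_arcs dest!: arcs_bounds[OF "7.IH"(1)] arcs_bounds[OF "7.IH"(2)])
next
  case (9 l A) show ?case using rtip_bounds[of "Suc l" A]
    by (auto simp: in_arcs dest!: arcs_bounds[OF "9.IH"])
next
  case (10 l F A) show ?case using rtip_bounds[of l A]
    by (auto simp: in_arcs dest!: arcs_bounds[OF "10.IH"(1)] arcs_bounds[OF "10.IH"(2)])
qed auto

lemmas sarcs_bounds = arcs_bounds[OF edges_arcs(1)]
lemmas larcs_bounds = arcs_bounds[OF edges_arcs(2)]
lemmas rarcs_bounds = arcs_bounds[OF edges_arcs(3)]

lemma noncrossingD: "noncrossing E \<Longrightarrow> (i, j) \<in> E \<Longrightarrow> (g, h) \<in> E \<Longrightarrow> \<not> (i < g \<and> g < j \<and> j < h)"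
  unfolding noncrossing_def by blast

lemma noncrossing_Un:
  assumes "noncrossing E1" "noncrossing E2" "E1 \<subseteq> arcs l c" "E2 \<subseteq> arcs c h"
  shows "noncrossing (E1 \<union> E2)"
  unfolding noncrossing_def
proof clarify
  fix i j g h' assume *: "(i, j) \<in> E1 \<union> E2" "(g, h') \<in> E1 \<union> E2" "i < g" "g < j" "j < h'"
  show False
    using *(1,2)
  proof (elim UnE)
    assume "(i, j) \<in> E1" "(g, h') \<in> E1" then show False using noncrossingD[OF assms(1)] * by blast
  next
    assume "(i, j) \<in> E2" "(g, h') \<in> E2" then show False using noncrossingD[OF assms(2)] * by blast
  next
    assume "(i, j) \<in> E1" "(g, h') \<in> E2"
    then show False using arcs_bounds[OF assms(3)] arcs_bounds[OF assms(4)] * by force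
  next
    assume "(i, j) \<in> E2" "(g, h') \<in> E1"
    then show False using arcs_bounds[OF assms(3)] arcs_bounds[OF assms(4)] * by force
  qed
qed

lemma noncrossing_insert:
  assumes "noncrossing E"
    and "\<And>g h. (g, h) \<in> E \<Longrightarrow> \<not> (i < g \<and> g < j \<and> j < h) \<and> \<not> (g < i \<and> i < h \<and> h < j)"
  shows "noncrossing (insert (i, j) E)"
  unfolding noncrossing_def
proof clarify
  fix i' j' g h assume *: "(i', j') \<in> insert (i, j) E" "(g, h) \<in> insert (i, j) E"
    "i' < g" "g < j'" "j' < h"
  show False
    using *(1,2)
  proof (elim insertE)
    assume "(i', j') \<in> E" "(g, h) \<in> E" then show False using noncrossingD[OF assms(1)] * by blast
  next
    assume "(i', j') = (i, j)" "(g, h) \<in> E"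
    then show False using assms(2) *(3-5) by blast
  next
    assume "(g, h) = (i, j)" "(i', j') \<in> E"
    then show False using assms(2) *(3-5) by blast
  qed (use * in auto)
qed

text \<open>Every new arc ends in tips, that is, in extreme vertices of blocks, or in a vertex
  outside all earlier blocks. It therefore passes over each earlier block entirely or not at
  all.\<close>

lemma noncrossing_edges:
  "noncrossing (sarcs l t)" "noncrossing (larcs l A)" "noncrossing (rarcs l A)"
proof (induction l t and l A and l A rule: sarcs_larcs_rarcs.induct)
  case (3 l A t)
  have 1: "noncrossing (insert (ltip l A, l + spsize A) (larcs l A))"
    apply (rule noncrossing_insert[OF "3.IH"(1)])
    apply (drule larcs_bounds)
    using ltip_cases[of l A] spsize_pos(1)[of A] by linarith
  have 2: "insert (ltip l A, l + spsize A) (larcs l A) \<subseteq> arcs l (Suc (l + spsize A))"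
    using edges_arcs(2)[of l "Inner A"] by simp
  show ?case
    using noncrossing_Un[OF 1 "3.IH"(2) 2 edges_arcs(1)] by simp
next
  case (4 l A B F t)
  let ?v = "l + spsize A + spsize B + ssize F"
  have 1: "noncrossing (rarcs (l + spsize A) B \<union> sarcs (l + spsize A + spsize B) F)"
    by (rule noncrossing_Un[OF "4.IH"(2) "4.IH"(3) edges_arcs(3) edges_arcs(1)])
  have s1: "rarcs (l + spsize A) B \<union> sarcs (l + spsize A + spsize B) F \<subseteq> arcs (l + spsize A) ?v"
    by (auto simp: in_arcs dest!: rarcs_bounds sarcs_bounds)
  have 2: "noncrossing (larcs l A \<union> (rarcs (l + spsize A) B \<union> sarcs (l + spsize A + spsize B) F))"
    by (rule noncrossing_Un[OF "4.IH"(1) 1 edges_arcs(2) s1])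
  have b: "((l \<le> g \<and> h < l + spsize A) \<or> (l + spsize A \<le> g \<and> h < l + spsize A + spsize B) \<or>
     (l + spsize A + spsize B \<le> g \<and> h < ?v)) \<and> g < h \<and> h < ?v"
    if "(g, h) \<in> larcs l A \<union> (rarcs (l + spsize A) B \<union> sarcs (l + spsize A + spsize B) F)" for g h
    using that by (auto dest!: rarcs_bounds sarcs_bounds larcs_bounds)
  have 3: "noncrossing (insert (rtip (l + spsize A) B, ?v) (larcs l A \<union> (rarcs (l + spsize A) B \<union> sarcs (l + spsize A + spsize B) F)))"
    apply (rule noncrossing_insert[OF 2])
    apply (drule b)
    using rtip_cases[of "l + spsize A" B] spsize_pos(1)[of B] by linarith
  have 4: "noncrossing (insert (ltip l A, ?v) (insert (rtip (l + spsize A) B, ?v) (larcs l A \<union> (rarcs (l + spsize A) B \<union> sarcs (l + spsize A + spsize B) F))))"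
    apply (rule noncrossing_insert[OF 3])
    apply (erule insertE)
    subgoal using ltip_bounds[of l A] rtip_bounds[of "l + spsize A" B] by auto
    apply (drule b)
    using ltip_cases[of "l" A] spsize_pos(1)[of A] by linarith
  have s4: "insert (ltip l A, ?v) (insert (rtip (l + spsize A) B, ?v) (larcs l A \<union> (rarcs (l + spsize A) B \<union> sarcs (l + spsize A + spsize B) F)))
     \<subseteq> arcs l (Suc ?v)"
    using edges_arcs(1)[of l "Joined A B F Empty"] by (simp add: add.assoc)
  show ?case
    using noncrossing_Un[OF 4 "4.IH"(4) s4 edges_arcs(1)] by simp
next
  case (6 l A)
  have "noncrossing (insert (ltip l A, l + spsize A) (larcs l A))"
    apply (rule noncrossing_insert[OF "6.IH"])
    apply (drule larcs_bounds)
    using ltip_cases[of l A] spsize_pos(1)[of A] by linarith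
  then show ?case by simp
next
  case (7 l F A)
  have 1: "noncrossing (sarcs (Suc l) F \<union> larcs (Suc (l + ssize F)) A)"
    using "7.IH" edges_arcs(1)[of "Suc l" F] edges_arcs(2)[of "Suc (l + ssize F)" A]
    by (intro noncrossing_Un[where l = "Suc l" and c = "Suc (l + ssize F)" and h = "Suc (l + ssize F) + spsize A"])
       (auto simp: add.commute)
  have b: "l < g \<and> g < h \<and> (h < l + ssize F + 1 \<or> (l + ssize F + 1 \<le> g \<and> h < l + ssize F + 1 + spsize A))"
    if "(g, h) \<in> sarcs (Suc l) F \<union> larcs (Suc (l + ssize F)) A" for g h
    using that by (auto dest!: sarcs_bounds larcs_bounds)
  have "noncrossing (insert (l, ltip (Suc (l + ssize F)) A) (sarcs (Suc l) F \<union> larcs (Suc (l + ssize F)) A))"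
    apply (rule noncrossing_insert[OF 1])
    apply (drule b)
    using ltip_cases[of "Suc (l + ssize F)" A] spsize_pos(1)[of A] by linarith
  then show ?case by simp
next
  case (9 l A)
  have "noncrossing (insert (l, rtip (Suc l) A) (rarcs (Suc l) A))"
    apply (rule noncrossing_insert[OF "9.IH"])
    apply (drule rarcs_bounds)
    using rtip_cases[of "Suc l" A] spsize_pos(1)[of A] by linarith
  then show ?case by simp
next
  case (10 l F A)
  have 1: "noncrossing (rarcs l A \<union> sarcs (l + spsize A) F)"
    by (rule noncrossing_Un[OF "10.IH" edges_arcs(3) edges_arcs(1)])
  have b: "g < h \<and> h < l + spsize A + ssize F \<and> ((l \<le> g \<and> h < l + spsize A) \<or> l + spsize A \<le> g)"
    if "(g, h) \<in> rarcs l A \<union> sarcs (l + spsize A) F" for g h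
    using that by (auto dest!: sarcs_bounds rarcs_bounds)
  have "noncrossing (insert (rtip l A, l + spsize A + ssize F) (rarcs l A \<union> sarcs (l + spsize A) F))"
    apply (rule noncrossing_insert[OF 1])
    apply (drule b)
    using rtip_cases[of l A] spsize_pos(1)[of A] by linarith
  then show ?case by simp
qed (auto simp: noncrossing_def)

lemma coversD: "covers l h E \<Longrightarrow> l < c \<Longrightarrow> c < h \<Longrightarrow> \<exists>i j. (i, j) \<in> E \<and> i < c \<and> c \<le> j"
  unfolding covers_def by blast

lemma covers_right:
  assumes "covers l d E" "E \<subseteq> E'" "i < d" "h \<le> Suc j"
  shows "covers l h (insert (i, j) E')"
  unfolding covers_def
proof (intro allI impI)
  fix c assume c: "l < c" "c < h"
  show "\<exists>(i, j)\<in>insert (i, j) E'. i < c \<and> c \<le> j"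
  proof (cases "c < d")
    case True then show ?thesis using coversD[OF assms(1) c(1)] assms(2) by blast
  qed (use c assms in auto)
qed

lemma covers_left:
  assumes "covers d h E" "E \<subseteq> E'" "i \<le> l" "d \<le> j"
  shows "covers l h (insert (i, j) E')"
  unfolding covers_def
proof (intro allI impI)
  fix c assume c: "l < c" "c < h"
  show "\<exists>(i, j)\<in>insert (i, j) E'. i < c \<and> c \<le> j"
  proof (cases "d < c")
    case True then show ?thesis using coversD[OF assms(1) _ c(2)] assms(2) by blast
  qed (use c assms in auto)
qed

text \<open>The arc to a new vertex leaves from the old tip and passes over everything between,
  including a nested system, so no cut on the way stays free.\<close>

lemma covers_spirals: "covers l (l + spsize A) (larcs l A) \<and> covers l (l + spsize A) (rarcs l A)"
\<comment> \<open>The trivial predicate for systems turns the mutual rule into an induction on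
  spirals alone.\<close>
proof (induction A arbitrary: l rule: spiral.induct[of "\<lambda>_. True"])
  case (Inner A)
  show ?case unfolding larcs.simps rarcs.simps
    by (intro conjI covers_right[OF conjunct1[OF Inner[of l]]] covers_left[where d = "Suc l" and E = "rarcs (Suc l) A"])
       (use Inner[of "Suc l"] ltip_bounds[of l A] rtip_bounds[of "Suc l" A] in auto)
next
  case (Outer F A)
  show ?case unfolding larcs.simps rarcs.simps
    by (intro conjI covers_right[OF conjunct2[OF Outer(2)[of l]]]
          covers_left[where d = "Suc (l + ssize F)" and E = "larcs (Suc (l + ssize F)) A"])
       (use Outer(2)[of "Suc (l + ssize F)"] ltip_bounds[of "Suc (l + ssize F)" A] rtip_bounds[of l A] in \<open>auto simp: ac_simps\<close>)
qed (auto simp: covers_def)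

lemmas covers_larcs = covers_spirals[THEN conjunct1]
lemmas covers_rarcs = covers_spirals[THEN conjunct2]

lemma arcs_disjoint: "E \<subseteq> arcs l c \<Longrightarrow> E' \<subseteq> arcs c' h \<Longrightarrow> c \<le> c' \<Longrightarrow> E \<inter> E' = {}"
  unfolding arcs_def by fastforce

(* The place where the first part ends is the first one not passed by an arc. *)
lemma split_first:
  assumes "E1 \<union> E2 = E1' \<union> E2'" "E1 \<subseteq> arcs l c" "E2 \<subseteq> arcs c h" "E1' \<subseteq> arcs l c'" "E2' \<subseteq> arcs c' h"
    "covers l c E1" "covers l c' E1'" "l < c" "l < c'"
  shows "c = c' \<and> E1 = E1' \<and> E2 = E2'"
proof -
  have nlt: "\<not> d < d'" if un: "F1 \<union> F2 = F1' \<union> F2'" and ar: "F1 \<subseteq> arcs l d" "F2 \<subseteq> arcs d h" 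
      and cov: "covers l d' F1'" "l < d" for F1 F2 F1' F2' d d'
  proof
    assume "d < d'"
    then obtain i j where "(i, j) \<in> F1'" "i < d" "d \<le> j" using cov unfolding covers_def by blast
    moreover have "(i, j) \<in> F1 \<union> F2" using calculation un by blast
    ultimately show False using ar by (auto simp: arcs_def)
  qed
  have c: "c = c'" using nlt[of E1 E2 E1' E2' c c'] nlt[of E1' E2' E1 E2 c' c] assms by (metis nat_neq_iff)
  have "E1 \<inter> E2' = {}" "E2 \<inter> E1' = {}"
    using arcs_disjoint[OF assms(2,5)] arcs_disjoint[OF assms(4,3)] c by auto
  then show ?thesis using c assms(1) by blast
qed

text \<open>Mirror image of \<open>split_first\<close>, for the outer extension of a left spiral:
  there the nested system, which may have free cuts, comes first and the covered spiral
  last.\<close>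

lemma split_last:
  assumes "E1 \<union> E2 = E1' \<union> E2'" "E1 \<subseteq> arcs l c" "E2 \<subseteq> arcs c h" "E1' \<subseteq> arcs l c'" "E2' \<subseteq> arcs c' h"
    "covers c h E2" "covers c' h E2'" "c < h" "c' < h"
  shows "c = c' \<and> E1 = E1' \<and> E2 = E2'"
proof -
  have nlt: "\<not> d' < d" if un: "F1 \<union> F2 = F1' \<union> F2'" and ar: "F1 \<subseteq> arcs l d" "F2 \<subseteq> arcs d h" 
      and cov: "covers d' h F2'" "d < h" for F1 F2 F1' F2' d d'
  proof
    assume "d' < d"
    then obtain i j where "(i, j) \<in> F2'" "i < d" "d \<le> j" using cov unfolding covers_def by blast
    moreover have "(i, j) \<in> F1 \<union> F2" using calculation un by blast
    ultimately show False using ar by (auto simp: arcs_def)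
  qed
  have c: "c = c'" using nlt[of E1 E2 E1' E2' c c'] nlt[of E1' E2' E1 E2 c' c] assms by (metis nat_neq_iff)
  have "E1 \<inter> E2' = {}" "E2 \<inter> E1' = {}"
    using arcs_disjoint[OF assms(2,5)] arcs_disjoint[OF assms(4,3)] c by auto
  then show ?thesis using c assms(1) by blast
qed


fun head_size :: "sys \<Rightarrow> nat" where
  "head_size Empty = 0"
| "head_size (Isolated t) = 1"
| "head_size (Closed A t) = spsize A + 1"
| "head_size (Joined A B F t) = spsize A + spsize B + ssize F + 1"

fun head_arcs :: "nat \<Rightarrow> sys \<Rightarrow> (nat \<times> nat) set" where
  "head_arcs l (Closed A t) = insert (ltip l A, l + spsize A) (larcs l A)"
| "head_arcs l (Joined A B F t) =
     {(ltip l A, l + spsize A + spsize B + ssize F), (rtip (l + spsize A) B, l + spsize A + spsize B + ssize F)}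
     \<union> (larcs l A \<union> (rarcs (l + spsize A) B \<union> sarcs (l + spsize A + spsize B) F))"
| "head_arcs l t = {}"

fun sys_tail :: "sys \<Rightarrow> sys" where
  "sys_tail Empty = Empty"
| "sys_tail (Isolated t) = t"
| "sys_tail (Closed A t) = t"
| "sys_tail (Joined A B F t) = t"

lemma sarcs_split: "sarcs l t = head_arcs l t \<union> sarcs (l + head_size t) (sys_tail t)"
  by (cases t) (auto simp: add.assoc)

lemma ssize_split: "ssize t = head_size t + ssize (sys_tail t)"
  by (cases t) auto

lemma head_arcs_arcs: "head_arcs l t \<subseteq> arcs l (l + head_size t)"
  using edges_arcs(1)[of l "Closed _ Empty"] edges_arcs(1)[of l "Joined _ _ _ Empty"]
  by (cases t) (auto simp: add.assoc)

lemma head_arcs_covers: "covers l (l + head_size t) (head_arcs l t)"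
proof (cases t)
  case (Closed A t')
  then show ?thesis
    using covers_right[OF covers_larcs[of l A] order_refl, of "ltip l A"] ltip_bounds[of l A] by simp
next
  case (Joined A B F t')
  let ?v = "l + spsize A + spsize B + ssize F"
  have "covers l (l + head_size t) (insert (ltip l A, ?v) (insert (rtip (l + spsize A) B, ?v)
      (larcs l A \<union> (rarcs (l + spsize A) B \<union> sarcs (l + spsize A + spsize B) F))))"
    by (rule covers_right[OF covers_larcs[of l A]]) (use Joined ltip_bounds[of l A] in auto)
  then show ?thesis using Joined by simp
qed (auto simp: covers_def)

text \<open>The head is covered and no arc leaves it, so it ends at the first free cut, and
  \<open>split_first\<close> recovers head and tail from their union. The size belongs to the data
  because isolated points leave no arc.\<close>

lemma sarcs_split_unique:
  assumes "sarcs l t = sarcs l t'" "ssize t = ssize t'" "t \<noteq> Empty"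
  shows "head_size t = head_size t'" "head_arcs l t = head_arcs l t'"
    "sarcs (l + head_size t) (sys_tail t) = sarcs (l + head_size t) (sys_tail t')" "ssize (sys_tail t) = ssize (sys_tail t')"
proof -
  have "ssize t > 0" using assms(3) by (cases t) auto
  then have t': "t' \<noteq> Empty" using assms(2) by (cases t') auto
  have pos: "0 < head_size t" using assms(3) by (cases t) auto
  have pos': "0 < head_size t'" using t' by (cases t') auto
  have eq: "head_arcs l t \<union> sarcs (l + head_size t) (sys_tail t) = head_arcs l t' \<union> sarcs (l + head_size t') (sys_tail t')"
    using assms(1) sarcs_split by metis
  have *: "l + head_size t = l + head_size t' \<and> head_arcs l t = head_arcs l t' \<and>
      sarcs (l + head_size t) (sys_tail t) = sarcs (l + head_size t') (sys_tail t')"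
  proof (rule split_first[OF eq head_arcs_arcs _ head_arcs_arcs _ head_arcs_covers head_arcs_covers])
    show "sarcs (l + head_size t) (sys_tail t) \<subseteq> arcs (l + head_size t) (l + ssize t)"
      using edges_arcs(1)[of "l + head_size t" "sys_tail t"] ssize_split[of t] by (simp add: add.assoc)
    show "sarcs (l + head_size t') (sys_tail t') \<subseteq> arcs (l + head_size t') (l + ssize t)"
      using edges_arcs(1)[of "l + head_size t'" "sys_tail t'"] ssize_split[of t'] assms(2) by (simp add: add.assoc)
  qed (use pos pos' in auto)
  then show "head_size t = head_size t'" "head_arcs l t = head_arcs l t'"
    "sarcs (l + head_size t) (sys_tail t) = sarcs (l + head_size t) (sys_tail t')" "ssize (sys_tail t) = ssize (sys_tail t')"
    using assms(2) ssize_split[of t] ssize_split[of t'] by auto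
qed

text \<open>The vertex \<open>v\<close> exceeds all vertices of the other arcs, so the arc ending
  there can be recognised in the union.\<close>

lemma insert_top_eq:
  assumes "insert (x, v) E = insert (x', v) E'" "E \<subseteq> arcs l v" "E' \<subseteq> arcs l v"
  shows "x = x' \<and> E = E'"
proof -
  have n: "(y, v) \<notin> E" "(y, v) \<notin> E'" for y using assms(2,3) by (auto simp: arcs_def)
  then have "x = x'" using assms(1) by blast
  then show ?thesis using assms(1) n[of x] by (simp add: insert_ident)
qed

lemma insert_bot_eq:
  assumes "insert (v, x) E = insert (v, x') E'" "E \<subseteq> arcs (Suc v) h" "E' \<subseteq> arcs (Suc v) h"
  shows "x = x' \<and> E = E'"
proof -
  have n: "(v, y) \<notin> E" "(v, y) \<notin> E'" for y using assms(2,3) by (auto simp: arcs_def)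
  then have "x = x'" using assms(1) by blast
  then show ?thesis using assms(1) n[of x] by (simp add: insert_ident)
qed

lemma insert2_top_eq:
  assumes "{(x, v), (y, v)} \<union> E = {(x', v), (y', v)} \<union> E'" "E \<subseteq> arcs l v" "E' \<subseteq> arcs l v"
    "x < y" "x' < y'"
  shows "x = x' \<and> y = y' \<and> E = E'"
proof -
  have n: "(y, v) \<notin> E" "(y, v) \<notin> E'" for y using assms(2,3) by (auto simp: arcs_def)
  have "(x, v) \<in> {(x', v), (y', v)} \<union> E'" "(y, v) \<in> {(x', v), (y', v)} \<union> E'"
    "(x', v) \<in> {(x, v), (y, v)} \<union> E" "(y', v) \<in> {(x, v), (y, v)} \<union> E"
    using assms(1) by blast+
  then have xy: "x = x'" "y = y'" using n assms(4,5) by auto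
  have "E = ({(x, v), (y, v)} \<union> E) - {(x, v), (y, v)}" using n by blast
  also have "\<dots> = ({(x', v), (y', v)} \<union> E') - {(x, v), (y, v)}" using assms(1) by simp
  also have "\<dots> = E'" using n xy by blast
  finally show ?thesis using xy by simp
qed

text \<open>The last vertex \<open>v\<close> lies on one arc of a closed path but on two arcs of a
  joined one, so these constructors cannot produce the same arcs.\<close>

lemma insert12_top_neq:
  assumes "insert (x, v) E = {(x', v), (y', v)} \<union> E'" "E \<subseteq> arcs l v" "x' < y'"
  shows False
proof -
  have n: "(y, v) \<notin> E" for y using assms(2) by (auto simp: arcs_def)
  have "(x', v) \<in> insert (x, v) E" "(y', v) \<in> insert (x, v) E" using assms(1) by blast+
  then show False using n assms(3) by auto
qed

lemma Joined_inner_arcs: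
  "rarcs (l + spsize A) B \<union> sarcs (l + spsize A + spsize B) F \<subseteq> arcs (l + spsize A) (l + spsize A + spsize B + ssize F)"
  "larcs l A \<union> (rarcs (l + spsize A) B \<union> sarcs (l + spsize A + spsize B) F) \<subseteq> arcs l (l + spsize A + spsize B + ssize F)"
  by (auto simp: in_arcs dest!: larcs_bounds rarcs_bounds sarcs_bounds)

lemma Joined_tips: "ltip l A < rtip (l + spsize A) B"
  using ltip_bounds[of l A] rtip_bounds[of "l + spsize A" B] by linarith

text \<open>Decoding peels off the last vertex of the first component, or the newest vertex of a
  spiral, and splits the rest at its free cuts. For spirals the tip must be known too:
  \<open>Inner Start\<close> and \<open>Outer Empty Start\<close> have the same single arc as left
  spirals and differ only in which end is the tip.\<close>

lemma edges_inject:
  "sarcs l t = sarcs l t' \<Longrightarrow> ssize t = ssize t' \<Longrightarrow> t = t'"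
  "larcs l A = larcs l A' \<Longrightarrow> ltip l A = ltip l A' \<Longrightarrow> spsize A = spsize A' \<Longrightarrow> A = A'"
  "rarcs l A = rarcs l A' \<Longrightarrow> rtip l A = rtip l A' \<Longrightarrow> spsize A = spsize A' \<Longrightarrow> A = A'"
proof (induction l t and l A and l A arbitrary: t' and A' and A' rule: sarcs_larcs_rarcs.induct)
  case (1 l)
  then show ?case by (cases t') auto
next
  case (2 l t)
  have ne: "Isolated t \<noteq> Empty" by simp
  note u = sarcs_split_unique[OF "2.prems" ne]
  show ?case
  proof (cases t')
    case (Isolated t'')
    then show ?thesis using "2.IH" u by auto
  qed (use u "2.prems" in auto)
next
  case (3 l A t)
  have ne: "Closed A t \<noteq> Empty" by simp
  note u = sarcs_split_unique[OF "3.prems" ne]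
  show ?case
  proof (cases t')
    case (Closed A' t'')
    have n: "spsize A = spsize A'" using u(1) Closed by simp
    have "ltip l A = ltip l A' \<and> larcs l A = larcs l A'"
      by (rule insert_top_eq[where l = l and v = "l + spsize A"])
         (use u(2) n Closed edges_arcs(2)[of l A] edges_arcs(2)[of l A'] in auto)
    then show ?thesis using "3.IH"(1)[of A'] "3.IH"(2)[of t''] n u(3,4) Closed by simp
  next
    case (Joined A' B' F' t'')
    have v: "l + spsize A = l + spsize A' + spsize B' + ssize F'" using u(1) Joined by simp
    have False
      by (rule insert12_top_neq[OF u(2)[unfolded Joined head_arcs.simps, folded v]
          edges_arcs(2)[of l A] Joined_tips])
    then show ?thesis ..
  qed (use u "3.prems" in auto)
next
  case (4 l A B F t)
  have ne: "Joined A B F t \<noteq> Empty" by simp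
  note u = sarcs_split_unique[OF "4.prems" ne]
  show ?case
  proof (cases t')
    case (Closed A' t'')
    have v: "l + spsize A' = l + spsize A + spsize B + ssize F" using u(1) Closed by simp
    have False
      by (rule insert12_top_neq[OF u(2)[unfolded Closed head_arcs.simps, folded v, symmetric]
          edges_arcs(2)[of l A'] Joined_tips])
    then show ?thesis ..
  next
    case (Joined A' B' F' t'')
    let ?v = "l + spsize A + spsize B + ssize F"
    have v: "?v = l + spsize A' + spsize B' + ssize F'" using u(1) Joined by simp
    have i: "ltip l A = ltip l A' \<and> rtip (l + spsize A) B = rtip (l + spsize A') B' \<and>
      larcs l A \<union> (rarcs (l + spsize A) B \<union> sarcs (l + spsize A + spsize B) F) =
      larcs l A' \<union> (rarcs (l + spsize A') B' \<union> sarcs (l + spsize A' + spsize B') F')"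
      by (rule insert2_top_eq[OF u(2)[unfolded Joined head_arcs.simps, folded v] Joined_inner_arcs(2)
          Joined_inner_arcs(2)[of l A' B' F', folded v] Joined_tips Joined_tips])
    have j: "l + spsize A = l + spsize A' \<and> larcs l A = larcs l A' \<and>
        rarcs (l + spsize A) B \<union> sarcs (l + spsize A + spsize B) F = rarcs (l + spsize A') B' \<union> sarcs (l + spsize A' + spsize B') F'"
      by (rule split_first[OF conjunct2[OF conjunct2[OF i]] edges_arcs(2) Joined_inner_arcs(1) edges_arcs(2)
            Joined_inner_arcs(1)[of l A' B' F', folded v] covers_larcs covers_larcs]) auto
    have k: "l + spsize A + spsize B = l + spsize A' + spsize B' \<and> rarcs (l + spsize A) B = rarcs (l + spsize A') B' \<and>
        sarcs (l + spsize A + spsize B) F = sarcs (l + spsize A' + spsize B') F'"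
    proof (rule split_first[OF conjunct2[OF conjunct2[OF j]] edges_arcs(3) edges_arcs(1) _ _ covers_rarcs])
      show "rarcs (l + spsize A') B' \<subseteq> arcs (l + spsize A) (l + spsize A' + spsize B')"
        using edges_arcs(3)[of "l + spsize A'" B'] j by auto
      show "sarcs (l + spsize A' + spsize B') F' \<subseteq> arcs (l + spsize A' + spsize B') ?v"
        using edges_arcs(1)[of "l + spsize A' + spsize B'" F'] unfolding v .
      show "covers (l + spsize A) (l + spsize A' + spsize B') (rarcs (l + spsize A') B')"
        using covers_rarcs[of "l + spsize A'" B'] j by auto
    qed (use j in auto)
    have "A = A'" by (rule "4.IH"(1)) (use i j in auto)
    moreover have "B = B'" by (rule "4.IH"(2)) (use i j k in auto)
    moreover have "F = F'" by (rule "4.IH"(3)) (use i j k v in auto)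
    moreover have "t = t''" by (rule "4.IH"(4)) (use u(3,4) Joined in \<open>auto simp: add.assoc\<close>)
    ultimately show ?thesis using Joined by simp
  qed (use u "4.prems" in auto)
next
  case (5 l)
  then show ?case by (cases A') auto
next
  case (6 l A)
  show ?case
  proof (cases A')
    case Start then show ?thesis using "6.prems" by simp
  next
    case (Inner B)
    have n: "spsize A = spsize B" using "6.prems" Inner by simp
    have "ltip l A = ltip l B \<and> larcs l A = larcs l B"
      by (rule insert_top_eq[where l = l and v = "l + spsize A"])
         (use "6.prems" n Inner edges_arcs(2)[of l A] edges_arcs(2)[of l B] in auto)
    then show ?thesis using "6.IH"[of B] n Inner by simp
  next
    case (Outer F B) then show ?thesis using "6.prems" by simp
  qed
next
  case (7 l F A)
  show ?case
  proof (cases A')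
    case Start then show ?thesis using "7.prems" by simp
  next
    case (Inner B) then show ?thesis using "7.prems" by simp
  next
    case (Outer G B)

    have n: "Suc (l + ssize F) + spsize A = Suc (l + ssize G) + spsize B" using "7.prems" Outer by simp
    have ar: "sarcs (Suc l) F \<union> larcs (Suc (l + ssize F)) A \<subseteq> arcs (Suc l) (Suc (l + ssize F) + spsize A)" for F A
      by (auto simp: in_arcs dest!: larcs_bounds sarcs_bounds)
    have i: "ltip (Suc (l + ssize F)) A = ltip (Suc (l + ssize G)) B \<and>
        sarcs (Suc l) F \<union> larcs (Suc (l + ssize F)) A = sarcs (Suc l) G \<union> larcs (Suc (l + ssize G)) B"
      by (rule insert_bot_eq[OF "7.prems"(1)[unfolded Outer larcs.simps] ar ar[of G B, folded n]])
    have j: "Suc (l + ssize F) = Suc (l + ssize G) \<and> sarcs (Suc l) F = sarcs (Suc l) G \<and>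
        larcs (Suc (l + ssize F)) A = larcs (Suc (l + ssize G)) B"
      by (rule split_last[OF conjunct2[OF i] edges_arcs(1)[of "Suc l" F, simplified] edges_arcs(2)
            edges_arcs(1)[of "Suc l" G, simplified] edges_arcs(2)[of "Suc (l + ssize G)" B, folded n]
            covers_larcs covers_larcs[of "Suc (l + ssize G)" B, folded n]]) (use n in auto)
    have "F = G" by (rule "7.IH"(1)) (use j in auto)
    moreover have "A = B" by (rule "7.IH"(2)) (use i j n in auto)
    ultimately show ?thesis using Outer by simp
  qed
next
  case (8 l)
  then show ?case by (cases A') auto
next
  case (9 l A)
  show ?case
  proof (cases A')
    case Start then show ?thesis using "9.prems" by simp
  next
    case (Inner B)
    have n: "spsize A = spsize B" using "9.prems" Inner by simp
    have "rtip (Suc l) A = rtip (Suc l) B \<and> rarcs (Suc l) A = rarcs (Suc l) B"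
      by (rule insert_bot_eq[where v = l and h = "Suc l + spsize A"])
         (use "9.prems" n Inner edges_arcs(3)[of "Suc l" A] edges_arcs(3)[of "Suc l" B] in auto)
    then show ?thesis using "9.IH"[of B] n Inner by simp
  next
    case (Outer F B) then show ?thesis using "9.prems" by (cases B) auto
  qed
next
  case (10 l F A)
  show ?case
  proof (cases A')
    case Start then show ?thesis using "10.prems" by simp
  next
    case (Inner B) then show ?thesis using "10.prems" by simp
  next
    case (Outer G B)
    let ?v = "l + spsize A + ssize F"
    have n: "?v = l + spsize B + ssize G" using "10.prems" Outer by simp
    have ar: "rarcs l A \<union> sarcs (l + spsize A) F \<subseteq> arcs l (l + spsize A + ssize F)" for F A
      by (auto simp: in_arcs dest!: rarcs_bounds sarcs_bounds)
    have i: "rtip l A = rtip l B \<and> rarcs l A \<union> sarcs (l + spsize A) F = rarcs l B \<union> sarcs (l + spsize B) G"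
      by (rule insert_top_eq[OF "10.prems"(1)[unfolded Outer rarcs.simps, folded n] ar ar[of B G, folded n]])
    have j: "l + spsize A = l + spsize B \<and> rarcs l A = rarcs l B \<and> sarcs (l + spsize A) F = sarcs (l + spsize B) G"
      by (rule split_first[OF conjunct2[OF i] edges_arcs(3) edges_arcs(1) edges_arcs(3)
            edges_arcs(1)[of "l + spsize B" G, folded n] covers_rarcs covers_rarcs]) auto
    have "F = G" by (rule "10.IH"(2)) (use j n in auto)
    moreover have "A = B" by (rule "10.IH"(1)) (use i j in auto)
    ultimately show ?thesis using Outer by simp
  qed
qed

section \<open>Paths of a system and the order of their endpoints\<close>

primrec left_path :: "nat \<Rightarrow> spiral \<Rightarrow> nat list" where
  "left_path l Start = [l]"
| "left_path l (Inner A) = left_path l A @ [l + spsize A]"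
| "left_path l (Outer F A) = left_path (Suc (l + ssize F)) A @ [l]"

primrec right_path :: "nat \<Rightarrow> spiral \<Rightarrow> nat list" where
  "right_path l Start = [l]"
| "right_path l (Inner B) = right_path (Suc l) B @ [l]"
| "right_path l (Outer F B) = right_path l B @ [l + spsize B + ssize F]"

text \<open>The list is ordered by endpoints. The endpoints of a joined path are the starts of its
  two spirals; the systems nested in the left spiral lie to the left of its start and come before
  the path, those nested in the right spiral come after it.\<close>

fun paths :: "nat \<Rightarrow> sys \<Rightarrow> nat list list"
  and left_nested :: "nat \<Rightarrow> spiral \<Rightarrow> nat list list"
  and right_nested :: "nat \<Rightarrow> spiral \<Rightarrow> nat list list" where
  "paths l Empty = []"
| "paths l (Isolated t) = [l] # paths (Suc l) t"
| "paths l (Closed A t) = left_nested l A @ (left_path l A @ [l + spsize A]) # paths (Suc (l + spsize A)) t"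
| "paths l (Joined A B F t) =
     left_nested l A @ (left_path l A @ (l + spsize A + spsize B + ssize F) # rev (right_path (l + spsize A) B))
     # right_nested (l + spsize A) B @ paths (l + spsize A + spsize B) F @ paths (Suc (l + spsize A + spsize B + ssize F)) t"
| "left_nested l Start = []"
| "left_nested l (Inner A) = left_nested l A"
| "left_nested l (Outer F A) = paths (Suc l) F @ left_nested (Suc (l + ssize F)) A"
| "right_nested l Start = []"
| "right_nested l (Inner B) = right_nested (Suc l) B"
| "right_nested l (Outer F B) = right_nested l B @ paths (l + spsize B) F"

fun parcs :: "nat list \<Rightarrow> (nat \<times> nat) set" where
  "parcs (x # y # zs) = insert (min x y, max x y) (parcs (y # zs))"
| "parcs _ = {}"

fun ends_in :: "nat \<Rightarrow> nat \<Rightarrow> nat list list \<Rightarrow> bool" where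
  "ends_in l h [] \<longleftrightarrow> l \<le> h"
| "ends_in l h (p # ps) \<longleftrightarrow>
     p \<noteq> [] \<and> l \<le> hd p \<and> hd p \<le> last p \<and> last p < h \<and> ends_in (Suc (last p)) h ps"

lemma left_path_ne [simp]: "left_path l A \<noteq> []" and right_path_ne [simp]: "right_path l A \<noteq> []"
  by (cases A; simp)+

lemma last_left_path [simp]: "last (left_path l A) = ltip l A" and last_right_path [simp]: "last (right_path l A) = rtip l A"
  by (cases A; simp)+

lemma hd_left_path_bounds: "l \<le> hd (left_path l A) \<and> hd (left_path l A) < l + spsize A"
proof (induction A arbitrary: l rule: spiral.induct[of "\<lambda>_. True"])
  case (Inner A)
  have "hd (left_path l (Inner A)) = hd (left_path l A)" by simp
  then show ?case using Inner[of l] unfolding spsize.simps by linarith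
next
  case (Outer F A)
  have "hd (left_path l (Outer F A)) = hd (left_path (Suc (l + ssize F)) A)" by simp
  then show ?case using Outer(2)[of "Suc (l + ssize F)"] unfolding spsize.simps by linarith
qed auto

lemma hd_right_path_bounds: "l \<le> hd (right_path l A) \<and> hd (right_path l A) < l + spsize A"
proof (induction A arbitrary: l rule: spiral.induct[of "\<lambda>_. True"])
  case (Inner A)
  have "hd (right_path l (Inner A)) = hd (right_path (Suc l) A)" by simp
  then show ?case using Inner[of "Suc l"] unfolding spsize.simps by linarith
next
  case (Outer F A)
  have "hd (right_path l (Outer F A)) = hd (right_path l A)" by simp
  then show ?case using Outer(2)[of l] unfolding spsize.simps by linarith
qed auto

lemma ends_in_le: "ends_in l h ps \<Longrightarrow> l \<le> h"
  by (induction l h ps rule: ends_in.induct) auto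

lemma ends_in_mono: "ends_in l h ps \<Longrightarrow> l' \<le> l \<Longrightarrow> h \<le> h' \<Longrightarrow> ends_in l' h' ps"
  by (induction l h ps arbitrary: l' rule: ends_in.induct) auto

lemma ends_in_append: "ends_in l c ps \<Longrightarrow> ends_in c h qs \<Longrightarrow> ends_in l h (ps @ qs)"
proof (induction l c ps rule: ends_in.induct)
  case (1 l c) then show ?case using ends_in_mono by auto
next
  case (2 l c p ps) then show ?case using ends_in_le[of c h qs] by auto
qed

text \<open>Nested systems occur only on the outer side of a spiral: to the left of the start of a
  left one, to the right of the start of a right one. So no endpoint of another path falls between
  the two endpoints of a path.\<close>

lemma ends_in_paths:
  "ends_in l (l + ssize t) (paths l t)"
  "ends_in l (hd (left_path l A)) (left_nested l A)"
  "ends_in (Suc (hd (right_path l B))) (l + spsize B) (right_nested l B)"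
proof (induction l t and l A and l B rule: paths_left_nested_right_nested.induct)
  case (2 l t) then show ?case by simp
next
  case (3 l A t)
  have "ends_in l (l + ssize (Closed A t)) (left_nested l A @ ((left_path l A @ [l + spsize A]) # paths (Suc (l + spsize A)) t))"
    by (rule ends_in_append[OF "3.IH"(1)])
       (use "3.IH"(2) hd_left_path_bounds[of l A] in \<open>simp add: add.assoc\<close>)
  then show ?case by simp
next
  case (4 l A B F t)
  let ?v = "l + spsize A + spsize B + ssize F"
  have 1: "ends_in (Suc (hd (right_path (l + spsize A) B))) ?v (right_nested (l + spsize A) B @ paths (l + spsize A + spsize B) F)"
    by (rule ends_in_append[OF "4.IH"(2) "4.IH"(3)])
  have 2: "ends_in (Suc (hd (right_path (l + spsize A) B))) (Suc ?v + ssize t)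
      ((right_nested (l + spsize A) B @ paths (l + spsize A + spsize B) F) @ paths (Suc ?v) t)"
    by (rule ends_in_append[OF 1 ends_in_mono[OF "4.IH"(4)]]) auto
  have "ends_in l (Suc ?v + ssize t) (left_nested l A @ ((left_path l A @ ?v # rev (right_path (l + spsize A) B)) #
      ((right_nested (l + spsize A) B @ paths (l + spsize A + spsize B) F) @ paths (Suc ?v) t)))"
    by (rule ends_in_append[OF "4.IH"(1)])
       (use 2 hd_left_path_bounds[of l A] hd_right_path_bounds[of "l + spsize A" B] in \<open>simp add: last_rev\<close>)
  then show ?case by (simp add: add.assoc)
next
  case (6 l A) then show ?case by simp
next
  case (7 l F A)
  show ?case using ends_in_append[OF "7.IH"[simplified]] by (auto intro: ends_in_mono)
next
  case (9 l A) then show ?case by simp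
next
  case (10 l F A)
  show ?case using ends_in_append[OF "10.IH"] by (auto intro: ends_in_mono)
qed auto

lemma upt_split: "[l..<l + (a + b)] = [l..<l + a] @ [l + a..<l + a + b]"
  by (metis add.assoc upt_add_eq_append le_add1)

lemma mset_upt_split:
  "mset [l..<l + (a + b)] = mset [l..<l + a] + mset [l + a..<l + a + b]"
  by (simp only: upt_split mset_append)

lemma mset_upt_Cons: "mset [l..<l + Suc n] = add_mset l (mset [Suc l..<Suc l + n])"
  by (simp add: upt_conv_Cons del: upt_Suc)

text \<open>Multisets settle at once that all vertices are used and that none is used twice, be it
  by one path or by two.\<close>

lemma mset_paths:
  "mset (concat (paths l t)) = mset [l..<l + ssize t]"
  "mset (concat (left_nested l A)) + mset (left_path l A) = mset [l..<l + spsize A]"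
  "mset (concat (right_nested l B)) + mset (right_path l B) = mset [l..<l + spsize B]"
proof (induction l t and l A and l B rule: paths_left_nested_right_nested.induct)
  case (2 l t)
  then show ?case using mset_upt_Cons[of l "ssize t"] by (simp del: upt_Suc)
next
  case (3 l A t)
  have "mset (concat (paths l (Closed A t))) = mset [l..<l + spsize A] + {#l + spsize A#} + mset [Suc (l + spsize A)..<Suc (l + spsize A) + ssize t]"
    using 3 by (simp del: upt_Suc)
  also have "\<dots> = mset [l..<l + (spsize A + Suc (ssize t))]"
    unfolding mset_upt_split mset_upt_Cons by (simp del: upt_Suc)
  also have "spsize A + Suc (ssize t) = ssize (Closed A t)" by simp
  finally show ?case .
next
  case (4 l A B F t)
  let ?v = "l + spsize A + spsize B + ssize F"
  have "mset (concat (paths l (Joined A B F t))) = mset [l..<l + spsize A] + (mset [l + spsize A..<l + spsize A + spsize B]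
     + (mset [l + spsize A + spsize B..<l + spsize A + spsize B + ssize F] + ({#?v#} + mset [Suc ?v..<Suc ?v + ssize t])))"
    unfolding "4.IH"[symmetric] by (simp add: ac_simps)
  also have "\<dots> = mset [l..<l + (spsize A + (spsize B + (ssize F + Suc (ssize t))))]"
    unfolding mset_upt_split mset_upt_Cons by (simp del: upt_Suc)
  also have "spsize A + (spsize B + (ssize F + Suc (ssize t))) = ssize (Joined A B F t)" by simp
  finally show ?case .
next
  case (6 l A)
  then show ?case by simp
next
  case (7 l F A)
  have "mset (concat (left_nested l (Outer F A))) + mset (left_path l (Outer F A)) =
     {#l#} + (mset [Suc l..<Suc l + ssize F] + mset [Suc (l + ssize F)..<Suc (l + ssize F) + spsize A])"
    unfolding "7.IH"[symmetric] by (simp add: ac_simps)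
  also have "\<dots> = {#l#} + mset [Suc l..<Suc l + (ssize F + spsize A)]"
    unfolding mset_upt_split by (simp del: upt_Suc)
  also have "\<dots> = mset [l..<l + spsize (Outer F A)]"
    using mset_upt_Cons[of l "ssize F + spsize A"] by (simp add: ac_simps del: upt_Suc)
  finally show ?case .
next
  case (9 l A)
  have "mset (concat (right_nested l (Inner A))) + mset (right_path l (Inner A)) = {#l#} + mset [Suc l..<Suc l + spsize A]"
    unfolding "9"[symmetric] by (simp add: ac_simps)
  also have "\<dots> = mset [l..<l + spsize (Inner A)]"
    using mset_upt_Cons[of l "spsize A"] by (simp add: ac_simps del: upt_Suc)
  finally show ?case .
next
  case (10 l F A)
  have "mset (concat (right_nested l (Outer F A))) + mset (right_path l (Outer F A)) =
     mset [l..<l + spsize A] + mset [l + spsize A..<l + spsize A + ssize F] + {#l + spsize A + ssize F#}"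
    unfolding "10.IH"[symmetric] by (simp add: ac_simps)
  also have "\<dots> = mset [l..<l + (spsize A + ssize F)] + {#l + (spsize A + ssize F)#}"
    unfolding mset_upt_split by (simp add: add.assoc del: upt_Suc)
  also have "\<dots> = mset [l..<l + spsize (Outer F A)]"
    by simp
  finally show ?case .
qed auto

lemma distinct_paths: "distinct (concat (paths l t))"
  using mset_paths(1)[of l t] by (metis distinct_upt mset_eq_imp_distinct_iff)

lemma set_paths: "set (concat (paths l t)) = {l..<l + ssize t}"
  using mset_paths(1)[of l t] by (metis atLeastLessThan_upt mset_eq_setD)

lemma parcs_append:
  "xs \<noteq> [] \<Longrightarrow> ys \<noteq> [] \<Longrightarrow> parcs (xs @ ys) =
     insert (min (last xs) (hd ys), max (last xs) (hd ys)) (parcs xs \<union> parcs ys)"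
proof (induction xs rule: parcs.induct)
  case (1 x y zs) then show ?case by auto
next
  case ("2_2" x) then show ?case by (cases ys) auto
qed auto

lemma parcs_rev: "parcs (rev xs) = parcs xs"
proof (induction xs rule: parcs.induct)
  case (1 x y zs)
  then show ?case using parcs_append[of "rev (y # zs)" "[x]"] by (auto simp: min.commute max.commute last_rev)
qed auto

lemma parcs_snoc: "xs \<noteq> [] \<Longrightarrow> parcs (xs @ [v]) = insert (min (last xs) v, max (last xs) v) (parcs xs)"
  using parcs_append[of xs "[v]"] by simp

lemma parcs_paths:
  "\<Union> (parcs ` set (paths l t)) = sarcs l t"
  "\<Union> (parcs ` set (left_nested l A)) \<union> parcs (left_path l A) = larcs l A"
  "\<Union> (parcs ` set (right_nested l B)) \<union> parcs (right_path l B) = rarcs l B"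
proof (induction l t and l A and l B rule: paths_left_nested_right_nested.induct)
  case (3 l A t)
  show ?case unfolding sarcs.simps "3.IH"[symmetric]
    using ltip_bounds[of l A] by (auto simp: parcs_snoc min_def max_def)
next
  case (4 l A B F t)
  let ?v = "l + spsize A + spsize B + ssize F"
  have "parcs (left_path l A @ ?v # rev (right_path (l + spsize A) B)) =
    parcs (left_path l A) \<union> parcs (right_path (l + spsize A) B) \<union> {(ltip l A, ?v), (rtip (l + spsize A) B, ?v)}"
    using ltip_bounds[of l A] rtip_bounds[of "l + spsize A" B] parcs_append[of "left_path l A @ [?v]" "rev (right_path (l + spsize A) B)"]
    by (auto simp: parcs_snoc parcs_rev hd_rev)
  then show ?case unfolding sarcs.simps "4.IH"[symmetric] by (simp only: paths.simps) auto
next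
  case (6 l A)
  show ?case unfolding larcs.simps "6.IH"[symmetric]
    using ltip_bounds[of l A] by (auto simp: parcs_snoc min_def max_def)
next
  case (7 l F A)
  show ?case unfolding larcs.simps "7.IH"[symmetric]
    using ltip_bounds[of "Suc (l + ssize F)" A] by (auto simp: parcs_snoc)
next
  case (9 l A)
  show ?case unfolding rarcs.simps "9.IH"[symmetric]
    using rtip_bounds[of "Suc l" A] by (auto simp: parcs_snoc)
next
  case (10 l F A)
  show ?case unfolding rarcs.simps "10.IH"[symmetric]
    using rtip_bounds[of l A] by (auto simp: parcs_snoc)
qed auto

text \<open>A one-point path contributes its vertex twice, because both of its joining edges leave
  from there.\<close>

definition ends :: "nat list list \<Rightarrow> nat list" where
  "ends ps = concat (map (\<lambda>p. [hd p, last p]) ps)"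

(* Gap i lies between the points i and i + 1. *)
definition inner_gaps :: "nat list list \<Rightarrow> nat set" where
  "inner_gaps ps = (\<Union>p\<in>set ps. {hd p..<last p})"

lemma ends_simps [simp]: "ends [] = []" "ends (p # ps) = hd p # last p # ends ps"
  "ends (ps @ qs) = ends ps @ ends qs"
  by (simp_all add: ends_def)

lemma inner_gaps_simps [simp]: "inner_gaps [] = {}" "inner_gaps (p # ps) = {hd p..<last p} \<union> inner_gaps ps"
  "inner_gaps (ps @ qs) = inner_gaps ps \<union> inner_gaps qs"
  by (auto simp: inner_gaps_def)

lemma length_ends: "length (ends ps) = 2 * length ps"
  by (induction ps) auto

lemma inner_gaps_bounds: "ends_in l h ps \<Longrightarrow> inner_gaps ps \<subseteq> {l..<h}"
  by (induction l h ps rule: ends_in.induct) fastforce+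

lemma ends_bounds: "ends_in l h ps \<Longrightarrow> set (ends ps) \<subseteq> {l..<h}"
  by (induction l h ps rule: ends_in.induct) fastforce+

text \<open>The two endpoints of a path are neighbours in \<open>ends\<close>, so a gap that is not
  inner has only whole pairs before it. This parity later counts the joining edges to the left of a
  gap.\<close>

lemma even_ends:
  "ends_in l h ps \<Longrightarrow> i \<notin> inner_gaps ps \<Longrightarrow> even (length (filter (\<lambda>x. x \<le> i) (ends ps)))"
  by (induction l h ps rule: ends_in.induct) auto

lemma odd_ends:
  "ends_in l h ps \<Longrightarrow> i \<in> inner_gaps ps \<Longrightarrow> odd (length (filter (\<lambda>x. x \<le> i) (ends ps)))"
proof (induction l h ps rule: ends_in.induct)
  case (2 l h p ps)
  show ?case
  proof (cases "i \<in> {hd p..<last p}")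
    case True
    then have "\<forall>x\<in>set (ends ps). \<not> x \<le> i" using ends_bounds[of "Suc (last p)" h ps] 2 by fastforce
    then show ?thesis using True by simp
  next
    case False
    then have i: "i \<in> inner_gaps ps" using 2 by auto
    then have "last p < i" using inner_gaps_bounds[of "Suc (last p)" h ps] 2 by fastforce
    then show ?thesis using 2 i by auto
  qed
qed auto

section \<open>Weaving two systems into one cycle\<close>

fun path_edges :: "'a list \<Rightarrow> 'a set set" where
  "path_edges (x # y # zs) = insert {x, y} (path_edges (y # zs))"
| "path_edges _ = {}"

lemma path_edges_append:
  "xs \<noteq> [] \<Longrightarrow> ys \<noteq> [] \<Longrightarrow> path_edges (xs @ ys) =
     insert {last xs, hd ys} (path_edges xs \<union> path_edges ys)"
proof (induction xs rule: path_edges.induct)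
  case (1 x y zs) then show ?case by auto
next
  case ("2_2" x) then show ?case by (cases ys) auto
qed auto

lemma path_edges_map: "path_edges (map f p) = (\<lambda>(i, j). {f i, f j}) ` parcs p"
  by (induction p rule: parcs.induct) (auto simp: min_def max_def)

text \<open>\<open>f\<close> and \<open>g\<close> place the vertices of the two chains in the plane.
  The intended listing starts and ends with a path of the first chain, which must therefore have one
  path more.\<close>

fun weave :: "(nat \<Rightarrow> 'a) \<Rightarrow> (nat \<Rightarrow> 'a) \<Rightarrow> nat list list \<Rightarrow> nat list list \<Rightarrow> 'a list" where
  "weave f g (p # ps) (q # qs) = map f p @ map g q @ weave f g ps qs"
| "weave f g [p] [] = map f p"
| "weave f g _ _ = []"

text \<open>\<open>y0\<close> and \<open>yl\<close> are the vertices visited just before and just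
  after the alternation. The joining edges run from \<open>y0\<close> to the first upper endpoint,
  then from the end of each path to the head of the next, and finally to \<open>yl\<close>. Paired
  up, these are the upper endpoints against the lower ones shifted by one.\<close>

lemma weave_path_edges:
  assumes "length ps = Suc (length qs)" "[] \<notin> set ps" "[] \<notin> set qs"
  shows "path_edges (g y0 # weave f g ps qs @ [g yl]) =
     (\<lambda>(i, j). {f i, f j}) ` \<Union> (parcs ` set ps) \<union> (\<lambda>(i, j). {g i, g j}) ` \<Union> (parcs ` set qs)
     \<union> (\<lambda>(x, y). {f x, g y}) ` set (zip (ends ps) (y0 # ends qs @ [yl]))"
  using assms
proof (induction qs arbitrary: ps y0)
  case Nil
  then obtain p where p: "ps = [p]" "p \<noteq> []" by (cases ps) auto
  have "path_edges (([g y0] @ map f p) @ [g yl]) =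
     {{f (last p), g yl}, {g y0, f (hd p)}} \<union> path_edges (map f p)"
    using p(2) by (subst path_edges_append; (subst path_edges_append)?) (auto simp: last_map hd_map)
  then show ?case using p by (auto simp: path_edges_map)
next
  case (Cons q qs)
  then obtain p ps' where p: "ps = p # ps'" "length ps' = Suc (length qs)" by (cases ps) auto
  have ne: "p \<noteq> []" "q \<noteq> []" "[] \<notin> set ps'" "[] \<notin> set qs" using Cons.prems p by auto
  let ?W = "weave f g ps' qs @ [g yl]"
  have q: "map g q = map g (butlast q) @ [g (last q)]"
    using ne(2) by (metis append_butlast_last_id last_map list.simps(8,9) map_append)
  have "path_edges (g y0 # weave f g ps (q # qs) @ [g yl]) = path_edges (([g y0] @ map f p) @ (map g q @ ?W))"
    using p by simp
  also have "\<dots> = {{f (last p), g (hd q)}, {g y0, f (hd p)}} \<union> path_edges (map f p) \<union> path_edges (map g q @ ?W)"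
    using ne by (subst path_edges_append; (subst path_edges_append)?) (auto simp: last_map hd_map hd_append)
  \<comment> \<open>Cutting at the last vertex of \<open>q\<close> makes this vertex the new
    \<open>y0\<close> of the induction hypothesis.\<close>
  also have "path_edges (map g q @ ?W) = path_edges (map g q) \<union> path_edges (g (last q) # ?W)"
  proof -
    have "path_edges (xs @ [z] @ W) = path_edges (xs @ [z]) \<union> path_edges (z # W)" for xs z and W :: "'a list"
      by (induction xs rule: path_edges.induct) auto
    from this[of "map g (butlast q)" "g (last q)" ?W] show ?thesis unfolding q append_assoc .
  qed
  also have "path_edges (g (last q) # ?W) =
     (\<lambda>(i, j). {f i, f j}) ` \<Union> (parcs ` set ps') \<union> (\<lambda>(i, j). {g i, g j}) ` \<Union> (parcs ` set qs)
     \<union> (\<lambda>(x, y). {f x, g y}) ` set (zip (ends ps') (last q # ends qs @ [yl]))"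
    by (rule Cons.IH[OF p(2) ne(3,4)])
  finally show ?case by (auto simp: p path_edges_map image_Un)
qed

lemma set_weave:
  "length ps = Suc (length qs) \<Longrightarrow>
   set (weave f g ps qs) = f ` set (concat ps) \<union> g ` set (concat qs)"
  by (induction f g ps qs rule: weave.induct) auto

lemma distinct_weave:
  assumes "length ps = Suc (length qs)" "distinct (concat ps)" "distinct (concat qs)"
    "inj_on f (set (concat ps))" "inj_on g (set (concat qs))"
    "f ` set (concat ps) \<inter> g ` set (concat qs) = {}"
  shows "distinct (weave f g ps qs)"
  using assms
proof (induction f g ps qs rule: weave.induct)
  case (1 f g p ps q qs)
  have IH: "distinct (weave f g ps qs)"
    by (rule 1(1)) (use 1(2-) in \<open>auto simp: inj_on_Un\<close>)
  have sw: "set (weave f g ps qs) = f ` set (concat ps) \<union> g ` set (concat qs)"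
    using set_weave 1(2) by (metis Suc_inject length_Cons)
  define P Q where "P = set (concat ps)" and "Q = set (concat qs)"
  have d: "distinct p" "distinct q" "set p \<inter> P = {}" "set q \<inter> Q = {}"
    and i: "inj_on f (set p \<union> P)" "inj_on g (set q \<union> Q)"
    and e: "f ` (set p \<union> P) \<inter> g ` (set q \<union> Q) = {}"
    using 1(3-7) unfolding P_def Q_def by simp_all
  have fg: "f ` set p \<inter> f ` P = {}" "g ` set q \<inter> g ` Q = {}"
    using d(3,4) inj_on_image_Int[OF i(1), of "set p" P] inj_on_image_Int[OF i(2), of "set q" Q] by auto
  have "distinct (map f p)" "distinct (map g q)"
    using d i by (auto simp: distinct_map inj_on_Un)
  moreover have "set (map f p) \<inter> (set (map g q) \<union> set (weave f g ps qs)) = {}"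
    "set (map g q) \<inter> set (weave f g ps qs) = {}"
    using sw fg e unfolding P_def[symmetric] Q_def[symmetric] by auto
  ultimately show ?case using IH by simp
qed (auto simp: distinct_map)

text \<open>Strict product order on pairs of an upper and a lower index. Comparable joining edges
  may share an endpoint but do not cross.\<close>

definition before :: "nat \<times> nat \<Rightarrow> nat \<times> nat \<Rightarrow> bool" where
  "before b b' \<longleftrightarrow> fst b \<le> fst b' \<and> snd b \<le> snd b' \<and> b \<noteq> b'"

text \<open>Consecutive pairs differ even at one-point paths: while one coordinate stays within a
  path, the other jumps strictly forward to the next path of its chain.\<close>

lemma sorted_bichromatic:
  assumes "length ps = Suc (length qs)" "ends_in l h ps" "ends_in (Suc y0) yl qs"
  shows "sorted_wrt before (zip (ends ps) (y0 # ends qs @ [yl]))"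
  using assms
proof (induction qs arbitrary: ps l y0)
  case Nil
  then obtain p where p: "ps = [p]" by (cases ps) auto
  then show ?case using Nil by (auto simp: before_def)
next
  case (Cons q qs)
  then obtain p ps' where p: "ps = p # ps'" "length ps' = Suc (length qs)" by (cases ps) auto
  have e: "ends_in (Suc (last p)) h ps'" "ends_in (Suc (last q)) yl qs" using Cons.prems p by auto
  have IH: "sorted_wrt before (zip (ends ps') (last q # ends qs @ [yl]))"
    by (rule Cons.IH[OF p(2) e])
  have b: "last p < x \<and> last q \<le> y" if "(x, y) \<in> set (zip (ends ps') (last q # ends qs @ [yl]))" for x y
  proof -
    have "x \<in> set (ends ps')" "y \<in> set (last q # ends qs @ [yl])"
      using that by (auto dest: set_zip_leftD set_zip_rightD)
    then show ?thesis using ends_bounds[OF e(1)] ends_bounds[OF e(2)] ends_in_le[OF e(2)] by fastforce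
  qed
  have le: "hd p \<le> last p" "y0 < hd q" "hd q \<le> last q" using Cons.prems p by auto
  have "before (last p, hd q) z \<and> before (hd p, y0) z"
    if "z \<in> set (zip (ends ps') (last q # ends qs @ [yl]))" for z
    using b[of "fst z" "snd z"] that le by (auto simp: before_def prod_eq_iff)
  moreover have "before (hd p, y0) (last p, hd q)" using le by (auto simp: before_def)
  ultimately show ?case using IH p(1) by simp
qed

section \<open>Growth of the number of systems\<close>

lemma finite_trees: "finite {t. ssize t \<le> M} \<and> finite {A. spsize A \<le> M}"
proof (induction M)
  case 0
  have "{t. ssize t \<le> 0} \<subseteq> {Empty}"
  proof
    fix t assume "t \<in> {t. ssize t \<le> 0}" then show "t \<in> {Empty}" by (cases t) auto
  qed
  moreover have "{A. spsize A \<le> 0} = {}" by auto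
  ultimately show ?case using finite_subset by fastforce
next
  case (Suc M)
  let ?S = "{t. ssize t \<le> M}" and ?A = "{A. spsize A \<le> M}"
  have "{t. ssize t \<le> Suc M} \<subseteq> {Empty} \<union> Isolated ` ?S \<union> (\<lambda>(A, t). Closed A t) ` (?A \<times> ?S)
      \<union> (\<lambda>(A, B, F, t). Joined A B F t) ` (?A \<times> ?A \<times> ?S \<times> ?S)"
  proof
    fix t assume "t \<in> {t. ssize t \<le> Suc M}"
    then show "t \<in> {Empty} \<union> Isolated ` ?S \<union> (\<lambda>(A, t). Closed A t) ` (?A \<times> ?S)
      \<union> (\<lambda>(A, B, F, t). Joined A B F t) ` (?A \<times> ?A \<times> ?S \<times> ?S)"
      by (cases t) (auto simp: image_iff)
  qed
  moreover have "finite ({Empty} \<union> Isolated ` ?S \<union> (\<lambda>(A, t). Closed A t) ` (?A \<times> ?S)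
      \<union> (\<lambda>(A, B, F, t). Joined A B F t) ` (?A \<times> ?A \<times> ?S \<times> ?S))"
    using Suc by (intro finite_UnI finite_imageI finite_SigmaI) auto
  ultimately have 1: "finite {t. ssize t \<le> Suc M}" using finite_subset by blast
  have "{A. spsize A \<le> Suc M} \<subseteq> {Start} \<union> Inner ` ?A \<union> (\<lambda>(F, A). Outer F A) ` (?S \<times> ?A)"
  proof
    fix A assume "A \<in> {A. spsize A \<le> Suc M}"
    then show "A \<in> {Start} \<union> Inner ` ?A \<union> (\<lambda>(F, A). Outer F A) ` (?S \<times> ?A)"
      by (cases A) (auto simp: image_iff)
  qed
  moreover have "finite ({Start} \<union> Inner ` ?A \<union> (\<lambda>(F, A). Outer F A) ` (?S \<times> ?A))"
    using Suc by auto
  ultimately have "finite {A. spsize A \<le> Suc M}" using finite_subset by blast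
  then show ?case using 1 by blast
qed

lemma finite_sys: "finite {t. ssize t \<le> M}" and finite_spiral: "finite {A. spsize A \<le> M}"
  using finite_trees by blast+

text \<open>Truncated generating functions: all sums are finite, so nothing about convergence is
  presupposed while divergence is being shown.\<close>

definition sys_gf :: "real \<Rightarrow> nat \<Rightarrow> real" where "sys_gf x M = (\<Sum>t | ssize t \<le> M. x ^ ssize t)"
definition spiral_gf :: "real \<Rightarrow> nat \<Rightarrow> real" where "spiral_gf x M = (\<Sum>A | spsize A \<le> M. x ^ spsize A)"

lemma sum_times_product:
  fixes x :: real
  shows "(\<Sum>(a, b)\<in>A \<times> B. x * f a * g b) = x * sum f A * sum g B"
proof -
  have "x * sum f A * sum g B = x * (\<Sum>(a, b)\<in>A \<times> B. f a * g b)"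
    by (simp add: sum_product sum.cartesian_product mult.assoc)
  then show ?thesis by (simp add: sum_distrib_left case_prod_unfold mult.assoc)
qed

text \<open>The larger truncation leaves room for every code assembled from parts of size at most
  \<open>M\<close>, so the recursion survives truncation as an inequality.\<close>

lemma spiral_gf_rec:
  assumes "0 \<le> x"
  shows "spiral_gf x (2 * M + 1) \<ge> x + x * spiral_gf x M + x * sys_gf x M * spiral_gf x M"
proof -
  let ?S = "{t. ssize t \<le> M}" and ?A = "{A. spsize A \<le> M}"
  let ?P = "Inner ` ?A" and ?Q = "(\<lambda>(F, A). Outer F A) ` (?S \<times> ?A)"
  have fin: "finite ?P" "finite ?Q" using finite_sys[of M] finite_spiral[of M] by auto
  have "(\<Sum>A\<in>{Start} \<union> (?P \<union> ?Q). x ^ spsize A) = (\<Sum>A\<in>{Start}. x ^ spsize A) + (\<Sum>A\<in>?P \<union> ?Q. x ^ spsize A)"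
    by (rule sum.union_disjoint) (use fin in auto)
  also have "(\<Sum>A\<in>?P \<union> ?Q. x ^ spsize A) = (\<Sum>A\<in>?P. x ^ spsize A) + (\<Sum>A\<in>?Q. x ^ spsize A)"
    by (rule sum.union_disjoint) (use fin in auto)
  also have "(\<Sum>A\<in>?P. x ^ spsize A) = x * spiral_gf x M"
    by (subst sum.reindex) (auto simp: spiral_gf_def sum_distrib_left inj_on_def)
  also have "(\<Sum>A\<in>?Q. x ^ spsize A) = (\<Sum>(F, A)\<in>?S \<times> ?A. x * x ^ ssize F * x ^ spsize A)"
    by (subst sum.reindex) (auto simp: inj_on_def power_add case_prod_unfold mult_ac intro!: sum.cong)
  also have "\<dots> = x * sys_gf x M * spiral_gf x M"
    unfolding sys_gf_def spiral_gf_def by (rule sum_times_product)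
  also have "(\<Sum>A\<in>{Start}. x ^ spsize A) = x" by simp
  finally have "x + (x * spiral_gf x M + x * sys_gf x M * spiral_gf x M) = (\<Sum>A\<in>{Start} \<union> (?P \<union> ?Q). x ^ spsize A)" by simp
  also have "\<dots> \<le> spiral_gf x (2 * M + 1)"
    unfolding spiral_gf_def using assms by (intro sum_mono2 finite_spiral) auto
  finally show ?thesis by simp
qed

lemma sys_gf_rec:
  assumes "0 \<le> x"
  shows "sys_gf x (4 * M + 1) \<ge> 1 + x * sys_gf x M + x * spiral_gf x M * sys_gf x M
     + x * (spiral_gf x M * spiral_gf x M) * (sys_gf x M * sys_gf x M)"
proof -
  let ?S = "{t. ssize t \<le> M}" and ?A = "{A. spsize A \<le> M}"
  let ?P = "Isolated ` ?S" and ?Q = "(\<lambda>(A, t). Closed A t) ` (?A \<times> ?S)"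
    and ?R = "(\<lambda>((A, B), (F, t)). Joined A B F t) ` ((?A \<times> ?A) \<times> (?S \<times> ?S))"
  have fin: "finite ?P" "finite ?Q" "finite ?R" using finite_sys[of M] finite_spiral[of M] by auto
  have "(\<Sum>A\<in>{Empty} \<union> (?P \<union> (?Q \<union> ?R)). x ^ ssize A) = (\<Sum>A\<in>{Empty}. x ^ ssize A) + (\<Sum>A\<in>?P \<union> (?Q \<union> ?R). x ^ ssize A)"
    by (rule sum.union_disjoint) (use fin in auto)
  also have "(\<Sum>A\<in>?P \<union> (?Q \<union> ?R). x ^ ssize A) = (\<Sum>A\<in>?P. x ^ ssize A) + (\<Sum>A\<in>?Q \<union> ?R. x ^ ssize A)"
    by (rule sum.union_disjoint) (use fin in auto)
  also have "(\<Sum>A\<in>?Q \<union> ?R. x ^ ssize A) = (\<Sum>A\<in>?Q. x ^ ssize A) + (\<Sum>A\<in>?R. x ^ ssize A)"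
    by (rule sum.union_disjoint) (use fin in auto)
  also have "(\<Sum>A\<in>?P. x ^ ssize A) = x * sys_gf x M"
    by (subst sum.reindex) (auto simp: sys_gf_def sum_distrib_left inj_on_def)
  also have "(\<Sum>A\<in>?Q. x ^ ssize A) = (\<Sum>(A, t)\<in>?A \<times> ?S. x * x ^ spsize A * x ^ ssize t)"
    by (subst sum.reindex) (auto simp: inj_on_def power_add case_prod_unfold mult_ac intro!: sum.cong)
  also have "\<dots> = x * spiral_gf x M * sys_gf x M"
    unfolding sys_gf_def spiral_gf_def by (rule sum_times_product)
  also have "(\<Sum>A\<in>?R. x ^ ssize A) = (\<Sum>(p, q)\<in>(?A \<times> ?A) \<times> (?S \<times> ?S).
      x * (x ^ spsize (fst p) * x ^ spsize (snd p)) * (x ^ ssize (fst q) * x ^ ssize (snd q)))"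
    by (subst sum.reindex) (auto simp: inj_on_def power_add case_prod_unfold mult_ac intro!: sum.cong)
  also have "\<dots> = x * (\<Sum>p\<in>?A \<times> ?A. x ^ spsize (fst p) * x ^ spsize (snd p))
      * (\<Sum>q\<in>?S \<times> ?S. x ^ ssize (fst q) * x ^ ssize (snd q))"
    by (rule sum_times_product)
  also have "\<dots> = x * (spiral_gf x M * spiral_gf x M) * (sys_gf x M * sys_gf x M)"
    by (simp add: sys_gf_def spiral_gf_def sum_product sum.cartesian_product case_prod_unfold)
  also have "(\<Sum>A\<in>{Empty}. x ^ ssize A) = 1" by simp
  finally have "1 + (x * sys_gf x M + (x * spiral_gf x M * sys_gf x M
     + x * (spiral_gf x M * spiral_gf x M) * (sys_gf x M * sys_gf x M))) = (\<Sum>A\<in>{Empty} \<union> (?P \<union> (?Q \<union> ?R)). x ^ ssize A)" by simp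
  also have "\<dots> \<le> sys_gf x (4 * M + 1)"
    unfolding sys_gf_def using assms by (intro sum_mono2 finite_sys) auto
  finally show ?thesis by simp
qed

lemma gf_mono: "0 \<le> x \<Longrightarrow> M \<le> M' \<Longrightarrow> sys_gf x M \<le> sys_gf x M'" "0 \<le> x \<Longrightarrow> M \<le> M' \<Longrightarrow> spiral_gf x M \<le> spiral_gf x M'"
  unfolding sys_gf_def spiral_gf_def by (intro sum_mono2 finite_sys finite_spiral; auto)+

lemma gf_nonneg: "0 \<le> x \<Longrightarrow> 1 \<le> sys_gf x M" "0 \<le> x \<Longrightarrow> 0 \<le> spiral_gf x M"
proof -
  assume x: "0 \<le> x"
  have "(\<Sum>t\<in>{Empty}. x ^ ssize t) \<le> sys_gf x M"
    unfolding sys_gf_def using x by (intro sum_mono2 finite_sys) auto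
  then show "1 \<le> sys_gf x M" by simp
  show "0 \<le> spiral_gf x M" unfolding spiral_gf_def using x by (auto intro: sum_nonneg)
qed

(* The generating function has its singularity just below x = 1000/4641; the double root 15/8
   approximates the value of F there. *)
lemma no_fixpoint:
  fixes F A :: real
  defines "x \<equiv> 1000 / 4641"
  assumes F: "1 \<le> F" and A0: "0 \<le> A" and A: "x + x * A + x * F * A \<le> A"
    and FF: "1 + x * F + x * A * F + x * (A * A) * (F * F) \<le> F"
  shows False
proof -
  \<comment> \<open>The first inequality becomes \<open>x \<le> A * D\<close>. After multiplication
    of the second one by \<open>D * D\<close>, the unknown \<open>A\<close> enters only through
    \<open>A * D\<close>, which can be bounded below by \<open>x\<close>.\<close>
  define D where "D = 1 - x - x * F"
  have xpos: "0 < x" by (simp add: x_def)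
  have AD: "x \<le> A * D" using A by (simp add: D_def algebra_simps)
  have D: "0 < D"
  proof (rule ccontr)
    assume "\<not> 0 < D"
    then have "A * D \<le> 0" using A0 by (simp add: mult_nonneg_nonpos)
    then show False using AD xpos by linarith
  qed
  have "D * D * (1 + x * F) + x * F * D * (A * D) + x * (F * F) * ((A * D) * (A * D)) =
     D * D * (1 + x * F + x * A * F + x * (A * A) * (F * F))"
    by (simp add: algebra_simps)
  also have "\<dots> \<le> D * D * F" using FF D by (intro mult_left_mono) auto
  finally have 1: "D * D * (1 + x * F) + x * F * D * (A * D) + x * (F * F) * ((A * D) * (A * D)) \<le> D * D * F" .
  have 2: "x * F * D * x \<le> x * F * D * (A * D)"
    using xpos F D AD by (intro mult_left_mono) auto
  have 3: "x * (F * F) * (x * x) \<le> x * (F * F) * ((A * D) * (A * D))"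
    using xpos F D AD by (intro mult_left_mono mult_mono) auto
  have q: "D * D * (1 + x * F) + x * F * D * x + x * (F * F) * (x * x) - D * D * F \<le> 0"
    using 1 2 3 by linarith
  \<comment> \<open>The factor clears the denominators. The cofactor of the square is positive for
    \<open>F < 3641 / 1000\<close>, which is what \<open>0 < D\<close> says, and the linear
    remainder is positive for \<open>F \<ge> 1\<close>.\<close>
  have "4641 ^ 3 * (D * D * (1 + x * F) + x * F * D * x + x * (F * F) * (x * x) - D * D * F) =
     (F - 15 / 8)\<^sup>2 * (17501012000 - 3641000000 * F) + 6119904 * F - 3621183 / 2"
    unfolding D_def x_def by (simp add: field_simps power2_eq_square power3_eq_cube)
  moreover have "F < 3641 / 1000" using D unfolding D_def x_def by simp
  then have "0 \<le> (F - 15 / 8)\<^sup>2 * (17501012000 - 3641000000 * F)" by (intro mult_nonneg_nonneg) auto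
  moreover have "4641 ^ 3 * (D * D * (1 + x * F) + x * F * D * x + x * (F * F) * (x * x) - D * D * F) \<le> 0"
    by (rule mult_nonneg_nonpos[OF _ q]) simp
  ultimately show False using F by linarith
qed

text \<open>If the truncations stayed bounded, both monotone sequences would converge, and in the
  limit the recursive inequalities would give a solution excluded by
  \<open>no_fixpoint\<close>.\<close>

lemma sys_gf_unbounded: "\<not> (\<exists>K. \<forall>M. sys_gf (1000 / 4641) M \<le> K)"
proof
  define x :: real where "x = 1000 / 4641"
  have x: "0 < x" by (simp add: x_def)
  assume "\<exists>K. \<forall>M. sys_gf (1000 / 4641) M \<le> K"
  then obtain K where K: "\<And>M. sys_gf x M \<le> K" unfolding x_def by auto
  \<comment> \<open>A bound for systems bounds spirals as well, because every spiral occurs in a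
    closed path.\<close>
  have KA: "spiral_gf x M \<le> K / x" for M
  proof -
    have "x * spiral_gf x M * 1 \<le> x * spiral_gf x M * sys_gf x M"
      using gf_nonneg[of x M] x by (intro mult_left_mono) auto
    also have "\<dots> \<le> sys_gf x (4 * M + 1)"
      using sys_gf_rec[of x M] gf_nonneg[of x M] x by (smt (verit) mult_nonneg_nonneg)
    finally show ?thesis using K[of "4 * M + 1"] x by (simp add: field_simps)
  qed
  have "incseq (sys_gf x)" "incseq (spiral_gf x)" using gf_mono x by (auto simp: incseq_def)
  then obtain F A where F: "sys_gf x \<longlonglongrightarrow> F" and A: "spiral_gf x \<longlonglongrightarrow> A"
    using incseq_convergent[of "sys_gf x" K] incseq_convergent[of "spiral_gf x" "K / x"] K KA by metis
  have sub: "filterlim (\<lambda>M. 2 * M + 1 :: nat) at_top at_top" "filterlim (\<lambda>M. 4 * M + 1 :: nat) at_top at_top"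
    by (rule filterlim_subseq; simp add: strict_mono_def)+
  have A2: "(\<lambda>M. spiral_gf x (2 * M + 1)) \<longlonglongrightarrow> A" by (rule filterlim_compose[OF A sub(1)])
  have F4: "(\<lambda>M. sys_gf x (4 * M + 1)) \<longlonglongrightarrow> F" by (rule filterlim_compose[OF F sub(2)])
  have "(\<lambda>M. x + x * spiral_gf x M + x * sys_gf x M * spiral_gf x M) \<longlonglongrightarrow> x + x * A + x * F * A"
    by (intro tendsto_intros A F)
  then have 1: "x + x * A + x * F * A \<le> A"
    by (rule LIMSEQ_le[OF _ A2]) (use spiral_gf_rec x in auto)
  have "(\<lambda>M. 1 + x * sys_gf x M + x * spiral_gf x M * sys_gf x M + x * (spiral_gf x M * spiral_gf x M) * (sys_gf x M * sys_gf x M))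
     \<longlonglongrightarrow> 1 + x * F + x * A * F + x * (A * A) * (F * F)"
    by (intro tendsto_intros A F)
  then have 2: "1 + x * F + x * A * F + x * (A * A) * (F * F) \<le> F"
    by (rule LIMSEQ_le[OF _ F4]) (use sys_gf_rec x in auto)
  have "1 \<le> F" by (rule LIMSEQ_le_const[OF F]) (use gf_nonneg x in auto)
  moreover have "0 \<le> A" by (rule LIMSEQ_le_const[OF A]) (use gf_nonneg x in auto)
  ultimately show False using no_fixpoint[of F A] 1 2 unfolding x_def by blast
qed

definition num_sys :: "nat \<Rightarrow> nat" where
  "num_sys N = card {t. ssize t = N}"

lemma finite_sys_eq: "finite {t. ssize t = N}"
  by (rule finite_subset[OF _ finite_sys[of N]]) auto

fun sys_append :: "sys \<Rightarrow> sys \<Rightarrow> sys" where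
  "sys_append Empty s = s"
| "sys_append (Isolated t) s = Isolated (sys_append t s)"
| "sys_append (Closed A t) s = Closed A (sys_append t s)"
| "sys_append (Joined A B F t) s = Joined A B F (sys_append t s)"

lemma ssize_sys_append: "ssize (sys_append t s) = ssize t + ssize s"
  by (induction t s rule: sys_append.induct) auto

text \<open>Knowing the size of the first part fixes where the concatenation has to be cut.\<close>

lemma sys_append_inject: "sys_append t s = sys_append t' s' \<Longrightarrow> ssize t = ssize t' \<Longrightarrow> t = t' \<and> s = s'"
proof (induction t s arbitrary: t' rule: sys_append.induct)
  case (1 s) then show ?case by (cases t') auto
next
  case (2 t s) then show ?case by (cases t') (auto dest: arg_cong[of _ _ ssize] simp: ssize_sys_append)
next
  case (3 A t s) then show ?case by (cases t') (auto dest: arg_cong[of _ _ ssize] simp: ssize_sys_append)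
next
  case (4 A B F t s) then show ?case by (cases t') (auto dest: arg_cong[of _ _ ssize] simp: ssize_sys_append)
qed

lemma num_sys_mult: "num_sys a * num_sys b \<le> num_sys (a + b)"
proof -
  have "card ((\<lambda>(t, s). sys_append t s) ` ({t. ssize t = a} \<times> {t. ssize t = b})) = num_sys a * num_sys b"
    unfolding num_sys_def card_cartesian_product[symmetric]
    by (rule card_image) (auto simp: inj_on_def dest: sys_append_inject)
  moreover have "card ((\<lambda>(t, s). sys_append t s) ` ({t. ssize t = a} \<times> {t. ssize t = b})) \<le> num_sys (a + b)"
    unfolding num_sys_def by (rule card_mono[OF finite_sys_eq]) (auto simp: ssize_sys_append)
  ultimately show ?thesis by simp
qed

lemma num_sys_pos: "0 < num_sys N"
proof -
  have "ssize ((Isolated ^^ N) Empty) = N" by (induction N) auto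
  then show ?thesis unfolding num_sys_def using finite_sys_eq by (auto simp: card_gt_0_iff)
qed

lemma sys_gf_num_sys: "sys_gf x M = (\<Sum>N\<le>M. real (num_sys N) * x ^ N)"
proof -
  have "sys_gf x M = (\<Sum>t\<in>(\<Union>N\<le>M. {t. ssize t = N}). x ^ ssize t)"
    unfolding sys_gf_def by (rule sum.cong) auto
  also have "\<dots> = (\<Sum>N\<le>M. \<Sum>t | ssize t = N. x ^ ssize t)"
    by (rule sum.UNION_disjoint) (auto simp: finite_sys_eq)
  also have "\<dots> = (\<Sum>N\<le>M. real (num_sys N) * x ^ N)"
    by (auto simp: num_sys_def intro!: sum.cong)
  finally show ?thesis .
qed

text \<open>If \<open>num_sys m\<close> stayed below \<open>v ^ m\<close> for all
  \<open>m \<ge> 1\<close>, a geometric series would bound \<open>sys_gf\<close> at 1000/4641. One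
  good \<open>m\<close> suffices: concatenation carries its bound to all multiples of
  \<open>m\<close>, and the remainder modulo \<open>m\<close> costs at most the constant
  \<open>v ^ m\<close>.\<close>

lemma num_sys_growth:
  obtains c :: real where "c > 0" "\<And>N. c * 4.6405 ^ N \<le> real (num_sys N)"
proof -
  \<comment> \<open>A value between 4.64 and 4.641: below 4.641 so that the series converges, above
    4.64 so that a polynomial factor can be paid for.\<close>
  define v :: real where "v = 4.6405"
  have v: "0 < v" "v * (1000 / 4641) < 1" by (simp_all add: v_def)
  have "\<exists>m\<ge>1. v ^ m \<le> real (num_sys m)"
  proof (rule ccontr)
    assume "\<not> ?thesis"
    then have "real (num_sys m) \<le> v ^ m" if "m \<ge> 1" for m using that by force
    moreover have "num_sys 0 = 1"
    proof -
      have "{t. ssize t = 0} = {Empty}"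
      proof (intro equalityI subsetI)
        fix t assume "t \<in> {t. ssize t = 0}" then show "t \<in> {Empty}" by (cases t) auto
      qed auto
      then show ?thesis by (simp add: num_sys_def)
    qed
    ultimately have b: "real (num_sys m) \<le> v ^ m" for m by (cases "m = 0") auto
    have "sys_gf (1000 / 4641) M \<le> 1 / (1 - v * (1000 / 4641))" for M
    proof -
      have "sys_gf (1000 / 4641) M \<le> (\<Sum>N\<le>M. v ^ N * (1000 / 4641) ^ N)"
        unfolding sys_gf_num_sys using b by (intro sum_mono mult_right_mono) auto
      also have "\<dots> = (\<Sum>N\<le>M. (v * (1000 / 4641)) ^ N)" by (simp only: power_mult_distrib)
      also have "\<dots> \<le> (\<Sum>N. (v * (1000 / 4641)) ^ N)"
        using v by (intro sum_le_suminf summable_geometric) auto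
      also have "\<dots> = 1 / (1 - v * (1000 / 4641))"
        using v by (intro suminf_geometric) auto
      finally show ?thesis .
    qed
    then show False using sys_gf_unbounded by blast
  qed
  then obtain m where m: "m \<ge> 1" "v ^ m \<le> real (num_sys m)" by blast
  have pw: "v ^ (m * j) \<le> real (num_sys (m * j))" for j
  proof (induction j)
    case 0 then show ?case using num_sys_pos[of 0] by simp
  next
    case (Suc j)
    have "v ^ (m * Suc j) = v ^ m * v ^ (m * j)" by (simp add: power_add)
    also have "\<dots> \<le> real (num_sys m) * real (num_sys (m * j))"
      using Suc m v by (intro mult_mono) auto
    also have "\<dots> \<le> real (num_sys (m * Suc j))"
      using num_sys_mult[of m "m * j"] by (metis mult_Suc_right of_nat_le_iff of_nat_mult)
    finally show ?case .
  qed
  have "(1 / v ^ m) * v ^ N \<le> real (num_sys N)" for N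
  proof -
    have N: "N = m * (N div m) + N mod m" by simp
    have "v ^ N = v ^ (m * (N div m)) * v ^ (N mod m)" using N by (metis power_add)
    also have "\<dots> \<le> v ^ (m * (N div m)) * v ^ m"
      using m v by (intro mult_left_mono power_increasing) (auto simp: v_def intro: less_imp_le)
    finally have "(1 / v ^ m) * v ^ N \<le> v ^ (m * (N div m))" using v by (simp add: field_simps)
    also have "\<dots> \<le> real (num_sys (m * (N div m)))" by (rule pw)
    also have "\<dots> \<le> real (num_sys (m * (N div m)) * num_sys (N mod m))"
      using num_sys_pos[of "N mod m"] by (simp add: mult_le_cancel_left1)
    also have "\<dots> \<le> real (num_sys N)"
      using num_sys_mult[of "m * (N div m)" "N mod m"] N by (metis of_nat_le_iff)
    finally show ?thesis .
  qed
  then show ?thesis using that[of "1 / v ^ m"] v by (auto simp: v_def)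
qed

text \<open>The fourth power is the price of the later choice of a class: there are
  \<open>(N + 1)^2\<close> classes, and both chains take their system from the same one, so the loss
  is squared.\<close>

lemma num_sys_growth4:
  obtains c :: real where "c > 0" "\<And>N. c * 4.64 ^ (2 * N) * (real N + 1) ^ 4 \<le> real (num_sys N) ^ 2"
proof -
  obtain c :: real where c: "c > 0" "\<And>N. c * 4.6405 ^ N \<le> real (num_sys N)"
    using num_sys_growth by blast
  \<comment> \<open>Small enough for \<open>4.64 * (1 + d)^2 \<le> 4.6405\<close>, while by
    Bernoulli \<open>(1 + d) ^ N\<close> dominates \<open>d * (N + 1)\<close>.\<close>
  define d :: real where "d = 0.00005"
  have "c\<^sup>2 * d ^ 4 * 4.64 ^ (2 * N) * (real N + 1) ^ 4 \<le> real (num_sys N) ^ 2" for N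
  proof -
    have "d * (real N + 1) \<le> 1 + real N * d" by (simp add: d_def field_simps)
    also have "\<dots> \<le> (1 + d) ^ N" by (rule Bernoulli_inequality) (simp add: d_def)
    finally have "(d * (real N + 1)) ^ 4 \<le> ((1 + d) ^ N) ^ 4"
      by (rule power_mono) (simp add: d_def)
    then have "4.64 ^ (2 * N) * (d * (real N + 1)) ^ 4 \<le> 4.64 ^ (2 * N) * ((1 + d) ^ N) ^ 4"
      by (intro mult_left_mono) auto
    also have "((1 + d) ^ N) ^ 4 = (((1 + d)\<^sup>2) ^ N)\<^sup>2"
      by (simp add: power_mult[symmetric] mult.commute)
    also have "4.64 ^ (2 * N) * (((1 + d)\<^sup>2) ^ N)\<^sup>2 = ((4.64 * (1 + d)\<^sup>2) ^ N)\<^sup>2"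
      by (simp only: power_mult_distrib power_even_eq)
    also have "\<dots> \<le> (4.6405 ^ N)\<^sup>2"
      by (intro power_mono) (auto simp: d_def power2_eq_square)
    finally have "c\<^sup>2 * (4.64 ^ (2 * N) * (d * (real N + 1)) ^ 4) \<le> c\<^sup>2 * (4.6405 ^ N)\<^sup>2"
      by (intro mult_left_mono) auto
    also have "\<dots> = (c * 4.6405 ^ N)\<^sup>2" by (simp add: power_mult_distrib)
    also have "\<dots> \<le> real (num_sys N) ^ 2" using c by (intro power_mono) auto
    finally show ?thesis by (simp add: power_mult_distrib mult_ac)
  qed
  then show ?thesis using that[of "c\<^sup>2 * d ^ 4"] c by (auto simp: d_def)
qed

section \<open>Simple polygons as closed curves\<close>

lemma cyclic_edges_path_edges:
  assumes "vs \<noteq> []"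
  shows "cyclic_edges vs = insert {last vs, hd vs} (path_edges vs)"
proof -
  have pe: "path_edges xs = (\<lambda>i. {xs ! i, xs ! Suc i}) ` {..<length xs - 1}" for xs :: "complex list"
  proof (induction xs rule: path_edges.induct)
    case (1 x y zs)
    have "{..<length (x # y # zs) - 1} = insert 0 (Suc ` {..<length (y # zs) - 1})"
      by (auto simp: lessThan_Suc_eq_insert_0)
    then show ?case using 1 by (simp add: image_image)
  qed auto
  obtain n where n: "length vs = Suc n" using assms by (cases vs) auto
  have "cyclic_edges vs = (\<lambda>i. {vs ! i, vs ! ((i + 1) mod Suc n)}) ` (insert n {..<n})"
    unfolding cyclic_edges_def n lessThan_Suc ..
  also have "\<dots> = insert {vs ! n, vs ! 0} ((\<lambda>i. {vs ! i, vs ! Suc i}) ` {..<n})"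
    by (auto intro!: image_cong)
  finally show ?thesis
    using n assms by (simp add: pe last_conv_nth hd_conv_nth)
qed

lemma Union_path_edges: "2 \<le> length xs \<Longrightarrow> \<Union> (path_edges xs) = set xs"
proof (induction xs rule: path_edges.induct)
  case (1 x y zs) then show ?case by (cases zs) auto
qed auto

lemma path_edges_subset: "e \<in> path_edges xs \<Longrightarrow> e \<subseteq> set xs"
  by (induction xs rule: path_edges.induct) auto

text \<open>Lists with fewer than two points get a constant path as default value; the lemmas start
  at length two.\<close>

fun poly_path :: "complex list \<Rightarrow> real \<Rightarrow> complex" where
  "poly_path (x # y # z # zs) = linepath x y +++ poly_path (y # z # zs)"
| "poly_path [x, y] = linepath x y"
| "poly_path xs = linepath 0 0"

lemma poly_path_ends:
  "2 \<le> length xs \<Longrightarrow> pathstart (poly_path xs) = hd xs \<and> pathfinish (poly_path xs) = last xs"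
  by (induction xs rule: poly_path.induct) auto

lemma path_image_poly_path:
  "2 \<le> length xs \<Longrightarrow> path_image (poly_path xs) = (\<Union>e\<in>path_edges xs. convex hull e)"
proof (induction xs rule: poly_path.induct)
  case (1 x y z zs)
  then show ?case using poly_path_ends[of "y # z # zs"]
    by (simp add: path_image_join segment_convex_hull)
qed (auto simp: segment_convex_hull)

lemma arc_poly_path:
  "2 \<le> length xs \<Longrightarrow> distinct xs \<Longrightarrow>
    \<forall>e\<in>path_edges xs. \<forall>f\<in>path_edges xs. e \<noteq> f \<longrightarrow> convex hull e \<inter> convex hull f = e \<inter> f \<Longrightarrow>
    arc (poly_path xs)"
proof (induction xs rule: poly_path.induct)
  case (1 x y z zs)
  have "arc (linepath x y +++ poly_path (y # z # zs))"
  proof (rule arc_join)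
    show "arc (linepath x y)" using 1 by auto
    show "arc (poly_path (y # z # zs))" by (rule 1(1)) (use 1 in auto)
    show "pathfinish (linepath x y) = pathstart (poly_path (y # z # zs))"
      using poly_path_ends[of "y # z # zs"] by simp
    have seg: "convex hull {x, y} \<inter> convex hull e \<subseteq> {y}" if e: "e \<in> path_edges (y # z # zs)" for e
    proof -
      have "x \<notin> e" using path_edges_subset[OF e] 1(3) by auto
      moreover have "convex hull {x, y} \<inter> convex hull e = {x, y} \<inter> e"
        by (rule 1(4)[rule_format]) (use e \<open>x \<notin> e\<close> in auto)
      ultimately show ?thesis by auto
    qed
    have pim: "path_image (poly_path (y # z # zs)) = (\<Union>e\<in>path_edges (y # z # zs). convex hull e)"
      by (rule path_image_poly_path) simp
    have ps: "pathstart (poly_path (y # z # zs)) = y"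
      using poly_path_ends[of "y # z # zs"] by simp
    show "path_image (linepath x y) \<inter> path_image (poly_path (y # z # zs)) \<subseteq> {pathstart (poly_path (y # z # zs))}"
      unfolding path_image_linepath segment_convex_hull pim ps using seg by blast
  qed
  then show ?case by simp
qed auto

text \<open>The Jordan curve theorem speaks of paths, so the set of edges has to be traversed: an
  arc along the vertex list, closed up by the edge from the last vertex to the first.\<close>

lemma simple_polygon_loop:
  assumes "simple_polygon P"
  obtains g where "simple_path g" "pathfinish g = pathstart g" "path_image g = polygon_boundary P"
proof -
  obtain vs where vs: "distinct vs" "3 \<le> length vs" "P = cyclic_edges vs"
    and X: "\<forall>e\<in>P. \<forall>f\<in>P. e \<noteq> f \<longrightarrow> convex hull e \<inter> convex hull f = e \<inter> f"
    using assms unfolding simple_polygon_def by blast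
  have ne: "vs \<noteq> []" using vs by auto
  have P: "P = insert {last vs, hd vs} (path_edges vs)" using cyclic_edges_path_edges[OF ne] vs by simp
  obtain x y zs where xy: "vs = x # y # zs" "zs \<noteq> []"
    using vs(2) by (cases vs; cases "tl vs"; cases "tl (tl vs)") auto
  have lasty: "last vs \<noteq> y" "last vs \<noteq> x" using xy vs(1) by (auto simp: last_in_set)
  \<comment> \<open>Because there are at least three vertices, the closing edge is not already an
    edge of the list; so it meets the arc only where it should.\<close>
  have nin: "e \<noteq> {last vs, hd vs}" if "e \<in> path_edges vs" for e
  proof
    assume e: "e = {last vs, hd vs}"
    have "e = {x, y} \<or> e \<in> path_edges (y # zs)" using that xy by simp
    moreover have "e \<noteq> {x, y}" using e lasty xy by (auto simp: doubleton_eq_iff)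
    ultimately have "e \<subseteq> set (y # zs)" using path_edges_subset by blast
    then show False using e xy vs(1) by auto
  qed
  let ?g = "poly_path vs +++ linepath (last vs) (hd vs)"
  have ends: "pathstart (poly_path vs) = hd vs" "pathfinish (poly_path vs) = last vs"
    using poly_path_ends[of vs] vs by auto
  have pim: "path_image (poly_path vs) = (\<Union>e\<in>path_edges vs. convex hull e)"
    by (rule path_image_poly_path) (use vs in auto)
  have "simple_path ?g"
  proof (rule simple_path_join_loop)
    show "arc (poly_path vs)" by (rule arc_poly_path) (use vs X P in auto)
    show "arc (linepath (last vs) (hd vs))" using lasty xy by simp
    have "convex hull e \<inter> convex hull {last vs, hd vs} \<subseteq> {last vs, hd vs}" if "e \<in> path_edges vs" for e
      using X[rule_format, of e "{last vs, hd vs}"] P nin[OF that] that by auto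
    then show "path_image (poly_path vs) \<inter> path_image (linepath (last vs) (hd vs)) \<subseteq>
        {pathstart (poly_path vs), pathstart (linepath (last vs) (hd vs))}"
      unfolding pim path_image_linepath segment_convex_hull ends by auto
  qed (use ends in auto)
  moreover have "path_image ?g = polygon_boundary P"
    using ends pim by (simp add: path_image_join polygon_boundary_def P segment_convex_hull Un_commute)
  ultimately show ?thesis using that[of ?g] ends by simp
qed

section \<open>Orientation and crossing parity\<close>

lemma inside_connected_iff:
  assumes "connected C" "C \<subseteq> - S" "x \<in> C" "y \<in> C"
  shows "x \<in> inside S \<longleftrightarrow> y \<in> inside S"
proof -
  have "connected_component_set (- S) x = connected_component_set (- S) y"
    using assms by (metis connected_component_eq connected_component_maximal in_mono)
  then show ?thesis using assms by (auto simp: inside_def)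
qed

text \<open>Twice the signed area of the triangle \<open>p\<close>, \<open>q\<close>,
  \<open>r\<close>: positive iff \<open>r\<close> lies to the left of the line directed from
  \<open>p\<close> to \<open>q\<close>.\<close>

definition orient :: "complex \<Rightarrow> complex \<Rightarrow> complex \<Rightarrow> real" where
  "orient p q r = (Re q - Re p) * (Im r - Im p) - (Im q - Im p) * (Re r - Re p)"

lemma orient_rotate: "orient p q r = orient q r p"
  and orient_swap: "orient p q r = - orient p r q"
  and orient_same [simp]: "orient p p r = 0" "orient p q p = 0" "orient p q q = 0"
  by (simp_all add: orient_def algebra_simps)

lemma orient_affine: "orient p q ((1 - t) *\<^sub>R x + t *\<^sub>R y) = (1 - t) * orient p q x + t * orient p q y"
  by (simp add: orient_def algebra_simps)

lemma orient_inner: "orient p q r = Complex (- (Im q - Im p)) (Re q - Re p) \<bullet> r -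
   Complex (- (Im q - Im p)) (Re q - Re p) \<bullet> p"
  by (simp add: orient_def inner_complex_def algebra_simps)

lemma convex_orient: "convex {z. orient p q z > 0}" "convex {z. orient p q z < 0}" 
  unfolding orient_inner using convex_halfspace_gt convex_halfspace_lt by (simp_all add: algebra_simps)

lemma hull_doubletonE:
  assumes "z \<in> convex hull {A, B :: complex}"
  obtains s where "0 \<le> s" "s \<le> 1" "z = (1 - s) *\<^sub>R A + s *\<^sub>R B"
  using assms unfolding segment_convex_hull[symmetric] closed_segment_def by blast

lemma orient_on_hull:
  assumes "z \<in> convex hull {A, B}"
  shows "orient A B z = 0"
  using hull_doubletonE[OF assms] by (metis orient_affine orient_same(2,3) mult_zero_right add_0)

(* The two half-discs at c avoid the boundary, and by the Jordan curve theorem both the inside and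
   the outside meet their union. *)
lemma crossing_switch:
  assumes P: "simple_polygon P" and e: "{A, B} \<in> P" and c: "c \<in> convex hull {A, B}" "c \<noteq> A" "c \<noteq> B"
    and v: "orient A B (c + v) \<noteq> 0"
  obtains \<delta> where "\<delta> > 0" "\<And>s t. 0 < s \<Longrightarrow> s < \<delta> \<Longrightarrow> 0 < t \<Longrightarrow> t < \<delta> \<Longrightarrow>
    c - s *\<^sub>R v \<in> inside (polygon_boundary P) \<longleftrightarrow> c + t *\<^sub>R v \<notin> inside (polygon_boundary P)"
proof -
  define bd where "bd = polygon_boundary P"
  obtain g where g: "simple_path g" "pathfinish g = pathstart g" "path_image g = bd"
    using simple_polygon_loop[OF P] bd_def by metis
  have J: "open (inside bd)" "open (outside bd)" "inside bd \<inter> outside bd = {}"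
    "inside bd \<union> outside bd = - bd" "frontier (inside bd) = bd" "frontier (outside bd) = bd"
    using Jordan_inside_outside[OF g(1,2)] unfolding g(3) by blast+
  have X: "\<forall>e\<in>P. \<forall>f\<in>P. e \<noteq> f \<longrightarrow> convex hull e \<inter> convex hull f = e \<inter> f"
    and fin: "finite P" and fine: "\<forall>e\<in>P. finite e"
    using P unfolding simple_polygon_def cyclic_edges_def by auto
  have fin': "finite (P - {{A, B}})" using fin by simp
  \<comment> \<open>The other edges form a closed set that avoids \<open>c\<close>, hence a small
    disc around \<open>c\<close> meets the boundary only in the edge \<open>{A, B}\<close>.\<close>
  define O' where "O' = (\<Union>f\<in>P - {{A, B}}. convex hull f)"
  have "closed O'"
    unfolding O'_def using fin'
    by (intro closed_UN ballI compact_imp_closed finite_imp_compact_convex_hull) (use fine in auto)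
  moreover have "c \<notin> O'"
  proof
    assume "c \<in> O'"
    then obtain f where f: "f \<in> P" "f \<noteq> {A, B}" "c \<in> convex hull f" unfolding O'_def by auto
    have "convex hull {A, B} \<inter> convex hull f = {A, B} \<inter> f" using X e f by metis
    then show False using f c by auto
  qed
  ultimately obtain \<epsilon> where \<epsilon>: "\<epsilon> > 0" "ball c \<epsilon> \<inter> O' = {}"
    by (metis Compl_iff disjoint_eq_subset_Compl open_Compl open_contains_ball)
  have bdO: "bd = convex hull {A, B} \<union> O'"
    using e unfolding bd_def polygon_boundary_def O'_def by auto
  define Hp Hm where "Hp = ball c \<epsilon> \<inter> {z. orient A B z > 0}" and "Hm = ball c \<epsilon> \<inter> {z. orient A B z < 0}"
  have H: "convex Hp" "convex Hm" unfolding Hp_def Hm_def by (intro convex_Int convex_ball convex_orient)+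
  have Hbd: "Hp \<subseteq> - bd" "Hm \<subseteq> - bd"
    using \<epsilon> orient_on_hull unfolding Hp_def Hm_def bdO by fastforce+
  have c0: "orient A B c = 0" using orient_on_hull c by blast
  define k where "k = orient A B (c + v)"
  have k: "k = (Re B - Re A) * Im v - (Im B - Im A) * Re v"
    using c0 unfolding k_def orient_def by (simp add: algebra_simps)
  have ov: "orient A B (z + t *\<^sub>R v) = orient A B z + t * k" for z t
    unfolding k orient_def by (simp add: algebra_simps)
  have cbd: "c \<in> bd" using c bdO by blast
  have meets: "\<exists>z\<in>Q. z \<in> Hp \<union> Hm" if Q: "open Q" "c \<in> frontier Q" for Q
  proof -
    have "c \<in> closure Q" using Q by (simp add: frontier_def)
    then obtain p where p: "p \<in> Q \<inter> ball c \<epsilon>"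
      using \<epsilon>(1) by (metis IntI centre_in_ball closure_iff_nhds_not_empty disjoint_iff open_ball order_refl)
    show ?thesis
    proof (cases "orient A B p = 0")
      case False then show ?thesis using p unfolding Hp_def Hm_def by force
    next
      \<comment> \<open>A point of \<open>Q\<close> on the line through \<open>A\<close> and
        \<open>B\<close> is pushed off that line along \<open>v\<close>, by a step short enough to
        stay in \<open>Q\<close> and in the disc.\<close>
      case True
      have "open (Q \<inter> ball c \<epsilon>)" using Q by auto
      then obtain r where r: "r > 0" "ball p r \<subseteq> Q \<inter> ball c \<epsilon>" using p open_contains_ball by blast
      define t where "t = r / (2 * (norm v + 1))"
      have nv: "norm v + 1 > 0" by (smt (verit) norm_ge_zero)
      have t0: "t > 0" using r(1) nv unfolding t_def by simp
      have "t * (norm v + 1) = r / 2" using nv unfolding t_def by (simp add: field_simps)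
      then have "t * norm v = r / 2 - t" by (simp add: algebra_simps)
      then have t: "t > 0" "t * norm v < r" using t0 r(1) by linarith+
      have "p + t *\<^sub>R v \<in> ball p r" using t by (simp add: dist_norm)
      moreover have "orient A B (p + t *\<^sub>R v) \<noteq> 0" unfolding ov True using t v k_def by simp
      ultimately show ?thesis using r unfolding Hp_def Hm_def by force
    qed
  qed
  have side: "H \<subseteq> inside bd \<or> H \<subseteq> outside bd" if "convex H" "H \<subseteq> - bd" for H
    using connectedD[OF convex_connected[OF that(1)] J(1,2)] J that by blast
  obtain p q where pq: "p \<in> inside bd" "p \<in> Hp \<union> Hm" "q \<in> outside bd" "q \<in> Hp \<union> Hm"
    using meets[OF J(1)] meets[OF J(2)] J(5,6) cbd by blast
  have sides: "(Hp \<subseteq> inside bd \<and> Hm \<subseteq> outside bd) \<or> (Hp \<subseteq> outside bd \<and> Hm \<subseteq> inside bd)"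
    using side[OF H(1) Hbd(1)] side[OF H(2) Hbd(2)] pq J(3) by blast
  define \<delta> where "\<delta> = \<epsilon> / (norm v + 1)"
  have nv: "norm v + 1 > 0" by (smt (verit) norm_ge_zero)
  show ?thesis
  proof (rule that[of \<delta>])
    show "\<delta> > 0" using \<epsilon> nv by (simp add: \<delta>_def)
    fix s t assume st: "0 < s" "s < \<delta>" "0 < t" "t < \<delta>"
    have small: "r * norm v < \<epsilon>" if "0 < r" "r < \<delta>" for r
    proof -
      have "r * (norm v + 1) < \<epsilon>" using that nv by (simp add: \<delta>_def field_simps)
      then show ?thesis using that by (simp add: algebra_simps)
    qed
    have b: "c - s *\<^sub>R v \<in> ball c \<epsilon>" "c + t *\<^sub>R v \<in> ball c \<epsilon>"
      using small st by (auto simp: dist_norm)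
    have o: "orient A B (c - s *\<^sub>R v) = - s * k" "orient A B (c + t *\<^sub>R v) = t * k"
      using ov[of c "- s"] ov[of c t] c0 by simp_all
    have "(c - s *\<^sub>R v \<in> Hp \<and> c + t *\<^sub>R v \<in> Hm) \<or> (c - s *\<^sub>R v \<in> Hm \<and> c + t *\<^sub>R v \<in> Hp)"
      using b st v unfolding Hp_def Hm_def mem_Collect_eq Int_iff o k_def[symmetric]
      by (cases "k > 0") (auto simp: mult_less_0_iff zero_less_mult_iff)
    then show "c - s *\<^sub>R v \<in> inside (polygon_boundary P) \<longleftrightarrow> c + t *\<^sub>R v \<notin> inside (polygon_boundary P)"
      using sides J(3) unfolding bd_def[symmetric] by blast
  qed
qed

text \<open>The point moves along the line from the unbounded end. Before the first crossing it is
  outside, and each crossing is transversal and misses the endpoints of its edge, so it switches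
  sides. The induction is on the number of crossings passed.\<close>

lemma crossing_parity:
  assumes P: "simple_polygon P" and T: "finite T" and v: "v \<noteq> 0"
    and bd: "\<And>s. p + s *\<^sub>R v \<in> polygon_boundary P \<longleftrightarrow> s \<in> T"
    and cross: "\<And>s. s \<in> T \<Longrightarrow> \<exists>A B. {A, B} \<in> P \<and> p + s *\<^sub>R v \<in> convex hull {A, B} \<and>
       p + s *\<^sub>R v \<noteq> A \<and> p + s *\<^sub>R v \<noteq> B \<and> orient A B (p + s *\<^sub>R v + v) \<noteq> 0"
    and s: "s \<notin> T"
  shows "p + s *\<^sub>R v \<in> inside (polygon_boundary P) \<longleftrightarrow> odd (card {t \<in> T. t < s})"
  using s
proof (induction "card {t \<in> T. t < s}" arbitrary: s)
  case 0
  then have none: "\<not> t < s" if "t \<in> T" for t using that T by auto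
  let ?R = "(\<lambda>r. p + r *\<^sub>R v) ` {..s}"
  have "connected ?R" by (intro connected_continuous_image continuous_intros) auto
  moreover have "?R \<subseteq> - polygon_boundary P"
    using bd none 0(2) by (auto simp: order.order_iff_strict)
  ultimately have sub: "?R \<subseteq> connected_component_set (- polygon_boundary P) (p + s *\<^sub>R v)"
    by (intro connected_component_maximal) auto
  \<comment> \<open>A ray that avoids the boundary lies in an unbounded component of the
    complement.\<close>
  have "\<not> bounded ?R"
  proof
    assume "bounded ?R"
    then obtain K where K: "\<And>r. r \<le> s \<Longrightarrow> norm (p + r *\<^sub>R v) \<le> K" unfolding bounded_iff by auto
    define q where "q = (K + norm p + 1) / norm v"
    define r where "r = min s (- q)"
    have "\<bar>r\<bar> * norm v \<le> norm (p + r *\<^sub>R v) + norm p"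
      by (metis add.commute norm_scaleR norm_triangle_sub add_diff_cancel_left' norm_triangle_ineq4)
    moreover have "norm (p + r *\<^sub>R v) \<le> K" by (rule K) (simp add: r_def)
    moreover have "q \<le> \<bar>r\<bar>" unfolding r_def by auto
    then have "K + norm p + 1 \<le> \<bar>r\<bar> * norm v" using v by (simp add: q_def field_simps)
    ultimately show False by linarith
  qed
  then have "p + s *\<^sub>R v \<notin> inside (polygon_boundary P)"
    using sub bounded_subset unfolding inside_def by blast
  then show ?case unfolding 0(1)[symmetric] by simp
next
  case (Suc n)
  let ?L = "{t \<in> T. t < s}"
  have fin: "finite ?L" using T by simp
  have ne: "?L \<noteq> {}"
  proof
    assume "?L = {}"
    then have "card ?L = 0" by (simp only: card.empty)
    then show False using Suc(2) by linarith
  qed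
  define t0 where "t0 = Max ?L"
  have t0: "t0 \<in> T" "t0 < s" "\<And>t. t \<in> T \<Longrightarrow> t < s \<Longrightarrow> t \<le> t0"
    using Max_in[OF fin ne] Max_ge[OF fin] unfolding t0_def by auto
  obtain A B where AB: "{A, B} \<in> P" "p + t0 *\<^sub>R v \<in> convex hull {A, B}" "p + t0 *\<^sub>R v \<noteq> A"
    "p + t0 *\<^sub>R v \<noteq> B" "orient A B (p + t0 *\<^sub>R v + v) \<noteq> 0"
    using cross[OF t0(1)] by blast
  obtain \<delta> where \<delta>: "\<delta> > 0" "\<And>s t. 0 < s \<Longrightarrow> s < \<delta> \<Longrightarrow> 0 < t \<Longrightarrow> t < \<delta> \<Longrightarrow>
    p + t0 *\<^sub>R v - s *\<^sub>R v \<in> inside (polygon_boundary P) \<longleftrightarrow> p + t0 *\<^sub>R v + t *\<^sub>R v \<notin> inside (polygon_boundary P)"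
    using crossing_switch[OF P AB] by blast
  let ?L' = "{t \<in> T. t < t0}"
  \<comment> \<open>\<open>m\<close> is the previous crossing or \<open>t0 - \<delta>\<close>,
    whichever is later. Points between \<open>m\<close> and \<open>t0\<close> are near enough for
    the switch and have exactly the earlier crossings behind them.\<close>
  define m where "m = Max (insert (t0 - \<delta>) ?L')"
  have finL': "finite (insert (t0 - \<delta>) ?L')" using T by auto
  have m: "m < t0" "\<And>t. t \<in> T \<Longrightarrow> t < t0 \<Longrightarrow> t \<le> m" "t0 - \<delta> \<le> m"
    using Max_in[OF finL'] Max_ge[OF finL'] \<delta>(1) unfolding m_def by auto
  define a where "a = (m + t0) / 2"
  define b where "b = t0 + min (s - t0) \<delta> / 2"
  have a: "m < a" "a < t0" "t0 - a < \<delta>" using m(1,3) by (auto simp: a_def field_simps)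
  have b: "t0 < b" "b < s" "b - t0 < \<delta>" using t0 \<delta> by (auto simp: b_def min_def field_simps)
  have ab: "p + t0 *\<^sub>R v - (t0 - a) *\<^sub>R v = p + a *\<^sub>R v" "p + t0 *\<^sub>R v + (b - t0) *\<^sub>R v = p + b *\<^sub>R v"
    by (simp_all add: algebra_simps)
  have sw: "p + a *\<^sub>R v \<in> inside (polygon_boundary P) \<longleftrightarrow> p + b *\<^sub>R v \<notin> inside (polygon_boundary P)"
    unfolding ab[symmetric] by (rule \<delta>(2)) (use a b in auto)
  have "connected ((\<lambda>r. p + r *\<^sub>R v) ` {b..s})"
    by (intro connected_continuous_image continuous_intros) auto
  moreover have "(\<lambda>r. p + r *\<^sub>R v) ` {b..s} \<subseteq> - polygon_boundary P"
    using bd t0(3) b(1) Suc(3) by (fastforce simp: order.order_iff_strict)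
  ultimately have bs: "p + b *\<^sub>R v \<in> inside (polygon_boundary P) \<longleftrightarrow> p + s *\<^sub>R v \<in> inside (polygon_boundary P)"
    by (rule inside_connected_iff) (use b in auto)
  have eq: "?L = insert t0 {t \<in> T. t < a}" using t0 m(2) a by fastforce
  have "t0 \<notin> {t \<in> T. t < a}" using a by simp
  then have n: "n = card {t \<in> T. t < a}" using Suc(2) eq T by (simp add: card_insert_if)
  have "a \<notin> T" using m(2) a by force
  then have "p + a *\<^sub>R v \<in> inside (polygon_boundary P) \<longleftrightarrow> odd n" using Suc(1)[OF n] n by simp
  then show ?case using sw bs Suc(2) by (metis even_Suc)
qed

section \<open>Segments that meet only in common endpoints\<close>

lemma convex_comb_pos:
  fixes p q s :: real
  assumes "0 \<le> s" "s \<le> 1" "0 < p" "0 < q"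
  shows "0 < (1 - s) * p + s * q"
proof (cases "s = 0")
  case False
  then show ?thesis using assms by (intro add_nonneg_pos mult_nonneg_nonneg mult_pos_pos) auto
qed (use assms in simp)

text \<open>The factor \<open>\<sigma>\<close> stands for a sign, so that the two chains, which turn
  in opposite directions, can share the lemmas that follow.\<close>

lemma hulls_disjoint:
  assumes "\<sigma> * orient A B C > 0" "\<sigma> * orient A B D > 0"
  shows "convex hull {A, B} \<inter> convex hull {C, D} = {}"
proof -
  have "orient A B z \<noteq> 0" if z: "z \<in> convex hull {C, D}" for z
  proof -
    obtain s where s: "0 \<le> s" "s \<le> 1" "z = (1 - s) *\<^sub>R C + s *\<^sub>R D" using z by (rule hull_doubletonE)
    have "\<sigma> * orient A B z = (1 - s) * (\<sigma> * orient A B C) + s * (\<sigma> * orient A B D)"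
      unfolding s(3) orient_affine by (simp add: algebra_simps)
    also have "\<dots> > 0" by (rule convex_comb_pos) (use s assms in auto)
    finally show ?thesis by auto
  qed
  then show ?thesis using orient_on_hull by blast
qed

lemma hulls_share:
  assumes "orient A B D \<noteq> 0"
  shows "convex hull {A, B} \<inter> convex hull {A, D} = {A, B} \<inter> {A, D}"
proof -
  have "z = A" if z: "z \<in> convex hull {A, B}" "z \<in> convex hull {A, D}" for z
  proof -
    obtain s where s: "0 \<le> s" "s \<le> 1" "z = (1 - s) *\<^sub>R A + s *\<^sub>R D" using z(2) by (rule hull_doubletonE)
    have "0 = s * orient A B D" using orient_on_hull[OF z(1)] unfolding s(3) orient_affine by simp
    then show ?thesis using s assms by simp
  qed
  moreover have "B \<noteq> D" using assms by auto
  moreover have "A \<in> convex hull {A, B}" "A \<in> convex hull {A, D}" by (simp_all add: hull_inc)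
  ultimately show ?thesis by blast
qed

definition hulls_meet :: "complex set \<Rightarrow> complex set \<Rightarrow> bool" where
  "hulls_meet e f \<longleftrightarrow> convex hull e \<inter> convex hull f = e \<inter> f"

lemma hulls_meet_sym: "hulls_meet e f \<Longrightarrow> hulls_meet f e"
  unfolding hulls_meet_def by blast

lemma hulls_meet_disjoint:
  assumes "\<sigma> * orient A B C > 0" "\<sigma> * orient A B D > 0"
  shows "hulls_meet {A, B} {C, D}"
proof -
  have "{A, B} \<inter> {C, D} \<subseteq> convex hull {A, B} \<inter> convex hull {C, D}"
    by (meson Int_mono hull_subset)
  then show ?thesis using hulls_disjoint[OF assms] unfolding hulls_meet_def by simp
qed

lemma hulls_meet_share: "orient A B D \<noteq> 0 \<Longrightarrow> hulls_meet {A, B} {A, D}"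
  unfolding hulls_meet_def by (rule hulls_share)

text \<open>The points are in convex position, so arcs that do not interleave (disjoint, nested or
  with a common end) become chords without a crossing; the turning direction of the triples settles
  each case.\<close>

lemma mono_mono_meet:
  fixes c :: "nat \<Rightarrow> complex"
  assumes conv: "\<And>i j h. i < j \<Longrightarrow> j < h \<Longrightarrow> h < M \<Longrightarrow> \<sigma> * orient (c i) (c j) (c h) > 0"
    and E: "E \<subseteq> arcs 0 M" "noncrossing E" and e: "(i, j) \<in> E" "(g, h) \<in> E" "(i, j) \<noteq> (g, h)"
  shows "hulls_meet {c i, c j} {c g, c h}"
proof -
  have main: "hulls_meet {c i, c j} {c g, c h}" if e: "(i, j) \<in> E" "(g, h) \<in> E" "i < g \<or> (i = g \<and> j < h)" for i j g h
  proof -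
    have b: "i < j" "j < M" "g < h" "h < M" using arcs_bounds[OF E(1)] e by blast+
    have nc: "\<not> (i < g \<and> g < j \<and> j < h)" using noncrossingD[OF E(2)] e by blast
    consider "i = g" "j < h" | "i < g" "g = j" | "i < g" "j = h" | "i < g" "j < g" | "i < g" "h < j"
      using e(3) nc b by force
    then show ?thesis
    proof cases
      case 1
      have "orient (c i) (c j) (c h) \<noteq> 0" using conv[of i j h] 1 b by auto
      then show ?thesis using 1 hulls_meet_share by simp
    next
      case 2
      have "orient (c j) (c i) (c h) \<noteq> 0" using conv[of i j h] 2 b
        by (metis orient_rotate orient_swap mult_zero_right less_irrefl neg_equal_0_iff_equal)
      then show ?thesis using 2 hulls_meet_share[of "c j" "c i" "c h"] by (simp add: insert_commute)
    next
      case 3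
      have "orient (c j) (c i) (c g) \<noteq> 0" using conv[of i g j] 3 b
        by (metis orient_rotate orient_swap mult_zero_right less_irrefl neg_equal_0_iff_equal)
      then show ?thesis using 3 hulls_meet_share[of "c j" "c i" "c g"] by (simp add: insert_commute)
    next
      case 4
      show ?thesis by (rule hulls_meet_disjoint[of \<sigma>]) (use 4 b in \<open>auto intro!: conv\<close>)
    next
      case 5
      have "orient (c i) (c j) (c g) = - orient (c i) (c g) (c j)" "orient (c i) (c j) (c h) = - orient (c i) (c h) (c j)"
        by (rule orient_swap)+
      then show ?thesis using 5 b conv[of i g j] conv[of i h j]
        by (intro hulls_meet_disjoint[of "- \<sigma>"]) auto
    qed
  qed
  consider "i < g \<or> (i = g \<and> j < h)" | "g < i \<or> (g = i \<and> h < j)" using e(3) by force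
  then show ?thesis
  proof cases
    case 1 then show ?thesis using main e by blast
  next
    case 2 then show ?thesis using main[of g h i j] e hulls_meet_sym by blast
  qed
qed

text \<open>The case \<open>i < h < j\<close> is where the bend of the chain counts:
  \<open>c h\<close> lies on the same side of the line through \<open>c i\<close> and
  \<open>c j\<close> as the other chain, so the joining edge stays on that side. If \<open>h\<close>
  is not between, \<open>c i\<close> and \<open>c j\<close> lie on one side of the line of the
  joining edge.\<close>

lemma mono_bi_meet:
  fixes c d :: "nat \<Rightarrow> complex"
  assumes ccc: "\<And>i j h. i < j \<Longrightarrow> j < h \<Longrightarrow> h < M \<Longrightarrow> \<sigma> * orient (c i) (c j) (c h) > 0"
    and ccd: "\<And>i j y. i < j \<Longrightarrow> j < M \<Longrightarrow> y < M \<Longrightarrow> \<sigma> * orient (c i) (c j) (d y) < 0"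
    and ij: "i < j" "j < M" and h: "h < M" "y < M"
  shows "hulls_meet {c i, c j} {c h, d y}"
proof -
  have ne: "orient (c i) (c j) (d y) \<noteq> 0" using ccd[OF ij h(2)] by auto
  have o: "orient (c h) (d y) (c k) = - orient (c h) (c k) (d y)" for k by (rule orient_swap)
  have o': "orient (c h) (d y) (c k) = orient (c k) (c h) (d y)" for k by (metis orient_rotate)
  consider "h = i" | "h = j" | "h < i" | "j < h" | "i < h" "h < j" by linarith
  then show ?thesis
  proof cases
    case 1 then show ?thesis using hulls_meet_share[OF ne] by simp
  next
    case 2
    have "orient (c j) (c i) (d y) \<noteq> 0" using ne by (metis orient_rotate orient_swap neg_equal_0_iff_equal)
    then show ?thesis using 2 hulls_meet_share[of "c j" "c i" "d y"] by (simp add: insert_commute)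
  next
    case 3
    have "hulls_meet {c h, d y} {c i, c j}"
      using ccd[of h i y] ccd[of h j y] 3 ij h by (intro hulls_meet_disjoint[of \<sigma>]) (auto simp: o)
    then show ?thesis by (rule hulls_meet_sym)
  next
    case 4
    have "hulls_meet {c h, d y} {c i, c j}"
      using ccd[of i h y] ccd[of j h y] 4 ij h by (intro hulls_meet_disjoint[of "- \<sigma>"]) (auto simp: o')
    then show ?thesis by (rule hulls_meet_sym)
  next
    case 5
    have "orient (c i) (c j) (c h) = - orient (c i) (c h) (c j)" by (rule orient_swap)
    then show ?thesis
      using ccd[OF ij h(2)] ccc[of i h j] 5 ij by (intro hulls_meet_disjoint[of "- \<sigma>"]) auto
  qed
qed

text \<open>Normal form of a double chain. Both chains are numbered from left to right; the signs
  say that \<open>u\<close> runs above \<open>l\<close> and that each chain bends towards the other,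
  and the line \<open>a \<bullet> z = b\<close> separates them.\<close>

locale facing_chains =
  fixes u l :: "nat \<Rightarrow> complex" and M :: nat and a :: complex and b :: real
  assumes UUL: "i < j \<Longrightarrow> j < M \<Longrightarrow> h < M \<Longrightarrow> orient (u i) (u j) (l h) < 0"
    and LLU: "i < j \<Longrightarrow> j < M \<Longrightarrow> h < M \<Longrightarrow> orient (l i) (l j) (u h) > 0"
    and UUU: "i < j \<Longrightarrow> j < h \<Longrightarrow> h < M \<Longrightarrow> orient (u i) (u j) (u h) > 0"
    and LLL: "i < j \<Longrightarrow> j < h \<Longrightarrow> h < M \<Longrightarrow> orient (l i) (l j) (l h) < 0"
    and above: "i < M \<Longrightarrow> b < a \<bullet> u i" and below: "i < M \<Longrightarrow> a \<bullet> l i < b"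
begin

lemma u_neq_l: "i < M \<Longrightarrow> j < M \<Longrightarrow> u i \<noteq> l j"
  using above[of i] below[of j] by auto

lemma u_inj: "i < M \<Longrightarrow> j < M \<Longrightarrow> u i = u j \<longleftrightarrow> i = j"
  using UUL[of i j 0] UUL[of j i 0] by (cases i j rule: linorder_cases) auto

lemma l_inj: "i < M \<Longrightarrow> j < M \<Longrightarrow> l i = l j \<longleftrightarrow> i = j"
  using LLU[of i j 0] LLU[of j i 0] by (cases i j rule: linorder_cases) auto

lemma u_bi_meet: "i < j \<Longrightarrow> j < M \<Longrightarrow> h < M \<Longrightarrow> y < M \<Longrightarrow> hulls_meet {u i, u j} {u h, l y}"
  by (rule mono_bi_meet[where \<sigma> = 1 and M = M]) (auto intro: UUU UUL)

lemma l_bi_meet: "i < j \<Longrightarrow> j < M \<Longrightarrow> h < M \<Longrightarrow> y < M \<Longrightarrow> hulls_meet {l i, l j} {u h, l y}"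
  using mono_bi_meet[where \<sigma> = "-1" and M = M and c = l and d = u] LLL LLU
  by (simp add: insert_commute)

text \<open>Walking down a joining edge from \<open>u x\<close> to \<open>l y\<close>, the later
  joining edges are on the left hand, strictly so in each coordinate that grows.\<close>

lemma bi_left:
  assumes "before (x, y) (x', y')" "x < M" "y < M" "x' < M" "y' < M"
  shows "orient (u x) (l y) (u x') \<ge> 0" "orient (u x) (l y) (l y') \<ge> 0"
    "x < x' \<Longrightarrow> orient (u x) (l y) (u x') > 0" "y < y' \<Longrightarrow> orient (u x) (l y) (l y') > 0"
proof -
  have o: "orient (u x) (l y) (u x') = - orient (u x) (u x') (l y)" by (rule orient_swap)
  have o': "orient (u x) (l y) (l y') = orient (l y) (l y') (u x)" by (rule orient_rotate)
  show 1: "x < x' \<Longrightarrow> orient (u x) (l y) (u x') > 0" using UUL[of x x' y] o assms by simp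
  show 2: "y < y' \<Longrightarrow> orient (u x) (l y) (l y') > 0" using LLU[of y y' x] o' assms by simp
  show "orient (u x) (l y) (u x') \<ge> 0"
    using 1 assms(1) by (cases "x = x'") (auto simp: before_def)
  show "orient (u x) (l y) (l y') \<ge> 0"
    using 2 assms(1) by (cases "y = y'") (auto simp: before_def)
qed

lemma bi_bi_meet:
  assumes "before (x, y) (x', y')" "x < M" "y < M" "x' < M" "y' < M"
  shows "hulls_meet {u x, l y} {u x', l y'}"
proof -
  consider "x = x'" "y < y'" | "x < x'" "y = y'" | "x < x'" "y < y'"
    using assms(1) by (force simp: before_def)
  then show ?thesis
  proof cases
    case 1
    then have "orient (u x) (l y) (l y') \<noteq> 0" using bi_left[OF assms] by auto
    then show ?thesis using 1 hulls_meet_share by simp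
  next
    case 2
    have "orient (l y) (u x) (u x') = - orient (u x) (l y) (u x')" by (metis orient_rotate orient_swap)
    then have "orient (l y) (u x) (u x') \<noteq> 0" using 2 bi_left[OF assms] by auto
    then show ?thesis using 2 hulls_meet_share[of "l y" "u x" "u x'"] by (simp add: insert_commute)
  next
    case 3
    then show ?thesis using bi_left[OF assms] by (intro hulls_meet_disjoint[of 1]) auto
  qed
qed

section \<open>Crossings of joining edges with the separating line\<close>

definition cross_pt :: "nat \<Rightarrow> nat \<Rightarrow> complex" where
  "cross_pt x y = (let t = (a \<bullet> u x - b) / (a \<bullet> u x - a \<bullet> l y) in (1 - t) *\<^sub>R u x + t *\<^sub>R l y)"

lemma cross_ptE:
  assumes "x < M" "y < M"
  obtains t where "0 < t" "t < 1" "cross_pt x y = (1 - t) *\<^sub>R u x + t *\<^sub>R l y"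
proof
  let ?t = "(a \<bullet> u x - b) / (a \<bullet> u x - a \<bullet> l y)"
  show "0 < ?t" "?t < 1" using above[OF assms(1)] below[OF assms(2)] by simp_all
  show "cross_pt x y = (1 - ?t) *\<^sub>R u x + ?t *\<^sub>R l y" by (simp add: cross_pt_def Let_def)
qed

lemma a_cross_pt:
  assumes "x < M" "y < M"
  shows "a \<bullet> cross_pt x y = b"
proof -
  define t where "t = (a \<bullet> u x - b) / (a \<bullet> u x - a \<bullet> l y)"
  have "t * (a \<bullet> u x - a \<bullet> l y) = a \<bullet> u x - b"
    using above[OF assms(1)] below[OF assms(2)] by (simp add: t_def)
  moreover have "a \<bullet> cross_pt x y = (1 - t) * (a \<bullet> u x) + t * (a \<bullet> l y)"
    by (simp add: cross_pt_def Let_def inner_add_right t_def)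
  ultimately show ?thesis by (simp add: algebra_simps)
qed

lemma cross_pt_unique:
  assumes "x < M" "y < M" "z \<in> convex hull {u x, l y}" "a \<bullet> z = b"
  shows "z = cross_pt x y"
proof -
  obtain s where s: "z = (1 - s) *\<^sub>R u x + s *\<^sub>R l y" using assms(3) by (rule hull_doubletonE)
  have "b = (1 - s) * (a \<bullet> u x) + s * (a \<bullet> l y)" using assms(4) s by (simp add: inner_right_distrib)
  then have "s = (a \<bullet> u x - b) / (a \<bullet> u x - a \<bullet> l y)"
    using above[OF assms(1)] below[OF assms(2)] by (simp add: field_simps)
  then show ?thesis using s by (simp add: cross_pt_def Let_def)
qed

text \<open>\<open>dir\<close> is \<open>a\<close> turned clockwise by a right angle, so
  \<open>line_pt\<close> runs along the separating line from left to right. It has the length of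
  \<open>a\<close>, which explains the denominator in \<open>cross_param\<close>.\<close>

definition dir :: complex where "dir = Complex (Im a) (- Re a)"
definition line_pt :: "real \<Rightarrow> complex" where "line_pt s = (b / (a \<bullet> a)) *\<^sub>R a + s *\<^sub>R dir"
definition cross_param :: "nat \<Rightarrow> nat \<Rightarrow> real" where
  "cross_param x y = (cross_pt x y \<bullet> dir) / (a \<bullet> a)"

lemma a_nonzero: "0 < M \<Longrightarrow> a \<noteq> 0"
  using above[of 0] below[of 0] by auto

lemma a_dir: "a \<bullet> dir = 0"
  by (simp add: dir_def inner_complex_def)

lemma a_line_pt: "0 < M \<Longrightarrow> a \<bullet> line_pt s = b"
  using a_nonzero a_dir by (simp add: line_pt_def inner_add_right)

lemma line_pt_of_line:
  assumes "0 < M" "a \<bullet> z = b"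
  shows "line_pt ((z \<bullet> dir) / (a \<bullet> a)) = z"
proof -
  define n where "n = a \<bullet> a"
  have n: "n \<noteq> 0" "n = Re a * Re a + Im a * Im a"
    using a_nonzero[OF assms(1)] by (simp add: n_def) (simp add: n_def inner_complex_def)
  have "n *\<^sub>R line_pt ((z \<bullet> dir) / n) = (a \<bullet> z) *\<^sub>R a + (z \<bullet> dir) *\<^sub>R dir"
    using n(1) assms(2) by (simp add: line_pt_def n_def[symmetric] algebra_simps)
  also have "\<dots> = n *\<^sub>R z"
    unfolding n(2) dir_def inner_complex_def by (simp add: complex_eq_iff algebra_simps)
  finally show ?thesis using n(1) unfolding n_def by simp
qed

lemma line_pt_cross_param: "x < M \<Longrightarrow> y < M \<Longrightarrow> line_pt (cross_param x y) = cross_pt x y"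
  unfolding cross_param_def by (rule line_pt_of_line) (auto simp: a_cross_pt)

lemma line_pt_inject: "0 < M \<Longrightarrow> line_pt s = line_pt t \<longleftrightarrow> s = t"
  using a_nonzero by (auto simp: line_pt_def dir_def complex_eq_iff)

text \<open>On the separating line the orientation is affine in the parameter, with positive slope
  and zero at the crossing. This orders the crossings and also shows that they are
  transversal.\<close>

lemma orient_line_pt:
  assumes "x < M" "y < M"
  shows "\<exists>k>0. (\<forall>s. orient (u x) (l y) (line_pt s) = (s - cross_param x y) * k) \<and>
    (\<forall>z. orient (u x) (l y) (z + dir) = orient (u x) (l y) z + k)"
proof -
  define k where "k = a \<bullet> (u x - l y)"
  have k: "k > 0" using above[OF assms(1)] below[OF assms(2)] by (simp add: k_def inner_diff_right)
  have aff: "orient (u x) (l y) (z + s *\<^sub>R dir) = orient (u x) (l y) z + s * k" for z s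
    unfolding orient_def dir_def k_def inner_complex_def by (simp add: algebra_simps)
  obtain t where t: "0 < t" "t < 1" "cross_pt x y = (1 - t) *\<^sub>R u x + t *\<^sub>R l y"
    using cross_ptE[OF assms] .
  have 0: "orient (u x) (l y) (line_pt (cross_param x y)) = 0"
    unfolding line_pt_cross_param[OF assms] t(3) orient_affine by simp
  have lp: "line_pt s = line_pt (cross_param x y) + (s - cross_param x y) *\<^sub>R dir" for s
    by (simp add: line_pt_def algebra_simps)
  have "orient (u x) (l y) (line_pt s) = (s - cross_param x y) * k" for s
    unfolding lp[of s] aff 0 by simp
  moreover have "orient (u x) (l y) (z + dir) = orient (u x) (l y) z + k" for z
    using aff[of z 1] by simp
  ultimately show ?thesis using k by blast
qed

text \<open>The crossing point of the later edge is a proper convex combination of its endpoints,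
  which lie both weakly and at least one strictly to the left of the earlier edge.\<close>

lemma cross_param_mono:
  assumes "before (x, y) (x', y')" "x < M" "y < M" "x' < M" "y' < M"
  shows "cross_param x y < cross_param x' y'"
proof -
  obtain k where k: "k > 0" "\<And>s. orient (u x) (l y) (line_pt s) = (s - cross_param x y) * k"
    "\<And>z. orient (u x) (l y) (z + dir) = orient (u x) (l y) z + k"
    using orient_line_pt[OF assms(2,3)] by blast
  obtain t where t: "0 < t" "t < 1" "cross_pt x' y' = (1 - t) *\<^sub>R u x' + t *\<^sub>R l y'"
    using cross_ptE[OF assms(4,5)] .
  note bl = bi_left[OF assms]
  have "(cross_param x' y' - cross_param x y) * k = orient (u x) (l y) (cross_pt x' y')"
    using k(2)[of "cross_param x' y'"] line_pt_cross_param[OF assms(4,5)] by simp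
  also have "\<dots> = (1 - t) * orient (u x) (l y) (u x') + t * orient (u x) (l y) (l y')"
    unfolding t(3) orient_affine ..
  also have "\<dots> > 0"
  proof (cases "x < x'")
    case True
    then show ?thesis using bl t by (intro add_pos_nonneg mult_pos_pos mult_nonneg_nonneg) auto
  next
    case False
    then have "y < y'" using assms(1) by (force simp: before_def)
    then show ?thesis using bl t by (intro add_nonneg_pos mult_pos_pos mult_nonneg_nonneg) auto
  qed
  finally show ?thesis using k(1) by (simp add: zero_less_mult_iff)
qed

lemma hull_above: "i < M \<Longrightarrow> j < M \<Longrightarrow> z \<in> convex hull {u i, u j} \<Longrightarrow> b < a \<bullet> z"
  using hull_minimal[of "{u i, u j}" "{z. b < a \<bullet> z}" convex] above convex_halfspace_gt[of b a]
  by (auto simp: subset_iff)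

lemma hull_below: "i < M \<Longrightarrow> j < M \<Longrightarrow> z \<in> convex hull {l i, l j} \<Longrightarrow> a \<bullet> z < b"
  using hull_minimal[of "{l i, l j}" "{z. a \<bullet> z < b}" convex] below convex_halfspace_lt[of a b]
  by (auto simp: subset_iff)

definition chain_edges :: "(nat \<times> nat) set \<Rightarrow> (nat \<times> nat) set \<Rightarrow> (nat \<times> nat) set \<Rightarrow> complex set set" where
  "chain_edges EU EL B = (\<lambda>(i, j). {u i, u j}) ` EU \<union> (\<lambda>(i, j). {l i, l j}) ` EL \<union> (\<lambda>(x, y). {u x, l y}) ` B"

end

lemma fits_between:
  assumes B: "B \<subseteq> {..<M} \<times> {..<M}"
    and total: "\<And>p q. p \<in> B \<Longrightarrow> q \<in> B \<Longrightarrow> p \<noteq> q \<Longrightarrow> before p q \<or> before q p"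
    and h: "h < M" "\<And>p. p \<in> B \<Longrightarrow> fst p \<noteq> h"
  shows "\<exists>j<M. \<forall>p\<in>B. (before p (h, j) \<longleftrightarrow> fst p < h) \<and> (before p (h, j) \<or> before (h, j) p)"
proof -
  \<comment> \<open>The partner \<open>j\<close> is the largest one used to the left of
    \<open>h\<close>; the added 0 serves if there is none.\<close>
  define Y where "Y = insert 0 (snd ` {p \<in> B. fst p < h})"
  define j where "j = Max Y"
  have "finite B" using B by (rule finite_subset) auto
  then have finY: "finite Y" by (simp add: Y_def)
  have jY: "j \<in> Y" "\<And>y. y \<in> Y \<Longrightarrow> y \<le> j" using Max_in[OF finY] Max_ge[OF finY] unfolding j_def[symmetric] by (auto simp: Y_def)
  have "j < M" using jY(1) B h(1) by (auto simp: Y_def)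
  moreover have "(fst p < h \<longrightarrow> before p (h, j)) \<and> (\<not> fst p < h \<longrightarrow> before (h, j) p)" if p: "p \<in> B" for p
  proof (cases "fst p < h")
    case True
    then have "snd p \<in> Y" using p by (auto simp: Y_def)
    then show ?thesis using True jY(2)[of "snd p"] by (auto simp: before_def)
  next
    case False
    then have lt: "h < fst p" using h(2)[OF p] by simp
    have "j \<le> snd p"
    proof (cases "j = 0")
      case False
      then obtain q where q: "q \<in> B" "fst q < h" "snd q = j" using jY(1) by (auto simp: Y_def)
      then show ?thesis using total[OF q(1) p] lt by (auto simp: before_def)
    qed simp
    then show ?thesis using lt False by (auto simp: before_def)
  qed
  moreover have "\<not> before (h, j) p" if "fst p < h" for p using that by (auto simp: before_def)
  moreover have "\<not> before p (h, j)" if "h < fst p" for p using that by (auto simp: before_def)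
  ultimately show ?thesis using h(2) by (metis linorder_neqE_nat)
qed

section \<open>Points left outside by a polygon on facing chains\<close>

locale chain_polygon = facing_chains +
  fixes EU EL B :: "(nat \<times> nat) set"
  assumes EU: "EU \<subseteq> arcs 0 M" "noncrossing EU" and EL: "EL \<subseteq> arcs 0 M" "noncrossing EL"
    and B: "B \<subseteq> {..<M} \<times> {..<M}"
    and B_total: "p \<in> B \<Longrightarrow> q \<in> B \<Longrightarrow> p \<noteq> q \<Longrightarrow> before p q \<or> before q p"
begin

abbreviation "P \<equiv> chain_edges EU EL B"

lemma EU_b: "(i, j) \<in> EU \<Longrightarrow> i < j \<and> j < M" and EL_b: "(i, j) \<in> EL \<Longrightarrow> i < j \<and> j < M"
  and B_b: "(x, y) \<in> B \<Longrightarrow> x < M \<and> y < M"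
  using arcs_bounds[OF EU(1)] arcs_bounds[OF EL(1)] B by auto

lemma u_l_meet:
  assumes "i < M" "j < M" "g < M" "h < M"
  shows "hulls_meet {u i, u j} {l g, l h}"
proof -
  have "convex hull {u i, u j} \<inter> convex hull {l g, l h} = {}"
    using hull_above[of i j] hull_below[of g h] assms by force
  moreover have "{u i, u j} \<inter> {l g, l h} = {}" using u_neq_l assms by auto
  ultimately show ?thesis unfolding hulls_meet_def by simp
qed

lemma P_cases:
  assumes "e \<in> P"
  obtains (U) i j where "(i, j) \<in> EU" "e = {u i, u j}" | (L) i j where "(i, j) \<in> EL" "e = {l i, l j}"
    | (B) x y where "(x, y) \<in> B" "e = {u x, l y}"
  using assms unfolding chain_edges_def by auto

lemma P_meet:
  assumes ef: "e \<in> P" "f \<in> P" "e \<noteq> f"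
  shows "hulls_meet e f"
  using ef(1)
proof (cases rule: P_cases)
  case e: (U i j)
  show ?thesis using ef(2)
  proof (cases rule: P_cases)
    case (U g h)
    show ?thesis unfolding U e
      by (rule mono_mono_meet[where \<sigma> = 1 and M = M and E = EU]) (use EU U e ef(3) in \<open>auto intro: UUU\<close>)
  next
    case (L g h) then show ?thesis using e u_l_meet EU_b EL_b by (metis order.strict_trans)
  next
    case (B x y) then show ?thesis using e u_bi_meet EU_b B_b by metis
  qed
next
  case e: (L i j)
  show ?thesis using ef(2)
  proof (cases rule: P_cases)
    case (U g h) then show ?thesis using e u_l_meet hulls_meet_sym EU_b EL_b by (metis order.strict_trans)
  next
    case (L g h)
    show ?thesis unfolding L e
      by (rule mono_mono_meet[where \<sigma> = "-1" and M = M and E = EL]) (use EL L e ef(3) in \<open>auto intro: LLL\<close>)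
  next
    case (B x y) then show ?thesis using e l_bi_meet EL_b B_b by metis
  qed
next
  case e: (B x y)
  show ?thesis using ef(2)
  proof (cases rule: P_cases)
    case (U g h) then show ?thesis using e u_bi_meet hulls_meet_sym EU_b B_b by metis
  next
    case (L g h) then show ?thesis using e l_bi_meet hulls_meet_sym EL_b B_b by metis
  next
    case (B x' y')
    then have "before (x, y) (x', y') \<or> before (x', y') (x, y)" using B_total e ef(3) by blast
    then show ?thesis using bi_bi_meet hulls_meet_sym B e B_b by metis
  qed
qed

lemma finite_B: "finite B"
  using B by (rule finite_subset) auto

text \<open>Edges within a chain stay strictly on one side of the separating line, so only the
  joining edges meet it, each exactly once.\<close>

lemma line_pt_boundary:
  assumes "0 < M"
  shows "line_pt s \<in> polygon_boundary P \<longleftrightarrow> s \<in> (\<lambda>(x, y). cross_param x y) ` B"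
proof
  assume "line_pt s \<in> polygon_boundary P"
  then obtain e where e: "e \<in> P" "line_pt s \<in> convex hull e" unfolding polygon_boundary_def by auto
  note al = a_line_pt[OF assms, of s]
  show "s \<in> (\<lambda>(x, y). cross_param x y) ` B" using e(1)
  proof (cases rule: P_cases)
    case (U i j) then show ?thesis using hull_above[of i j "line_pt s"] EU_b[of i j] e al by auto
  next
    case (L i j) then show ?thesis using hull_below[of i j "line_pt s"] EL_b[of i j] e al by auto
  next
    case (B x y)
    have "line_pt s = line_pt (cross_param x y)"
      using cross_pt_unique[of x y "line_pt s"] line_pt_cross_param[of x y] B_b[OF B(1)] e(2) B(2) al by simp
    then show ?thesis using B line_pt_inject[OF assms] by force
  qed
next
  assume "s \<in> (\<lambda>(x, y). cross_param x y) ` B"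
  then obtain x y where xy: "(x, y) \<in> B" "s = cross_param x y" by auto
  obtain t where t: "0 < t" "t < 1" "cross_pt x y = (1 - t) *\<^sub>R u x + t *\<^sub>R l y"
    using cross_ptE[of x y] B_b[OF xy(1)] by blast
  have "line_pt s \<in> convex hull {u x, l y}"
    using t line_pt_cross_param[of x y] B_b[OF xy(1)] xy(2)
    unfolding segment_convex_hull[symmetric] closed_segment_def by auto
  moreover have "{u x, l y} \<in> P" using xy(1) unfolding chain_edges_def by force
  ultimately show "line_pt s \<in> polygon_boundary P" unfolding polygon_boundary_def by blast
qed

lemma cross_param_less_iff:
  assumes "x < M" "y < M" "h < M" "j < M" "before (x, y) (h, j) \<or> before (h, j) (x, y)"
  shows "cross_param x y < cross_param h j \<longleftrightarrow> before (x, y) (h, j)"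
  using cross_param_mono[of x y h j] cross_param_mono[of h j x y] assms
  by (auto simp: before_def)

text \<open>Crossing parity along the separating line: the crossings to the left of the virtual edge
  belong exactly to the members of \<open>B\<close> before it.\<close>

lemma cross_pt_outside:
  assumes P: "simple_polygon P" and hj: "h < M" "j < M"
    and tot: "\<And>p. p \<in> B \<Longrightarrow> before p (h, j) \<or> before (h, j) p"
    and ev: "even (card {p \<in> B. before p (h, j)})"
  shows "cross_pt h j \<notin> inside (polygon_boundary P)"
proof -
  have M: "0 < M" using hj by simp
  let ?T = "(\<lambda>(x, y). cross_param x y) ` B"
  let ?s = "cross_param h j"
  have less: "cross_param x y < ?s \<longleftrightarrow> before (x, y) (h, j)" if "(x, y) \<in> B" for x y
    using cross_param_less_iff[of x y h j] tot[OF that] B_b[OF that] hj by blast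
  have ne: "cross_param x y \<noteq> ?s" if "(x, y) \<in> B" for x y
    using tot[OF that] cross_param_mono[of x y h j] cross_param_mono[of h j x y] B_b[OF that] hj by force
  have inj: "inj_on (\<lambda>(x, y). cross_param x y) B"
  proof (rule inj_onI)
    fix p q assume pq: "p \<in> B" "q \<in> B" "(case p of (x, y) \<Rightarrow> cross_param x y) = (case q of (x, y) \<Rightarrow> cross_param x y)"
    obtain x y x' y' where [simp]: "p = (x, y)" "q = (x', y')" by fastforce
    show "p = q"
    proof (rule ccontr)
      assume "p \<noteq> q"
      then show False using B_total[OF pq(1,2)] pq(3) B_b[of x y] B_b[of x' y'] pq(1,2)
        cross_param_mono[of x y x' y'] cross_param_mono[of x' y' x y] by auto
    qed
  qed
  have "{t \<in> ?T. t < ?s} = (\<lambda>(x, y). cross_param x y) ` {p \<in> B. before p (h, j)}"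
    using less by auto
  then have "card {t \<in> ?T. t < ?s} = card {p \<in> B. before p (h, j)}"
    using inj by (simp add: card_image inj_on_subset)
  moreover have "line_pt ?s \<in> inside (polygon_boundary P) \<longleftrightarrow> odd (card {t \<in> ?T. t < ?s})"
    unfolding line_pt_def
  proof (rule crossing_parity[OF P])
    show "finite ?T" using finite_B by simp
    show "dir \<noteq> 0" using a_nonzero[OF M] by (auto simp: dir_def complex_eq_iff)
    show "((b / (a \<bullet> a)) *\<^sub>R a + s *\<^sub>R dir \<in> polygon_boundary P) = (s \<in> ?T)" for s
      using line_pt_boundary[OF M, of s] unfolding line_pt_def .
    show "?s \<notin> ?T" using ne by force
    fix s assume "s \<in> ?T"
    then obtain x y where xy: "(x, y) \<in> B" "s = cross_param x y" by auto
    have b: "x < M" "y < M" using B_b[OF xy(1)] by auto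
    obtain t where t: "0 < t" "t < 1" "cross_pt x y = (1 - t) *\<^sub>R u x + t *\<^sub>R l y"
      using cross_ptE[OF b] .
    have s: "line_pt s = cross_pt x y" using line_pt_cross_param[OF b] xy by simp
    have "{u x, l y} \<in> P" using xy(1) unfolding chain_edges_def by force
    moreover have "line_pt s \<in> convex hull {u x, l y}"
      unfolding s segment_convex_hull[symmetric] closed_segment_def using t by auto
    moreover have "line_pt s \<noteq> u x" "line_pt s \<noteq> l y"
      using a_cross_pt[OF b] above[OF b(1)] below[OF b(2)] unfolding s by auto
    moreover obtain k where k: "k > 0" "\<And>s. orient (u x) (l y) (line_pt s) = (s - cross_param x y) * k"
      "\<And>z. orient (u x) (l y) (z + dir) = orient (u x) (l y) z + k"
      using orient_line_pt[OF b] by blast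
    have "orient (u x) (l y) (line_pt s + dir) \<noteq> 0" using k xy(2) by simp
    ultimately show "\<exists>A B. {A, B} \<in> P \<and> (b / (a \<bullet> a)) *\<^sub>R a + s *\<^sub>R dir \<in> convex hull {A, B} \<and>
        (b / (a \<bullet> a)) *\<^sub>R a + s *\<^sub>R dir \<noteq> A \<and> (b / (a \<bullet> a)) *\<^sub>R a + s *\<^sub>R dir \<noteq> B \<and>
        orient A B ((b / (a \<bullet> a)) *\<^sub>R a + s *\<^sub>R dir + dir) \<noteq> 0"
      unfolding line_pt_def by blast
  qed
  ultimately show ?thesis using ev line_pt_cross_param[OF hj] by simp
qed

lemma inside_segment:
  fixes w z :: complex
  assumes "convex hull {w, z} \<inter> S = {}"
  shows "w \<in> inside S \<longleftrightarrow> z \<in> inside S"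
  by (rule inside_connected_iff[of "convex hull {w, z}"])
     (use assms in \<open>auto intro: convex_connected[OF convex_convex_hull] hull_inc\<close>)

lemma P_meet_bi:
  assumes "e \<in> P" "h < M" "j < M" "\<And>p. p \<in> B \<Longrightarrow> before p (h, j) \<or> before (h, j) p"
  shows "hulls_meet e {u h, l j}"
  using assms(1)
proof (cases rule: P_cases)
  case (U i g) then show ?thesis using u_bi_meet EU_b[OF U(1)] assms(2,3) by blast
next
  case (L i g) then show ?thesis using l_bi_meet EL_b[OF L(1)] assms(2,3) by blast
next
  case (B x y)
  then show ?thesis using bi_bi_meet hulls_meet_sym B_b[OF B(1)] assms(2,3) assms(4)[OF B(1)] by metis
qed

text \<open>The part of the virtual edge from \<open>w\<close> to the separating line avoids the
  boundary: it could be met only in an endpoint of the virtual edge, but \<open>w\<close> is no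
  vertex and the other endpoint is beyond the line. So \<open>w\<close> is outside together with the
  crossing point.\<close>

lemma not_inside:
  assumes P: "simple_polygon P" and hj: "h < M" "j < M"
    and tot: "\<And>p. p \<in> B \<Longrightarrow> before p (h, j) \<or> before (h, j) p"
    and ev: "even (card {p \<in> B. before p (h, j)})"
    and w: "w = u h \<or> w = l j" "w \<notin> \<Union> P"
  shows "w \<notin> inside (polygon_boundary P)"
proof -
  have "convex hull {w, cross_pt h j} \<inter> polygon_boundary P = {}"
  proof (rule ccontr)
    assume "\<not> ?thesis"
    then obtain z e where z: "z \<in> convex hull {w, cross_pt h j}" "e \<in> P" "z \<in> convex hull e"
      unfolding polygon_boundary_def by auto
    obtain t where t: "0 < t" "t < 1" "cross_pt h j = (1 - t) *\<^sub>R u h + t *\<^sub>R l j"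
      using cross_ptE[OF hj] .
    have "cross_pt h j \<in> convex hull {u h, l j}"
      unfolding t(3) segment_convex_hull[symmetric] closed_segment_def using t by auto
    then have "convex hull {w, cross_pt h j} \<subseteq> convex hull {u h, l j}"
      using w(1) by (intro hull_minimal) (auto intro: hull_inc)
    then have "z \<in> e \<inter> {u h, l j}"
      using z P_meet_bi[OF z(2) hj tot] unfolding hulls_meet_def by blast
    then have zw: "z \<in> {u h, l j}" "z \<noteq> w" using w(2) z(2) by auto
    obtain s where s: "0 \<le> s" "s \<le> 1" "z = (1 - s) *\<^sub>R w + s *\<^sub>R cross_pt h j"
      using z(1) by (rule hull_doubletonE)
    have az: "a \<bullet> z - b = (1 - s) * (a \<bullet> w - b)"
      unfolding s(3) by (simp add: inner_add_right a_cross_pt[OF hj] algebra_simps)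
    show False using w(1)
    proof
      assume w: "w = u h"
      then have "0 \<le> a \<bullet> z - b" unfolding az using above[OF hj(1)] s by simp
      then show False using zw w below[OF hj(2)] by auto
    next
      assume w: "w = l j"
      then have "a \<bullet> z - b \<le> 0" unfolding az using below[OF hj(2)] s by (simp add: mult_nonneg_nonpos)
      then show False using zw w above[OF hj(1)] by auto
    qed
  qed
  then show ?thesis using cross_pt_outside[OF P hj tot ev] inside_segment by blast
qed

lemma u_not_inside:
  assumes P: "simple_polygon P" and h: "h < M" "u h \<notin> \<Union> P" and ev: "even (card {p \<in> B. fst p < h})"
  shows "u h \<notin> inside (polygon_boundary P)"
proof -
  have "fst p \<noteq> h" if "p \<in> B" for p
    using that h(2) unfolding chain_edges_def by (force simp: case_prod_unfold)
  then obtain j where j: "j < M" "\<And>p. p \<in> B \<Longrightarrow> before p (h, j) \<longleftrightarrow> fst p < h"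
    "\<And>p. p \<in> B \<Longrightarrow> before p (h, j) \<or> before (h, j) p"
    using fits_between[OF B B_total h(1)] by blast
  have "{p \<in> B. before p (h, j)} = {p \<in> B. fst p < h}" using j(2) by blast
  then show ?thesis using not_inside[OF P h(1) j(1) j(3)] h(2) ev by simp
qed

lemma l_not_inside:
  assumes P: "simple_polygon P" and h: "h < M" "l h \<notin> \<Union> P" and ev: "even (card {p \<in> B. snd p < h})"
  shows "l h \<notin> inside (polygon_boundary P)"
proof -
  have ne: "snd p \<noteq> h" if "p \<in> B" for p
    using that h(2) unfolding chain_edges_def by (force simp: case_prod_unfold)
  have sw: "before (prod.swap p) (prod.swap q) \<longleftrightarrow> before p q" for p q :: "nat \<times> nat"
    by (auto simp: before_def prod_eq_iff)
  have "\<exists>j<M. \<forall>p\<in>prod.swap ` B. (before p (h, j) \<longleftrightarrow> fst p < h) \<and> (before p (h, j) \<or> before (h, j) p)"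
  proof (rule fits_between[OF _ _ h(1)])
    show "prod.swap ` B \<subseteq> {..<M} \<times> {..<M}" using B by auto
    fix p q assume pq: "p \<in> prod.swap ` B" "q \<in> prod.swap ` B" "p \<noteq> q"
    obtain p' q' where "p = prod.swap p'" "p' \<in> B" "q = prod.swap q'" "q' \<in> B"
      using pq(1,2) by (elim imageE)
    then show "before p q \<or> before q p" using B_total[of p' q'] pq(3) by (auto simp: sw)
  qed (use ne in force)
  then obtain j where j: "j < M"
    "\<And>p. p \<in> B \<Longrightarrow> (before (prod.swap p) (prod.swap (j, h)) \<longleftrightarrow> fst (prod.swap p) < h) \<and>
      (before (prod.swap p) (prod.swap (j, h)) \<or> before (prod.swap (j, h)) (prod.swap p))" by auto
  have j': "before p (j, h) \<longleftrightarrow> snd p < h" "before p (j, h) \<or> before (j, h) p" if "p \<in> B" for p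
    using j(2)[OF that] unfolding sw by auto
  have "{p \<in> B. before p (j, h)} = {p \<in> B. snd p < h}" using j'(1) by blast
  then show ?thesis using not_inside[OF P j(1) h(1) j'(2)] h(2) ev by simp
qed

end

section \<open>From a double chain to its normal form\<close>

lemma one_side_orient:
  assumes "on_one_side_of_line p q D" "p \<noteq> q"
  shows "(\<forall>d\<in>D. orient p q d < 0) \<or> (\<forall>d\<in>D. orient p q d > 0)"
proof -
  obtain a b where ab: "affine hull {p, q} = {x. a \<bullet> x = b}" "D \<subseteq> {x. a \<bullet> x < b}"
    using assms(1) unfolding on_one_side_of_line_def by blast
  have "p \<in> affine hull {p, q}" "q \<in> affine hull {p, q}" by (simp_all add: hull_inc)
  then have pq: "a \<bullet> p = b" "a \<bullet> q = b" using ab(1) by auto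
  define n where "n = Complex (- (Im q - Im p)) (Re q - Re p)"
  have "n \<noteq> 0" using assms(2) by (auto simp: n_def complex_eq_iff)
  then have nn: "n \<bullet> n > 0" by simp
  \<comment> \<open>\<open>a\<close> is orthogonal to \<open>q - p\<close> and hence parallel to the
    normal \<open>n\<close>; the sign of \<open>a \<bullet> n\<close> translates the half-plane into
    an orientation.\<close>
  have key: "(a \<bullet> n) * orient p q d < 0" if "d \<in> D" for d
  proof -
    have "a \<bullet> (q - p) = 0" using pq by (simp add: inner_diff_right)
    moreover have "(n \<bullet> n) * (a \<bullet> (d - p)) = (a \<bullet> n) * orient p q d + (a \<bullet> (q - p)) * ((q - p) \<bullet> (d - p))"
      unfolding n_def orient_def inner_complex_def by (simp add: algebra_simps)
    ultimately have "(n \<bullet> n) * (a \<bullet> (d - p)) = (a \<bullet> n) * orient p q d" by simp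
    moreover have "a \<bullet> (d - p) < 0" using that ab(2) pq by (auto simp: inner_diff_right)
    ultimately show ?thesis using nn by (metis mult_pos_neg)
  qed
  show ?thesis
  proof (cases "a \<bullet> n > 0")
    case True then show ?thesis using key by (auto simp: mult_less_0_iff)
  next
    case False then show ?thesis using key by (auto simp: mult_less_0_iff)
  qed
qed

lemma support_frontier:
  fixes f :: complex
  assumes "p \<in> S" "f \<noteq> 0" "\<And>z. z \<in> S \<Longrightarrow> f \<bullet> p \<le> f \<bullet> z"
  shows "p \<in> frontier (convex hull S)"
proof -
  have "convex hull S \<subseteq> {z. f \<bullet> z \<ge> f \<bullet> p}"
    using assms(3) by (intro hull_minimal convex_halfspace_ge) auto
  then have "interior (convex hull S) \<subseteq> {z. f \<bullet> z > f \<bullet> p}"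
    using interior_mono interior_halfspace_ge[OF assms(2)] by blast
  then have "p \<notin> interior (convex hull S)" by auto
  moreover have "p \<in> closure (convex hull S)"
    using assms(1) closure_subset hull_inc by (metis in_mono)
  ultimately show ?thesis by (simp add: frontier_def)
qed

lemma support_frontier_orient:
  assumes "p \<in> S" "A \<noteq> B" "orient A B p = 0" "\<And>z. z \<in> S \<Longrightarrow> \<sigma> * orient A B z \<ge> 0" "\<sigma> \<noteq> 0"
  shows "p \<in> frontier (convex hull S)"
proof (rule support_frontier[where f = "\<sigma> *\<^sub>R Complex (- (Im B - Im A)) (Re B - Re A)"])
  show "\<sigma> *\<^sub>R Complex (- (Im B - Im A)) (Re B - Re A) \<noteq> 0"
    using assms(2,5) by (auto simp: complex_eq_iff)
  fix z assume "z \<in> S"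
  then have "\<sigma> * orient A B p \<le> \<sigma> * orient A B z" using assms(3,4) by simp
  then show "(\<sigma> *\<^sub>R Complex (- (Im B - Im A)) (Re B - Re A)) \<bullet> p \<le> (\<sigma> *\<^sub>R Complex (- (Im B - Im A)) (Re B - Re A)) \<bullet> z"
    unfolding orient_inner by (simp add: right_diff_distrib)
qed (use assms in auto)

text \<open>The three orientations divided by that of the triangle are the barycentric coordinates
  of \<open>z\<close>.\<close>

lemma in_triangle:
  assumes "\<sigma> * orient p q z < 0" "\<sigma> * orient q r z < 0" "\<sigma> * orient r p z < 0"
  shows "z \<in> convex hull {p, q, r}"
proof -
  have sum: "orient q r z + orient r p z + orient p q z = orient p q r"
    unfolding orient_def by (simp add: algebra_simps)
  define D where "D = orient p q r"
  have s: "\<sigma> * D < 0" using assms sum unfolding D_def by (metis add_neg_neg distrib_left)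
  then have D: "D \<noteq> 0" by auto
  have nn: "0 \<le> x / D" if "\<sigma> * x < 0" for x
    using that s by (auto simp: mult_less_0_iff zero_le_divide_iff)
  have "D *\<^sub>R z = orient q r z *\<^sub>R p + orient r p z *\<^sub>R q + orient p q z *\<^sub>R r"
    unfolding D_def orient_def by (simp add: complex_eq_iff algebra_simps)
  then have "z = (orient q r z / D) *\<^sub>R p + (orient r p z / D) *\<^sub>R q + (orient p q z / D) *\<^sub>R r"
    using D by (metis (no_types, lifting) divide_inverse_commute scaleR_add_right scaleR_scaleR left_inverse scaleR_one)
  moreover have "orient q r z / D + orient r p z / D + orient p q z / D = 1"
    using D sum by (simp add: D_def flip: add_divide_distrib)
  ultimately show ?thesis
    unfolding convex_hull_3 using nn assms by blast
qed

lemma hull_orient: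
  "x \<in> convex hull A \<Longrightarrow> (\<And>y. y \<in> A \<Longrightarrow> orient p q y > 0) \<Longrightarrow> orient p q x > 0"
  "x \<in> convex hull A \<Longrightarrow> (\<And>y. y \<in> A \<Longrightarrow> orient p q y < 0) \<Longrightarrow> orient p q x < 0"
  using hull_minimal[of A "{x. orient p q x > 0}" convex] hull_minimal[of A "{x. orient p q x < 0}" convex]
    convex_orient by blast+

text \<open>Elements are numbered by rank, the number of their predecessors.\<close>

lemma enumerate_order:
  assumes fin: "finite C" and irr: "\<And>p. p \<in> C \<Longrightarrow> \<not> R p p"
    and trans: "\<And>p q r. p \<in> C \<Longrightarrow> q \<in> C \<Longrightarrow> r \<in> C \<Longrightarrow> R p q \<Longrightarrow> R q r \<Longrightarrow> R p r"
    and total: "\<And>p q. p \<in> C \<Longrightarrow> q \<in> C \<Longrightarrow> p \<noteq> q \<Longrightarrow> R p q \<or> R q p"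
  obtains c where "bij_betw c {..<card C} C" "\<And>i j. i < j \<Longrightarrow> j < card C \<Longrightarrow> R (c i) (c j)"
proof -
  define rk where "rk p = card {q \<in> C. R q p}" for p
  have lt: "rk p < rk q" if "p \<in> C" "q \<in> C" "R p q" for p q
  proof -
    have "{r \<in> C. R r p} \<subseteq> {r \<in> C. R r q}" using trans[OF _ that(1,2) _ that(3)] by blast
    moreover have "p \<in> {r \<in> C. R r q}" "p \<notin> {r \<in> C. R r p}" using that irr by blast+
    ultimately have "{r \<in> C. R r p} \<subset> {r \<in> C. R r q}" by blast
    then show ?thesis unfolding rk_def by (rule psubset_card_mono[rotated]) (use fin in simp)
  qed
  have inj: "inj_on rk C"
    by (rule inj_onI) (metis lt total less_irrefl)
  have "rk p < card C" if "p \<in> C" for p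
  proof -
    have "{q \<in> C. R q p} \<subset> C" using that irr by blast
    then show ?thesis unfolding rk_def by (rule psubset_card_mono[OF fin])
  qed
  then have "rk ` C = {..<card C}"
    using inj fin by (intro card_subset_eq) (auto simp: card_image)
  then have bij: "bij_betw rk C {..<card C}" using inj by (simp add: bij_betw_def)
  define c where "c = inv_into C rk"
  have cb: "bij_betw c {..<card C} C" unfolding c_def by (rule bij_betw_inv_into[OF bij])
  have "R (c i) (c j)" if "i < j" "j < card C" for i j
  proof -
    have m: "c i \<in> C" "c j \<in> C" using cb that by (auto simp: bij_betw_def)
    have r: "rk (c i) = i" "rk (c j) = j"
      using bij_betw_inv_into_right[OF bij] that unfolding c_def by auto
    then have "c i \<noteq> c j" using that by auto
    then show ?thesis using total[OF m] lt[OF m(2,1)] r that by auto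
  qed
  then show ?thesis using that cb by blast
qed

text \<open>\<open>p\<close> precedes \<open>q\<close> if the other chain lies on the side of their
  line prescribed by \<open>\<sigma>\<close>. The crux is transitivity: a cyclic triple would
  enclose all of \<open>D\<close> in the interior of a triangle, although \<open>D\<close> has a
  point on the frontier of the hull.\<close>

lemma chain_order:
  assumes fin: "finite C" and D: "D \<inter> frontier (convex hull S) \<noteq> {}" and S: "C \<union> D \<subseteq> S"
    and \<sigma>: "\<sigma> \<noteq> 0"
    and side: "\<And>p q. p \<in> C \<Longrightarrow> q \<in> C \<Longrightarrow> p \<noteq> q \<Longrightarrow> on_one_side_of_line p q D"
  obtains c where "bij_betw c {..<card C} C"
    "\<And>i j d. i < j \<Longrightarrow> j < card C \<Longrightarrow> d \<in> D \<Longrightarrow> \<sigma> * orient (c i) (c j) d < 0"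
proof -
  define R where "R p q \<longleftrightarrow> (\<forall>d\<in>D. \<sigma> * orient p q d < 0)" for p q
  obtain d0 where d0: "d0 \<in> D" "d0 \<in> frontier (convex hull S)" using D by blast
  have total: "R p q \<or> R q p" if "p \<in> C" "q \<in> C" "p \<noteq> q" for p q
  proof -
    have sw: "orient q p d = - orient p q d" for d by (simp add: orient_def algebra_simps)
    have s: "\<sigma> > 0 \<or> \<sigma> < 0" using \<sigma> by linarith
    from one_side_orient[OF side[OF that] that(3)] show ?thesis
    proof
      assume "\<forall>d\<in>D. orient p q d < 0"
      then show ?thesis using s unfolding R_def sw by (meson mult_neg_pos mult_pos_neg neg_0_less_iff_less neg_less_0_iff_less)
    next
      assume "\<forall>d\<in>D. orient p q d > 0"
      then show ?thesis using s unfolding R_def sw by (meson mult_neg_pos mult_pos_neg neg_0_less_iff_less neg_less_0_iff_less)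
    qed
  qed
  have irr: "\<not> R p p" for p using d0 unfolding R_def by auto
  have trans: "R p r" if pqr: "p \<in> C" "q \<in> C" "r \<in> C" "R p q" "R q r" for p q r
  proof (rule ccontr)
    assume n: "\<not> R p r"
    have "p \<noteq> r"
    proof
      assume "p = r"
      then have "\<sigma> * orient p q d0 < 0" "\<sigma> * orient q p d0 < 0" using pqr d0 unfolding R_def by auto
      moreover have "orient q p d0 = - orient p q d0" by (simp add: orient_def algebra_simps)
      ultimately show False by simp
    qed
    then have "R r p" using total n pqr by blast
    let ?W = "{z. \<sigma> * orient p q z < 0} \<inter> {z. \<sigma> * orient q r z < 0} \<inter> {z. \<sigma> * orient r p z < 0}"
    have "open ?W" unfolding orient_def by (intro open_Int open_Collect_less continuous_intros)
    moreover have "?W \<subseteq> convex hull S"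
    proof
      fix z assume "z \<in> ?W"
      then have "z \<in> convex hull {p, q, r}" using in_triangle by blast
      then show "z \<in> convex hull S" using hull_mono[of "{p, q, r}" S] pqr S by blast
    qed
    moreover have "d0 \<in> ?W" using d0 pqr \<open>R r p\<close> unfolding R_def by auto
    ultimately have "d0 \<in> interior (convex hull S)" using interiorI by blast
    then show False using d0 by (simp add: frontier_def)
  qed
  obtain c where "bij_betw c {..<card C} C" "\<And>i j. i < j \<Longrightarrow> j < card C \<Longrightarrow> R (c i) (c j)"
    by (rule enumerate_order[OF fin, of R]) (use irr trans total in blast)+
  then show ?thesis using that unfolding R_def by blast
qed

(* A line separating q from the rest of its chain leaves some point d of the other chain on the side
   of q, because q lies in the interior of the hull. Seen from d, the point q is then nearer than the
   segment from p to r. *)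
lemma chain_bends:
  assumes C: "finite C" "convex_position C" and S: "S = C \<union> D"
    and p: "p \<in> C" "q \<in> C" "r \<in> C" "q \<noteq> p" "q \<noteq> r" and q: "q \<notin> frontier (convex hull S)"
    and o: "\<And>d. d \<in> D \<Longrightarrow> \<sigma> * orient p q d < 0" "\<And>d. d \<in> D \<Longrightarrow> \<sigma> * orient q r d < 0"
      "\<And>d. d \<in> D \<Longrightarrow> \<sigma> * orient p r d < 0"
  shows "\<sigma> * orient p q r > 0"
proof -
  have "q \<notin> convex hull (C - {q})" using C(2) p(2) unfolding convex_position_def by blast
  then obtain f \<beta> where f: "f \<bullet> q < \<beta>" "\<And>x. x \<in> convex hull (C - {q}) \<Longrightarrow> \<beta> < f \<bullet> x"
    using separating_hyperplane_closed_point[of "convex hull (C - {q})" q] C(1)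
    by (auto simp: finite_imp_compact_convex_hull compact_imp_closed)
  have fC: "f \<bullet> q < f \<bullet> x" if "x \<in> C" "x \<noteq> q" for x
    using f(2)[of x] f(1) that hull_inc[of x "C - {q}"] by fastforce
  have "f \<noteq> 0" using fC[OF p(1)] p(4) by auto
  then obtain d where d: "d \<in> S" "f \<bullet> d < f \<bullet> q"
    using support_frontier[of q S f] q p(2) S by (meson UnI1 not_le)
  have dD: "d \<in> D" using d fC S by (metis UnE less_asym less_irrefl)
  define wpq wqr wpr where "wpq = - (\<sigma> * orient p q d)" and "wqr = - (\<sigma> * orient q r d)"
    and "wpr = - (\<sigma> * orient p r d)"
  have w: "0 < wpq" "0 < wqr" "0 < wpr" using o[OF dD] by (simp_all add: wpq_def wqr_def wpr_def)
  \<comment> \<open>This linear relation between the vectors from \<open>d\<close> to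
    \<open>p\<close>, \<open>q\<close> and \<open>r\<close> turns a comparison of heights measured
    by \<open>f\<close> into one of triangle areas.\<close>
  have "orient p r d *\<^sub>R (q - d) = orient q r d *\<^sub>R (p - d) + orient p q d *\<^sub>R (r - d)"
    unfolding orient_def by (simp add: complex_eq_iff algebra_simps)
  then have "orient p r d * (f \<bullet> (q - d)) = orient q r d * (f \<bullet> (p - d)) + orient p q d * (f \<bullet> (r - d))"
    by (metis inner_add_right inner_scaleR_right)
  then have "\<sigma> * (orient p r d * (f \<bullet> (q - d))) = \<sigma> * (orient q r d * (f \<bullet> (p - d)) + orient p q d * (f \<bullet> (r - d)))"
    by simp
  then have eq: "wpr * (f \<bullet> (q - d)) = wqr * (f \<bullet> (p - d)) + wpq * (f \<bullet> (r - d))"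
    unfolding wpq_def wqr_def wpr_def by (simp add: algebra_simps)
  have k: "0 < f \<bullet> (q - d)" using d(2) by (simp add: inner_diff_right)
  have "f \<bullet> (q - d) < f \<bullet> (p - d)" "f \<bullet> (q - d) < f \<bullet> (r - d)"
    using fC[OF p(1)] fC[OF p(3)] p(4,5) by (auto simp: inner_diff_right)
  then have "wqr * (f \<bullet> (q - d)) + wpq * (f \<bullet> (q - d)) < wqr * (f \<bullet> (p - d)) + wpq * (f \<bullet> (r - d))"
    using w by (intro add_strict_mono mult_strict_left_mono) auto
  then have "(wqr + wpq) * (f \<bullet> (q - d)) < wpr * (f \<bullet> (q - d))" using eq by (simp add: distrib_right)
  then have "wqr + wpq < wpr" using k by simp
  moreover have "\<sigma> * orient p q r = wpr - wqr - wpq"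
    unfolding wpq_def wqr_def wpr_def orient_def by (simp add: algebra_simps)
  ultimately show ?thesis by simp
qed

text \<open>The numbering comes from \<open>chain_order\<close> with opposite signs for the two
  chains. The first and the last point turn out to be the two hull points of their chain, so all
  others are off the frontier, which is what \<open>chain_bends\<close> asks for.\<close>

lemma double_chain_facing:
  assumes "double_chain n S"
  obtains u l a b where "facing_chains u l (n div 2) a b"
    "S = u ` {..<n div 2} \<union> l ` {..<n div 2}"
proof -
  obtain U L where UL: "finite S" "S = U \<union> L" "U \<inter> L = {}" "2 * card U = n" "2 * card L = n"
    "chain_facing S U L" "chain_facing S L U"
    using assms unfolding double_chain_def by blast
  define M where "M = n div 2"
  have M: "card U = M" "card L = M" using UL by (auto simp: M_def)
  have fin: "finite U" "finite L" using UL by auto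
  have fr: "card (U \<inter> frontier (convex hull S)) = 2" "card (L \<inter> frontier (convex hull S)) = 2"
    and cp: "convex_position U" "convex_position L"
    using UL unfolding chain_facing_def by auto
  have fr0: "L \<inter> frontier (convex hull S) \<noteq> {}" "U \<inter> frontier (convex hull S) \<noteq> {}"
    using fr by (metis card.empty zero_neq_numeral)+
  obtain u where u: "bij_betw u {..<M} U"
    "\<And>i j d. i < j \<Longrightarrow> j < M \<Longrightarrow> d \<in> L \<Longrightarrow> 1 * orient (u i) (u j) d < 0"
    using chain_order[OF fin(1) fr0(1), of 1] UL unfolding M chain_facing_def by (metis order_refl one_neq_zero)
  obtain l where l: "bij_betw l {..<M} L"
    "\<And>i j d. i < j \<Longrightarrow> j < M \<Longrightarrow> d \<in> U \<Longrightarrow> (- 1) * orient (l i) (l j) d < 0"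
    using chain_order[OF fin(2) fr0(2), of "-1"] UL unfolding M chain_facing_def
    by (metis Un_commute order_refl one_neq_zero neg_equal_0_iff_equal)
  have mem: "u i \<in> U" "l i \<in> L" if "i < M" for i
    using u(1) l(1) that by (auto simp: bij_betw_def)
  have img: "U = u ` {..<M}" "L = l ` {..<M}" using u(1) l(1) by (auto simp: bij_betw_def)
  have UUL: "orient (u i) (u j) (l h) < 0" if "i < j" "j < M" "h < M" for i j h
    using u(2)[OF that(1,2)] mem that(3) by simp
  have LLU: "orient (l i) (l j) (u h) > 0" if "i < j" "j < M" "h < M" for i j h
    using l(2)[OF that(1,2)] mem that(3) by simp
  have "2 \<le> card U" using fr(1) fin card_mono[of U "U \<inter> frontier (convex hull S)"] by simp
  then have M2: "2 \<le> M" using M by simp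
  define m where "m = M - 1"
  have m: "m < M" "0 < m" using M2 by (auto simp: m_def)
  have lt_m: "i < m" if "i < M" "i \<noteq> m" for i using that by (auto simp: m_def)
  have ne: "l 0 \<noteq> u 0" "l m \<noteq> u m" using mem[of 0] mem[of m] UL(3) M2 m by auto
  have Simg: "S = u ` {..<M} \<union> l ` {..<M}" by (simp only: UL(2) img)
  \<comment> \<open>The line through the first points of both chains supports \<open>S\<close>, and
    so does the line through the last points; hence these four points are on the frontier.\<close>
  have s0: "- 1 * orient (l 0) (u 0) z \<ge> 0" if z: "z \<in> S" for z
  proof -
    have "z \<in> u ` {..<M} \<union> l ` {..<M}" using z Simg by simp
    then consider (1) i where "i < M" "z = u i" | (2) i where "i < M" "z = l i" by blast
    then show ?thesis
    proof cases
      case 1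
      have "orient (l 0) (u 0) (u i) = orient (u 0) (u i) (l 0)" by (rule orient_rotate)
      then show ?thesis using 1 UUL[of 0 i 0] by (cases "i = 0") auto
    next
      case 2
      have "orient (l 0) (u 0) (l i) = - orient (l 0) (l i) (u 0)" by (rule orient_swap)
      then show ?thesis using 2 LLU[of 0 i 0] by (cases "i = 0") auto
    qed
  qed
  have sm: "1 * orient (l m) (u m) z \<ge> 0" if z: "z \<in> S" for z
  proof -
    have "z \<in> u ` {..<M} \<union> l ` {..<M}" using z Simg by simp
    then consider (1) i where "i < M" "z = u i" | (2) i where "i < M" "z = l i" by blast
    then show ?thesis
    proof cases
      case 1
      have "orient (l m) (u m) (u i) = - orient (u i) (u m) (l m)" by (simp add: orient_def algebra_simps)
      then show ?thesis using 1 UUL[of i m m] m lt_m[of i] by (cases "i = m") auto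
    next
      case 2
      have "orient (l m) (u m) (l i) = orient (l i) (l m) (u m)" by (simp add: orient_def algebra_simps)
      then show ?thesis using 2 LLU[of i m m] m lt_m[of i] by (cases "i = m") auto
    qed
  qed
  have S: "u 0 \<in> S" "l 0 \<in> S" "u m \<in> S" "l m \<in> S" using mem[of 0] mem[of m] UL M2 m by auto
  have F: "u 0 \<in> frontier (convex hull S)" "l 0 \<in> frontier (convex hull S)"
    "u m \<in> frontier (convex hull S)" "l m \<in> frontier (convex hull S)"
    using support_frontier_orient[OF S(1) ne(1) _ s0] support_frontier_orient[OF S(2) ne(1) _ s0]
      support_frontier_orient[OF S(3) ne(2) _ sm] support_frontier_orient[OF S(4) ne(2) _ sm] by auto
  have inj: "u i = u j \<longleftrightarrow> i = j" "l i = l j \<longleftrightarrow> i = j" if "i < M" "j < M" for i j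
    using u(1) l(1) that by (auto simp: bij_betw_def inj_on_def)
  have "{u 0, u m} = U \<inter> frontier (convex hull S)"
    by (rule card_subset_eq) (use F mem[of 0] mem[of m] m M2 fin fr inj(1)[of 0 m] in auto)
  then have nfu: "u j \<notin> frontier (convex hull S)" if "0 < j" "j < m" for j
    using inj(1)[of j 0] inj(1)[of j m] mem(1)[of j] that m by auto
  have "{l 0, l m} = L \<inter> frontier (convex hull S)"
    by (rule card_subset_eq) (use F mem[of 0] mem[of m] m M2 fin fr inj(2)[of 0 m] in auto)
  then have nfl: "l j \<notin> frontier (convex hull S)" if "0 < j" "j < m" for j
    using inj(2)[of j 0] inj(2)[of j m] mem(2)[of j] that m by auto
  have UUU: "orient (u i) (u j) (u h) > 0" if "i < j" "j < h" "h < M" for i j h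
  proof -
    have jm: "0 < j" "j < m" using that by (auto simp: m_def)
    have "1 * orient (u i) (u j) (u h) > 0"
      by (rule chain_bends[OF fin(1) cp(1) UL(2)])
         (use that mem inj[of j i] inj[of j h] nfu[OF jm] u(2) in auto)
    then show ?thesis by simp
  qed
  have SLU: "S = L \<union> U" using UL by auto
  have LLL: "orient (l i) (l j) (l h) < 0" if "i < j" "j < h" "h < M" for i j h
  proof -
    have jm: "0 < j" "j < m" using that by (auto simp: m_def)
    have "(- 1) * orient (l i) (l j) (l h) > 0"
      by (rule chain_bends[OF fin(2) cp(2) SLU])
         (use that mem inj[of j i] inj[of j h] nfl[OF jm] l(2) in auto)
    then show ?thesis by simp
  qed
  \<comment> \<open>Seen from \<open>u 0\<close>, a common point \<open>z\<close> lies strictly to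
    the right of the directions to all other points of \<open>U\<close>. In the hull of
    \<open>U\<close> this leaves only \<open>u 0\<close> itself, which is not strictly to the right
    of any of them.\<close>
  have disj: "convex hull L \<inter> convex hull U = {}"
  proof (rule ccontr)
    assume "\<not> ?thesis"
    then obtain z where z: "z \<in> convex hull L" "z \<in> convex hull U" by blast
    define U' where "U' = u ` {1..<M}"
    have U': "U = insert (u 0) U'" "U' \<noteq> {}"
    proof -
      have "{..<M} = insert 0 {1..<M}" using M2 by auto
      then show "U = insert (u 0) U'" unfolding img U'_def by auto
      show "U' \<noteq> {}" using M2 by (auto simp: U'_def)
    qed
    have r: "orient (u 0) (u i) z < 0" if "0 < i" "i < M" for i
      by (rule hull_orient(2)[OF z(1)]) (use UUL[OF that] in \<open>auto simp: img\<close>)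
    have r': "orient (u 0) z x > 0" if "x \<in> convex hull U'" for x
    proof (rule hull_orient(1)[OF that])
      fix y assume "y \<in> U'"
      then obtain i where i: "1 \<le> i" "i < M" "y = u i" unfolding U'_def by auto
      have "orient (u 0) z (u i) = - orient (u 0) (u i) z" by (rule orient_swap)
      then show "orient (u 0) z y > 0" using r[of i] i by simp
    qed
    obtain s t y where y: "0 \<le> s" "0 \<le> t" "s + t = 1" "y \<in> convex hull U'" "z = s *\<^sub>R u 0 + t *\<^sub>R y"
      using z(2) unfolding U'(1) convex_hull_insert[OF U'(2)] by blast
    have zz: "z = (1 - t) *\<^sub>R u 0 + t *\<^sub>R y" using y by (simp add: eq_diff_eq[symmetric])
    have "0 = orient (u 0) z z" by simp
    also have "\<dots> = orient (u 0) z ((1 - t) *\<^sub>R u 0 + t *\<^sub>R y)" using zz by simp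
    also have "\<dots> = t * orient (u 0) z y" unfolding orient_affine by simp
    finally have "t = 0" using r'[OF y(4)] by simp
    then have "z = u 0" using zz by simp
    then show False using r[of 1] M2 by simp
  qed
  have neUL: "U \<noteq> {}" "L \<noteq> {}" using fr0 by auto
  obtain a b where ab: "\<forall>x\<in>convex hull L. a \<bullet> x < b" "\<forall>x\<in>convex hull U. b < a \<bullet> x"
    using separating_hyperplane_closed_compact[of "convex hull L" "convex hull U"] disj neUL fin
    by (auto simp: finite_imp_compact_convex_hull compact_imp_closed)
  have "facing_chains u l M a b"
  proof
    show "b < a \<bullet> u i" "a \<bullet> l i < b" if "i < M" for i
      using ab mem[OF that] hull_inc by metis+
  qed (use UUL LLU UUU LLL in auto)
  then show ?thesis using that img UL(2) unfolding M_def by blast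
qed

(* e ! k counts the unused points between the vertices k - 1 and k of the polygon on a chain, so
   that pos e i below is the index in the whole chain of vertex i. *)
definition slots :: "nat \<Rightarrow> nat set \<Rightarrow> nat \<Rightarrow> nat list set" where
  "slots n G a = {e. length e = n \<and> sum_list e = a \<and> (\<forall>i<n. i \<notin> G \<longrightarrow> e ! i = 0)}"

lemma finite_slots: "finite (slots n G a)"
proof (rule finite_subset)
  show "slots n G a \<subseteq> {e. set e \<subseteq> {..a} \<and> length e = n}"
    using member_le_sum_list by (fastforce simp: slots_def)
qed (simp add: finite_lists_length_eq)

lemma slots_Cons_0:
  "e \<in> slots n {i. Suc i \<in> G} a \<Longrightarrow> 0 # e \<in> slots (Suc n) G a"
  by (auto simp: slots_def nth_Cons split: nat.splits)

text \<open>Stars and bars, as a lower bound. Truncated subtraction does no harm: without admissible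
  slots the binomial coefficient is 1 for \<open>a = 0\<close> and 0 otherwise.\<close>

lemma card_slots: "(a + card (G \<inter> {..<n}) - 1) choose a \<le> card (slots n G a)"
proof (induction n arbitrary: G a)
  case 0
  show ?case
  proof (cases a)
    case 0
    have "slots 0 G 0 = {[]}" by (auto simp: slots_def)
    then show ?thesis using 0 by simp
  next
    case (Suc b) then show ?thesis by (simp add: binomial_eq_0)
  qed
next
  case (Suc n)
  let ?G = "{i. Suc i \<in> G}"
  let ?g = "card (?G \<inter> {..<n})"
  have sp: "G \<inter> {..<Suc n} = (G \<inter> {0}) \<union> Suc ` (?G \<inter> {..<n})"
    unfolding lessThan_Suc_eq_insert_0 by auto
  have cS: "card (Suc ` (?G \<inter> {..<n})) = ?g" by (simp add: card_image)
  show ?case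
  proof (cases "0 \<in> G")
    case False
    then have "G \<inter> {..<Suc n} = Suc ` (?G \<inter> {..<n})" using sp by auto
    then have "card (G \<inter> {..<Suc n}) = ?g" using cS by metis
    then have "(a + card (G \<inter> {..<Suc n}) - 1) choose a \<le> card (slots n ?G a)" using Suc by simp
    also have "\<dots> = card ((#) 0 ` slots n ?G a)" by (simp add: card_image)
    also have "\<dots> \<le> card (slots (Suc n) G a)"
      by (intro card_mono finite_slots) (auto intro: slots_Cons_0)
    finally show ?thesis .
  next
    case True
    then have "G \<inter> {..<Suc n} = insert 0 (Suc ` (?G \<inter> {..<n}))" using sp by auto
    then have g: "card (G \<inter> {..<Suc n}) = Suc ?g" using cS by (simp add: card_insert_if)
    have "(a + ?g) choose a \<le> card (slots (Suc n) G a)" for a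
    proof (induction a)
      case 0
      have "replicate (Suc n) 0 \<in> slots (Suc n) G 0"
        by (auto simp: slots_def sum_list_replicate simp del: replicate_Suc)
      then have "slots (Suc n) G 0 \<noteq> {}" by blast
      then have "0 < card (slots (Suc n) G 0)" using finite_slots by (simp add: card_gt_0_iff)
      then show ?case by simp
    next
      case (Suc a)
      let ?inc = "\<lambda>e. Suc (hd e) # tl e"
      let ?X = "(#) 0 ` slots n ?G (Suc a)" and ?Y = "?inc ` slots (Suc n) G a"
      have len: "e \<noteq> []" if "e \<in> slots (Suc n) G a" for e using that by (auto simp: slots_def)
      have Y: "card ?Y = card (slots (Suc n) G a)"
        by (intro card_image inj_onI) (metis len list.collapse list.inject nat.inject)
      have X: "card ?X = card (slots n ?G (Suc a))" by (simp add: card_image)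
      have sub: "?X \<union> ?Y \<subseteq> slots (Suc n) G (Suc a)"
      proof (intro Un_least image_subsetI)
        fix e assume "e \<in> slots n ?G (Suc a)" then show "0 # e \<in> slots (Suc n) G (Suc a)"
          by (rule slots_Cons_0)
      next
        fix e assume e: "e \<in> slots (Suc n) G a"
        then obtain x es where "e = x # es" using len by (cases e) auto
        then show "?inc e \<in> slots (Suc n) G (Suc a)"
          using e True by (auto simp: slots_def nth_Cons split: nat.splits)
      qed
      have "(Suc a + ?g) choose Suc a = ((a + ?g) choose a) + ((a + ?g) choose Suc a)" by simp
      also have "\<dots> \<le> card (slots (Suc n) G a) + card (slots n ?G (Suc a))"
        using Suc Suc.IH \<open>\<And>G a. (a + card (G \<inter> {..<n}) - 1) choose a \<le> card (slots n G a)\<close>[of "Suc a" ?G]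
        by (intro add_mono) simp_all
      also have "\<dots> = card (?X \<union> ?Y)"
        using X Y by (subst card_Un_disjoint) (auto intro: finite_slots)
      also have "\<dots> \<le> card (slots (Suc n) G (Suc a))" by (rule card_mono[OF finite_slots sub])
      finally show ?case .
    qed
    then show ?thesis using g by simp
  qed
qed

definition pos :: "nat list \<Rightarrow> nat \<Rightarrow> nat" where
  "pos e i = i + sum_list (take (Suc i) e)"

lemma pos_0: "e \<noteq> [] \<Longrightarrow> pos e 0 = e ! 0"
  by (cases e) (auto simp: pos_def)

lemma pos_Suc: "Suc i < length e \<Longrightarrow> pos e (Suc i) = pos e i + 1 + e ! Suc i"
  by (simp add: pos_def take_Suc_conv_app_nth)

lemma pos_mono:
  assumes "i < j"
  shows "pos e i < pos e j"
proof -
  have "take (Suc j) e = take (Suc i) e @ take (j - i) (drop (Suc i) e)"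
    using assms by (metis Suc_mono add_diff_inverse_nat diff_Suc_Suc not_less_iff_gr_or_eq take_add)
  then show ?thesis using assms by (simp add: pos_def)
qed

lemma pos_less_iff: "pos e i < pos e j \<longleftrightarrow> i < j"
  using pos_mono[of i j e] pos_mono[of j i e] by (cases i j rule: linorder_cases) auto

lemma pos_bound: "i < m \<Longrightarrow> sum_list e = a \<Longrightarrow> pos e i < m + a"
proof -
  assume "i < m" "sum_list e = a"
  moreover have "sum_list e = sum_list (take (Suc i) e) + sum_list (drop (Suc i) e)"
    by (metis append_take_drop_id sum_list_append)
  ultimately show ?thesis by (simp add: pos_def)
qed

lemma pos_gap:
  assumes e: "e \<in> slots (Suc m) G a" and m: "0 < m" and h: "h < m + a" "h \<notin> pos e ` {..<m}"
  obtains k where "k \<in> G" "k \<le> m" "\<And>x. x < m \<Longrightarrow> pos e x < h \<longleftrightarrow> x < k"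
proof -
  have len: "length e = Suc m" "sum_list e = a" and z: "\<And>i. i \<le> m \<Longrightarrow> i \<notin> G \<Longrightarrow> e ! i = 0"
    using e by (auto simp: slots_def)
  define k where "k = (LEAST k. k = m \<or> h < pos e k)"
  have kP: "k = m \<or> h < pos e k" unfolding k_def by (rule LeastI[of _ m]) simp
  have km: "k \<le> m" unfolding k_def by (rule Least_le) simp
  have lt: "pos e x < h" if "x < k" for x
  proof -
    have "\<not> (x = m \<or> h < pos e x)" using not_less_Least[of x "\<lambda>k. k = m \<or> h < pos e k"] that
      unfolding k_def by blast
    moreover have "x < m" using that km by simp
    then have "h \<noteq> pos e x" using h(2) by blast
    ultimately show ?thesis by simp
  qed
  have iff: "pos e x < h \<longleftrightarrow> x < k" if "x < m" for x
  proof
    assume "pos e x < h"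
    show "x < k"
    proof (rule ccontr)
      assume "\<not> x < k"
      then have "k \<noteq> m" "k \<le> x" using that by auto
      then have "h < pos e k" "pos e k \<le> pos e x" using kP pos_less_iff[of e x k] by auto
      then show False using \<open>pos e x < h\<close> by simp
    qed
  qed (rule lt)
  have "e ! k \<noteq> 0"
  proof (cases k)
    case 0
    then have "h < pos e 0" using kP m by auto
    moreover have "e \<noteq> []" using len by auto
    ultimately show ?thesis using 0 by (simp add: pos_0)
  next
    case (Suc j)
    have hj: "pos e j < h" using lt Suc by simp
    show ?thesis
    proof (cases "k = m")
      case False
      then have "h < pos e (Suc j)" using kP Suc by simp
      then show ?thesis using hj pos_Suc[of j e] len Suc km by simp
    next
      case True
      have "e = take m e @ [e ! m]" using len by (metis lessI take_Suc_conv_app_nth take_all order_refl)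
      then have "a = sum_list (take m e) + e ! m" using len(2) by (metis sum_list_append sum_list.Cons sum_list.Nil add_0_right)
      then show ?thesis using hj h(1) True Suc by (simp add: pos_def)
    qed
  qed
  then have "k \<in> G" using z[OF km] by auto
  from that[OF this km iff] show ?thesis .
qed

lemma pos_inject:
  assumes e: "e \<in> slots (Suc m) G a" "e' \<in> slots (Suc m) G' a" and eq: "pos e ` {..<m} = pos e' ` {..<m}"
  shows "e = e'"
proof -
  have len: "length e = Suc m" "sum_list e = a" "length e' = Suc m" "sum_list e' = a"
    using e by (auto simp: slots_def)
  have sd: "sorted (map (pos e) [0..<m])" "distinct (map (pos e) [0..<m])" for e
  proof -
    have "pos e i \<le> pos e j" if "i \<le> j" for i j
      using pos_mono[of i j e] that by (cases "i = j") auto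
    then show "sorted (map (pos e) [0..<m])" by (simp add: sorted_iff_nth_mono)
    have "inj (pos e)" by (rule injI) (metis linorder_neqE_nat pos_less_iff less_irrefl)
    then show "distinct (map (pos e) [0..<m])" by (auto simp: distinct_map intro: inj_on_subset)
  qed
  \<comment> \<open>Positions increase, so their set determines their list. Consecutive differences
    give the entries below \<open>m\<close>, and the total \<open>a\<close> gives the last
    entry.\<close>
  have "map (pos e) [0..<m] = map (pos e') [0..<m]"
    by (rule sorted_distinct_set_unique[OF sd(1,2) sd(1,2)]) (use eq in \<open>simp add: atLeast0LessThan\<close>)
  then have p: "pos e i = pos e' i" if "i < m" for i using that by (metis add_0 length_upt nth_map nth_upt diff_zero)
  have ni: "e ! i = e' ! i" if "i < m" for i
  proof (cases i)
    case 0
    have "e \<noteq> []" "e' \<noteq> []" using len by auto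
    then show ?thesis using p[of 0] 0 that by (simp add: pos_0)
  next
    case (Suc j)
    then show ?thesis using p[of i] p[of j] pos_Suc[of j e] pos_Suc[of j e'] that len by simp
  qed
  have "take m e = take m e'" by (rule nth_equalityI) (use ni len in auto)
  moreover have "e = take m e @ [e ! m]" "e' = take m e' @ [e' ! m]"
    using len by (metis lessI take_Suc_conv_app_nth take_all order_refl)+
  then have "a = sum_list (take m e) + e ! m" "a = sum_list (take m e') + e' ! m"
    using len by (metis sum_list_append sum_list.Cons sum_list.Nil add_0_right)+
  ultimately have "e ! m = e' ! m" by simp
  then show ?thesis using \<open>take m e = take m e'\<close> \<open>e = take m e @ [e ! m]\<close> \<open>e' = take m e' @ [e' ! m]\<close> by metis
qed

lemma binomial_Suc_ratio: "(p + 1) * ((a + p + 1) choose a) = (a + p + 1) * ((a + p) choose a)"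
  using binomial_absorb_comp[of "a + p + 1" a] by simp

text \<open>For fixed \<open>p + q\<close> the product on the right is smallest when it is most
  unbalanced: moving one unit from \<open>q\<close> to \<open>p\<close> does not increase it, and at
  \<open>q = 0\<close> equality holds because the second factor is \<open>a + 1\<close>.\<close>

lemma binomial_product_le:
  assumes "q \<le> p + 1"
  shows "((a + p + q + 1) choose a) * (a + 1) \<le> ((a + p + 1) choose a) * ((a + q + 1) choose a)"
  using assms
proof (induction q arbitrary: p)
  case 0
  then show ?case by simp
next
  case (Suc q)
  define X X' Y Y' where "X = (a + p + 1) choose a" and "X' = (a + p + 2) choose a"
    and "Y = (a + q + 1) choose a" and "Y' = (a + q + 2) choose a"
  have X: "(p + 2) * X' = (a + p + 2) * X" and Y: "(q + 2) * Y' = (a + q + 2) * Y"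
    using binomial_Suc_ratio[of "p + 1" a] binomial_Suc_ratio[of "q + 1" a]
    unfolding X_def X'_def Y_def Y'_def by simp_all
  have "((p + 2) * (q + 2)) * (X' * Y) = ((p + 2) * X') * ((q + 2) * Y)" by (simp add: algebra_simps)
  also have "\<dots> = ((a + p + 2) * (q + 2)) * (X * Y)" unfolding X by (simp add: algebra_simps)
  also have "\<dots> \<le> ((a + q + 2) * (p + 2)) * (X * Y)"
  proof (rule mult_right_mono)
    have "a * q \<le> a * p" using Suc.prems by simp
    then show "(a + p + 2) * (q + 2) \<le> (a + q + 2) * (p + 2)" by (simp add: algebra_simps)
  qed simp
  also have "\<dots> = ((p + 2) * X) * ((a + q + 2) * Y)" by (simp add: algebra_simps)
  also have "\<dots> = ((p + 2) * (q + 2)) * (X * Y')" unfolding Y[symmetric] by (simp add: algebra_simps)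
  finally have "((p + 2) * (q + 2)) * (X' * Y) \<le> ((p + 2) * (q + 2)) * (X * Y')" .
  moreover have "0 < (p + 2) * (q + 2)" by simp
  ultimately have XY: "X' * Y \<le> X * Y'" by (simp only: nat_mult_le_cancel1)
  have "((a + p + Suc q + 1) choose a) * (a + 1) = ((a + (p + 1) + q + 1) choose a) * (a + 1)" by simp
  also have "\<dots> \<le> ((a + (p + 1) + 1) choose a) * ((a + q + 1) choose a)"
    by (rule Suc.IH) (use Suc.prems in simp)
  also have "\<dots> = X' * Y" by (simp add: X'_def Y_def)
  also note XY
  also have "X * Y' = ((a + p + 1) choose a) * ((a + Suc q + 1) choose a)" by (simp add: X_def Y'_def)
  finally show ?case .
qed

text \<open>Used with \<open>p = N - d\<close> and \<open>q = d\<close>, it removes the dependence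
  on the number \<open>d\<close> of inner gaps.\<close>

lemma binomial_product_lower:
  "((a + (p + q)) choose a) * (a + 1) \<le> ((a + p + 1) choose a) * ((a + q + 1) choose a)"
proof -
  have "((a + (p + q)) choose a) \<le> ((a + p + q + 1) choose a)" by (rule binomial_right_mono) simp
  then have 1: "((a + (p + q)) choose a) * (a + 1) \<le> ((a + p + q + 1) choose a) * (a + 1)"
    by (rule mult_right_mono) simp
  show ?thesis
  proof (cases "q \<le> p + 1")
    case True then show ?thesis using 1 binomial_product_le[OF True, of a] by linarith
  next
    case False
    then have "p \<le> q + 1" by simp
    from binomial_product_le[OF this, of a] have
      "((a + p + q + 1) choose a) * (a + 1) \<le> ((a + p + 1) choose a) * ((a + q + 1) choose a)"
      by (simp add: ac_simps)
    then show ?thesis using 1 by linarith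
  qed
qed

section \<open>Classes of systems and their joining edges\<close>

lemma left_path_Suc: "left_path (Suc l) A = map Suc (left_path l A)"
proof (induction A arbitrary: l rule: spiral.induct[of "\<lambda>_. True"])
  case (Outer F A) then show ?case using Outer(2)[of "Suc (l + ssize F)"] by simp
qed auto

lemma right_path_Suc: "right_path (Suc l) A = map Suc (right_path l A)"
proof (induction A arbitrary: l rule: spiral.induct[of "\<lambda>_. True"])
  case (Inner A) then show ?case using Inner[of "Suc l"] by simp
next
  case (Outer F A) then show ?case using Outer(2)[of l] by simp
qed auto

lemma paths_Suc:
  "paths (Suc l) t = map (map Suc) (paths l t)"
  "left_nested (Suc l) A = map (map Suc) (left_nested l A)"
  "right_nested (Suc l) B = map (map Suc) (right_nested l B)"
  by (induction l t and l A and l B rule: paths_left_nested_right_nested.induct) (simp_all add: left_path_Suc right_path_Suc rev_map)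

lemma inner_gaps_Suc: "[] \<notin> set ps \<Longrightarrow> inner_gaps (map (map Suc) ps) = Suc ` inner_gaps ps"
  by (induction ps) (auto simp: hd_map last_map image_Un image_Suc_atLeastLessThan)

lemma ends_in_nonempty: "ends_in l h ps \<Longrightarrow> [] \<notin> set ps"
  by (induction l h ps rule: ends_in.induct) auto

lemma ends_in_length: "ends_in l h ps \<Longrightarrow> length ps + l \<le> h"
  by (induction l h ps rule: ends_in.induct) auto

definition sys_class :: "nat \<Rightarrow> nat \<Rightarrow> nat \<Rightarrow> sys set" where
  "sys_class N r d = {t. ssize t = N \<and> length (paths 0 t) = r \<and> card (inner_gaps (paths 0 t)) = d}"

lemma inner_gaps_paths: "inner_gaps (paths l t) \<subseteq> {l..<l + ssize t}"
  by (rule inner_gaps_bounds[OF ends_in_paths(1)])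

lemma finite_inner_gaps: "finite (inner_gaps ps)"
  by (simp add: inner_gaps_def)

text \<open>Pigeonhole principle: both parameters lie in \<open>{..N}\<close>. Equal
  \<open>r\<close> lets any two systems of the class be joined to a cycle, and equal
  \<open>d\<close> balances their usable gaps.\<close>

lemma large_class:
  obtains r d where "d \<le> N" "num_sys N \<le> (N + 1)\<^sup>2 * card (sys_class N r d)"
proof -
  let ?I = "{..N} \<times> {..N}"
  have b: "length (paths 0 t) \<le> N" "card (inner_gaps (paths 0 t)) \<le> N" if "ssize t = N" for t
  proof -
    show "length (paths 0 t) \<le> N" using ends_in_length[OF ends_in_paths(1)[of 0 t]] that by simp
    have "card (inner_gaps (paths 0 t)) \<le> card {0..<0 + ssize t}" by (rule card_mono[OF _ inner_gaps_paths]) simp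
    then show "card (inner_gaps (paths 0 t)) \<le> N" using that by simp
  qed
  have "num_sys N = card (\<Union>(r, d)\<in>?I. sys_class N r d)"
    unfolding num_sys_def by (rule arg_cong[where f = card]) (use b in \<open>auto simp: sys_class_def\<close>)
  also have "\<dots> \<le> (\<Sum>(r, d)\<in>?I. card (sys_class N r d))"
    using card_UN_le[of ?I "\<lambda>(r, d). sys_class N r d"] by (simp add: case_prod_unfold)
  finally have le: "num_sys N \<le> (\<Sum>x\<in>?I. card (sys_class N (fst x) (snd x)))" by (simp add: case_prod_unfold)
  have "\<exists>x\<in>?I. num_sys N \<le> (N + 1)\<^sup>2 * card (sys_class N (fst x) (snd x))"
  proof (rule ccontr)
    assume "\<not> ?thesis"
    then have lt: "(N + 1)\<^sup>2 * card (sys_class N (fst x) (snd x)) < num_sys N" if "x \<in> ?I" for x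
      using that by force
    have "(N + 1)\<^sup>2 * (\<Sum>x\<in>?I. card (sys_class N (fst x) (snd x))) < (\<Sum>x\<in>?I. num_sys N)"
      unfolding sum_distrib_left by (rule sum_strict_mono) (use lt in auto)
    also have "\<dots> = (N + 1)\<^sup>2 * num_sys N" by (simp add: card_cartesian_product power2_eq_square)
    finally show False using le by simp
  qed
  then show ?thesis using that by auto
qed

text \<open>Two more vertices per chain make the shift by one work. Above, an extra path at the
  right end gives the upper chain one path more. Below, an arc from the first to the last vertex
  spans the system, which moves one place to the right, and closes the cycle.\<close>

definition upper_paths :: "sys \<Rightarrow> nat list list" where
  "upper_paths t = paths 0 t @ [[ssize t, ssize t + 1]]"

definition upper_arcs :: "sys \<Rightarrow> (nat \<times> nat) set" where
  "upper_arcs t = insert (ssize t, ssize t + 1) (sarcs 0 t)"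

definition lower_arcs :: "sys \<Rightarrow> (nat \<times> nat) set" where
  "lower_arcs s = insert (0, ssize s + 1) (sarcs 1 s)"

definition bridges :: "sys \<Rightarrow> sys \<Rightarrow> (nat \<times> nat) list" where
  "bridges t s = zip (ends (upper_paths t)) (0 # ends (paths 1 s) @ [ssize s + 1])"

text \<open>Slot \<open>k\<close> is gap \<open>k - 1\<close>, whence \<open>Suc\<close>; the slots
  0 and \<open>ssize t + 2\<close> lie before the first and after the last vertex. The gap between
  the two extra vertices is inner and therefore absent.\<close>

definition upper_slots :: "sys \<Rightarrow> nat set" where
  "upper_slots t = {0, ssize t + 2} \<union> Suc ` ({..<ssize t} - inner_gaps (paths 0 t))"

text \<open>The joining edge at the extra vertex 0 precedes every gap of the lower system and flips
  the parity, so here the inner gaps are the usable ones.\<close>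

definition lower_slots :: "sys \<Rightarrow> nat set" where
  "lower_slots s = {0, ssize s + 2} \<union> Suc ` inner_gaps (paths 1 s)"

lemma upper_paths_ends_in: "ends_in 0 (ssize t + 2) (upper_paths t)"
  unfolding upper_paths_def by (rule ends_in_append[OF ends_in_paths(1)]) simp

lemma upper_paths_arcs: "\<Union> (parcs ` set (upper_paths t)) = upper_arcs t"
  using parcs_paths(1)[of 0 t] by (auto simp: upper_paths_def upper_arcs_def)

lemma upper_arcs_bounds: "upper_arcs t \<subseteq> arcs 0 (ssize t + 2)"
  using edges_arcs(1)[of 0 t] by (auto simp: upper_arcs_def arcs_def)

lemma lower_arcs_bounds: "lower_arcs s \<subseteq> arcs 0 (ssize s + 2)"
  using edges_arcs(1)[of 1 s] by (auto simp: lower_arcs_def arcs_def)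

lemma noncrossing_upper_arcs: "noncrossing (upper_arcs t)"
proof -
  have "noncrossing (sarcs 0 t \<union> {(ssize t, ssize t + 1)})"
    by (rule noncrossing_Un[where l = 0 and c = "ssize t" and h = "ssize t + 2"])
       (use edges_arcs(1)[of 0 t] noncrossing_edges(1) in \<open>auto simp: noncrossing_def arcs_def\<close>)
  then show ?thesis by (simp add: upper_arcs_def)
qed

lemma noncrossing_lower_arcs: "noncrossing (lower_arcs s)"
  unfolding lower_arcs_def
  by (rule noncrossing_insert[OF noncrossing_edges(1)]) (auto dest!: sarcs_bounds)

lemma upper_arcs_inject: "upper_arcs t = upper_arcs t' \<Longrightarrow> ssize t = ssize t' \<Longrightarrow> t = t'"
proof -
  assume a: "upper_arcs t = upper_arcs t'" "ssize t = ssize t'"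
  have "(ssize t, ssize t + 1) \<notin> sarcs 0 t" "(ssize t', ssize t' + 1) \<notin> sarcs 0 t'"
    using sarcs_bounds by fastforce+
  then have "sarcs 0 t = sarcs 0 t'" using a unfolding upper_arcs_def by (metis insert_ident)
  then show ?thesis using edges_inject(1) a(2) by blast
qed

lemma lower_arcs_inject: "lower_arcs s = lower_arcs s' \<Longrightarrow> ssize s = ssize s' \<Longrightarrow> s = s'"
proof -
  assume a: "lower_arcs s = lower_arcs s'" "ssize s = ssize s'"
  have "(0, ssize s + 1) \<notin> sarcs 1 s" "(0, ssize s' + 1) \<notin> sarcs 1 s'"
    using sarcs_bounds by fastforce+
  then have "sarcs 1 s = sarcs 1 s'" using a unfolding lower_arcs_def by (metis insert_ident)
  then show ?thesis using edges_inject(1) a(2) by blast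
qed

lemma sorted_wrt_before_distinct: "sorted_wrt before xs \<Longrightarrow> distinct xs"
  by (induction xs) (auto simp: before_def)

lemma sorted_wrt_before_total:
  "sorted_wrt before xs \<Longrightarrow> p \<in> set xs \<Longrightarrow> q \<in> set xs \<Longrightarrow> p \<noteq> q \<Longrightarrow> before p q \<or> before q p"
  by (induction xs) auto

lemma paths_1: "paths 1 s = map (map Suc) (paths 0 s)"
  using paths_Suc(1)[of 0 s] by simp

lemma card_upper_slots:
  assumes "card (inner_gaps (paths 0 t)) = d" 
  shows "card (upper_slots t \<inter> {..<ssize t + 3}) = ssize t - d + 2"
proof -
  have I: "inner_gaps (paths 0 t) \<subseteq> {..<ssize t}" using inner_gaps_paths[of 0 t] by auto
  have "upper_slots t \<inter> {..<ssize t + 3} = {0, ssize t + 2} \<union> Suc ` ({..<ssize t} - inner_gaps (paths 0 t))"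
    by (auto simp: upper_slots_def)
  moreover have "card (Suc ` ({..<ssize t} - inner_gaps (paths 0 t))) = ssize t - d"
    using I assms finite_inner_gaps by (simp add: card_image card_Diff_subset)
  moreover have "{0, ssize t + 2} \<inter> Suc ` ({..<ssize t} - inner_gaps (paths 0 t)) = {}" by auto
  ultimately show ?thesis by (simp add: card_Un_disjoint)
qed

lemma card_lower_slots:
  assumes "card (inner_gaps (paths 0 s)) = d"
  shows "card (lower_slots s \<inter> {..<ssize s + 3}) = d + 2"
proof -
  have I: "inner_gaps (paths 1 s) \<subseteq> {1..<1 + ssize s}" by (rule inner_gaps_paths)
  have "lower_slots s \<inter> {..<ssize s + 3} = {0, ssize s + 2} \<union> Suc ` inner_gaps (paths 1 s)"
    using I by (auto simp: lower_slots_def)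
  moreover have "card (Suc ` inner_gaps (paths 1 s)) = d"
    using assms inner_gaps_Suc[OF ends_in_nonempty[OF ends_in_paths(1)[of 0 s]]] unfolding paths_1 by (simp add: card_image)
  moreover have "{0, ssize s + 2} \<inter> Suc ` inner_gaps (paths 1 s) = {}" using I by auto
  ultimately show ?thesis using finite_inner_gaps by (simp add: card_Un_disjoint)
qed

text \<open>With equally many paths in \<open>t\<close> and \<open>s\<close>, the extra upper path
  provides the surplus of one that \<open>weave\<close> expects.\<close>

locale sys_pair =
  fixes t s :: sys and N :: nat
  assumes N: "ssize t = N" "ssize s = N" and len: "length (paths 0 t) = length (paths 1 s)"
begin

lemma len': "length (upper_paths t) = Suc (length (paths 1 s))"
  using len by (simp add: upper_paths_def)

lemma sorted_bridges: "sorted_wrt before (bridges t s)"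
  unfolding bridges_def
  by (rule sorted_bichromatic[OF len' upper_paths_ends_in]) (use ends_in_paths(1)[of 1 s] in simp)

lemma map_fst_bridges: "map fst (bridges t s) = ends (upper_paths t)"
  and map_snd_bridges: "map snd (bridges t s) = 0 # ends (paths 1 s) @ [N + 1]"
  unfolding bridges_def using len' N by (simp_all add: length_ends)

lemma bridges_bounds: "set (bridges t s) \<subseteq> {..<N + 2} \<times> {..<N + 2}"
proof
  fix p assume p: "p \<in> set (bridges t s)"
  have "fst p \<in> set (ends (upper_paths t))" using p by (metis map_fst_bridges image_eqI list.set_map)
  moreover have "snd p \<in> set (0 # ends (paths 1 s) @ [N + 1])" using p by (metis map_snd_bridges image_eqI list.set_map)
  ultimately show "p \<in> {..<N + 2} \<times> {..<N + 2}"
    using ends_bounds[OF upper_paths_ends_in[of t]] ends_bounds[OF ends_in_paths(1)[of 1 s]] N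
    by (cases p) auto
qed

lemma card_bridges_fst:
  "card {p \<in> set (bridges t s). fst p < k} = length (filter (\<lambda>x. x < k) (ends (upper_paths t)))"
proof -
  have "card {p \<in> set (bridges t s). fst p < k} = card (set (filter (\<lambda>p. fst p < k) (bridges t s)))" by simp
  also have "\<dots> = length (filter (\<lambda>p. fst p < k) (bridges t s))"
    by (rule distinct_card) (simp add: sorted_wrt_before_distinct[OF sorted_bridges])
  also have "\<dots> = length (filter (\<lambda>x. x < k) (map fst (bridges t s)))"
    by (simp add: filter_map o_def)
  finally show ?thesis by (simp only: map_fst_bridges)
qed

lemma card_bridges_snd:
  "card {p \<in> set (bridges t s). snd p < k} = length (filter (\<lambda>x. x < k) (0 # ends (paths 1 s) @ [N + 1]))"
proof -
  have "card {p \<in> set (bridges t s). snd p < k} = card (set (filter (\<lambda>p. snd p < k) (bridges t s)))" by simp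
  also have "\<dots> = length (filter (\<lambda>p. snd p < k) (bridges t s))"
    by (rule distinct_card) (simp add: sorted_wrt_before_distinct[OF sorted_bridges])
  also have "\<dots> = length (filter (\<lambda>x. x < k) (map snd (bridges t s)))"
    by (simp add: filter_map o_def)
  finally show ?thesis by (simp only: map_snd_bridges)
qed

lemma even_upper:
  assumes "k \<in> upper_slots t"
  shows "even (card {p \<in> set (bridges t s). fst p < k})"
proof -
  consider "k = 0" | "k = N + 2" | i where "k = Suc i" "i < N" "i \<notin> inner_gaps (paths 0 t)"
    using assms N by (auto simp: upper_slots_def)
  then show ?thesis
  proof cases
    case 1 then show ?thesis by simp
  next
    case 2
    have "filter (\<lambda>x. x < k) (ends (upper_paths t)) = ends (upper_paths t)"
      using ends_bounds[OF upper_paths_ends_in[of t]] 2 N by (intro filter_True) auto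
    then show ?thesis unfolding card_bridges_fst by (simp add: length_ends)
  next
    case 3
    have "i \<notin> inner_gaps (upper_paths t)" using 3 N by (simp add: upper_paths_def)
    then have "even (length (filter (\<lambda>x. x \<le> i) (ends (upper_paths t))))"
      by (rule even_ends[OF upper_paths_ends_in])
    then show ?thesis unfolding card_bridges_fst 3(1) by (simp only: less_Suc_eq_le)
  qed
qed

lemma even_lower:
  assumes "k \<in> lower_slots s"
  shows "even (card {p \<in> set (bridges t s). snd p < k})"
proof -
  have I: "inner_gaps (paths 1 s) \<subseteq> {1..<1 + N}" using inner_gaps_paths[of 1 s] N by simp
  consider "k = 0" | "k = N + 2" | i where "k = Suc i" "i \<in> inner_gaps (paths 1 s)"
    using assms N by (auto simp: lower_slots_def)
  then show ?thesis
  proof cases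
    case 1 then show ?thesis by simp
  next
    case 2
    have "filter (\<lambda>x. x < k) (ends (paths 1 s)) = ends (paths 1 s)"
      using ends_bounds[OF ends_in_paths(1)[of 1 s]] 2 N by (intro filter_True) auto
    then show ?thesis unfolding card_bridges_snd using 2 by (simp add: length_ends)
  next
    case 3
    have "odd (length (filter (\<lambda>x. x \<le> i) (ends (paths 1 s))))"
      by (rule odd_ends[OF ends_in_paths(1) 3(2)])
    moreover have "\<not> N + 1 \<le> i" using 3 I by auto
    ultimately show ?thesis unfolding card_bridges_snd 3(1) by (simp add: less_Suc_eq_le)
  qed
qed

end

section \<open>Holes from pairs of systems\<close>

lemma arcs_map_prod:
  assumes "E \<subseteq> arcs 0 m" "\<And>i j. f i < f j \<longleftrightarrow> i < j" "\<And>i. i < m \<Longrightarrow> f i < M"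
  shows "map_prod f f ` E \<subseteq> arcs 0 M"
  by (auto simp: assms(2) in_arcs dest!: arcs_bounds[OF assms(1)] intro: assms(3))

lemma noncrossing_map_prod:
  assumes "noncrossing E" "\<And>i j. f i < f j \<longleftrightarrow> i < j"
  shows "noncrossing (map_prod f f ` E)"
  unfolding noncrossing_def[of "map_prod f f ` E"]
  using noncrossingD[OF assms(1)] by (auto simp: assms(2))

lemma pair_edges_inject:
  fixes c :: "nat \<Rightarrow> complex"
  assumes "E \<subseteq> arcs 0 M" "E' \<subseteq> arcs 0 M" "inj_on c {..<M}"
    and sub: "(\<lambda>(i, j). {c i, c j}) ` E \<subseteq> (\<lambda>(i, j). {c i, c j}) ` E'"
  shows "E \<subseteq> E'"
proof
  fix p assume p: "p \<in> E"
  have "(\<lambda>(i, j). {c i, c j}) p \<in> (\<lambda>(i, j). {c i, c j}) ` E'"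
    using sub p by (rule subsetD[OF _ imageI])
  then obtain q where q: "(\<lambda>(i, j). {c i, c j}) p = (\<lambda>(i, j). {c i, c j}) q" "q \<in> E'" by (rule imageE)
  obtain i j g h where ij: "p = (i, j)" "q = (g, h)" by (cases p, cases q)
  have b: "i < j" "j < M" "g < h" "h < M"
    using arcs_bounds[OF assms(1)] arcs_bounds[OF assms(2)] p q(2) unfolding ij by blast+
  have "c x = c y \<longleftrightarrow> x = y" if "x < M" "y < M" for x y
    using inj_on_eq_iff[OF assms(3)] that by simp
  then have "i = g \<and> j = h" using q(1) b unfolding ij by (auto simp: doubleton_eq_iff)
  then show "p \<in> E'" using q(2) ij by simp
qed

context facing_chains
begin

definition hole_edges :: "sys \<times> sys \<times> nat list \<times> nat list \<Rightarrow> complex set set" where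
  "hole_edges = (\<lambda>(t, s, e, f). chain_edges
     (map_prod (pos e) (pos e) ` upper_arcs t) (map_prod (pos f) (pos f) ` lower_arcs s)
     (map_prod (pos e) (pos f) ` set (bridges t s)))"

lemma hole:
  assumes ts: "sys_pair t s N" and M: "M = N + 2 + a'"
    and e: "e \<in> slots (N + 3) (upper_slots t) a'" and f: "f \<in> slots (N + 3) (lower_slots s) a'"
  defines "P' \<equiv> hole_edges (t, s, e, f)"
  shows "\<Union> P' = u ` pos e ` {..<N + 2} \<union> l ` pos f ` {..<N + 2}"
    and "k_hole (u ` {..<M} \<union> l ` {..<M}) (2 * (N + 2)) P'"
proof -
  interpret sys_pair t s N by (rule ts)
  let ?EU = "map_prod (pos e) (pos e) ` upper_arcs t" and ?EL = "map_prod (pos f) (pos f) ` lower_arcs s"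
    and ?B = "map_prod (pos e) (pos f) ` set (bridges t s)"
  have P': "P' = chain_edges ?EU ?EL ?B" by (simp add: P'_def hole_edges_def)
  have sum: "sum_list e = a'" "sum_list f = a'" using e f by (auto simp: slots_def)
  have eM: "pos e i < M" if "i < N + 2" for i using pos_bound[OF that sum(1)] M by simp
  have fM: "pos f i < M" if "i < N + 2" for i using pos_bound[OF that sum(2)] M by simp
  interpret chain_polygon u l M a b ?EU ?EL ?B
  proof
    show "?EU \<subseteq> arcs 0 M"
      by (rule arcs_map_prod[of _ "N + 2"]) (use upper_arcs_bounds[of t] N eM pos_less_iff in auto)
    show "?EL \<subseteq> arcs 0 M"
      by (rule arcs_map_prod[of _ "N + 2"]) (use lower_arcs_bounds[of s] N fM pos_less_iff in auto)
    show "noncrossing ?EU" by (rule noncrossing_map_prod[OF noncrossing_upper_arcs pos_less_iff])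
    show "noncrossing ?EL" by (rule noncrossing_map_prod[OF noncrossing_lower_arcs pos_less_iff])
    show "?B \<subseteq> {..<M} \<times> {..<M}" using bridges_bounds eM fM by auto
    fix p q assume pq: "p \<in> ?B" "q \<in> ?B" "p \<noteq> q"
    from pq(1) obtain p' where p': "p = map_prod (pos e) (pos f) p'" "p' \<in> set (bridges t s)"
      by (rule imageE)
    from pq(2) obtain q' where q': "q = map_prod (pos e) (pos f) q'" "q' \<in> set (bridges t s)"
      by (rule imageE)
    have le: "pos e i \<le> pos e j \<longleftrightarrow> i \<le> j" "pos f i \<le> pos f j \<longleftrightarrow> i \<le> j" for i j
      using pos_less_iff[of e j i] pos_less_iff[of f j i] by (metis not_le)+
    have "p' \<noteq> q'" using pq p' q' by auto
    then have "before p' q' \<or> before q' p'" by (rule sorted_wrt_before_total[OF sorted_bridges p'(2) q'(2)])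
    then show "before p q \<or> before q p"
      using pq(3) unfolding p'(1) q'(1) before_def by (auto simp: le)
  qed
  have posi: "pos e i = pos e j \<longleftrightarrow> i = j" "pos f i = pos f j \<longleftrightarrow> i = j" for i j
    by (metis linorder_neqE_nat pos_less_iff less_irrefl)+
  let ?f = "\<lambda>i. u (pos e i)" and ?g = "\<lambda>i. l (pos f i)"
  have inj_f: "inj_on ?f {..<N + 2}" by (rule inj_onI) (use eM u_inj posi in auto)
  have inj_g: "inj_on ?g {..<N + 2}" by (rule inj_onI) (use fM l_inj posi in auto)
  have fg: "?f ` {..<N + 2} \<inter> ?g ` {..<N + 2} = {}" using eM fM u_neq_l by auto
  have cU: "set (concat (upper_paths t)) = {..<N + 2}" "distinct (concat (upper_paths t))"
    using set_paths[of 0 t] distinct_paths[of 0 t] N unfolding upper_paths_def by auto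
  have cL: "set (concat (paths 1 s)) = {1..<N + 1}" using set_paths[of 1 s] N by simp
  define W where "W = weave ?f ?g (upper_paths t) (paths 1 s)"
  \<comment> \<open>The listing starts at the left end of the spanning lower arc and stops at its
    right end, so that the edge from the last to the first vertex is this arc.\<close>
  define vs where "vs = ?g 0 # W @ [?g (N + 1)]"
  have sW: "set W = ?f ` {..<N + 2} \<union> ?g ` {1..<N + 1}"
    unfolding W_def set_weave[OF len'] cU cL ..
  have svs: "set vs = ?f ` {..<N + 2} \<union> ?g ` {..<N + 2}"
  proof -
    have "{..<N + 2} = {0} \<union> {1..<N + 1} \<union> {N + 1}" by auto
    then have "?g ` {..<N + 2} = {?g 0} \<union> ?g ` {1..<N + 1} \<union> {?g (N + 1)}" by (metis (no_types) image_Un image_empty image_insert)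
    then show ?thesis unfolding vs_def using sW by auto
  qed
  have dW: "distinct W"
    unfolding W_def
  proof (rule distinct_weave[OF len' cU(2) distinct_paths])
    show "inj_on ?f (set (concat (upper_paths t)))" unfolding cU(1) by (rule inj_f)
    show "inj_on ?g (set (concat (paths 1 s)))" unfolding cL by (rule inj_on_subset[OF inj_g]) auto
    have "?g ` {1..<N + 1} \<subseteq> ?g ` {..<N + 2}" by (rule image_mono) auto
    then show "?f ` set (concat (upper_paths t)) \<inter> ?g ` set (concat (paths 1 s)) = {}"
      unfolding cU(1) cL using fg by blast
  qed
  have g0: "?g 0 \<notin> ?g ` {1..<N + 1}" "?g (N + 1) \<notin> ?g ` {1..<N + 1}" "?g 0 \<noteq> ?g (N + 1)"
  proof -
    have gi: "?g i = ?g j \<longleftrightarrow> i = j" if "i < N + 2" "j < N + 2" for i j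
      using inj_on_eq_iff[OF inj_g] that by simp
    show "?g 0 \<notin> ?g ` {1..<N + 1}" "?g (N + 1) \<notin> ?g ` {1..<N + 1}" "?g 0 \<noteq> ?g (N + 1)"
      by (auto simp: gi)
  qed
  have dvs: "distinct vs"
    unfolding vs_def using dW sW g0 fg by auto
  have lvs: "length vs = 2 * (N + 2)"
  proof -
    have "length vs = card (set vs)" using dvs by (simp add: distinct_card)
    also have "\<dots> = card (?f ` {..<N + 2}) + card (?g ` {..<N + 2})"
      unfolding svs by (rule card_Un_disjoint[OF _ _ fg]) auto
    also have "\<dots> = (N + 2) + (N + 2)" using card_image[OF inj_f] card_image[OF inj_g] by simp
    finally show ?thesis by simp
  qed
  have "path_edges vs = (\<lambda>(i, j). {?f i, ?f j}) ` upper_arcs t \<union> (\<lambda>(i, j). {?g i, ?g j}) ` sarcs 1 s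
     \<union> (\<lambda>(x, y). {?f x, ?g y}) ` set (bridges t s)"
    unfolding vs_def W_def
    by (subst weave_path_edges[OF len' ends_in_nonempty[OF upper_paths_ends_in] ends_in_nonempty[OF ends_in_paths(1)]])
       (simp only: upper_paths_arcs parcs_paths(1) bridges_def N)
  then have "cyclic_edges vs = (\<lambda>(i, j). {?f i, ?f j}) ` upper_arcs t \<union> (\<lambda>(i, j). {?g i, ?g j}) ` lower_arcs s
     \<union> (\<lambda>(x, y). {?f x, ?g y}) ` set (bridges t s)"
    using cyclic_edges_path_edges[of vs] unfolding lower_arcs_def N vs_def by (auto simp: insert_commute)
  also have "\<dots> = P'"
    unfolding P' chain_edges_def by (simp add: image_image case_prod_unfold)
  finally have cyc: "P' = cyclic_edges vs" by simp
  have simple: "simple_polygon P'"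
    unfolding simple_polygon_def
  proof (intro conjI)
    show "\<exists>vs. distinct vs \<and> 3 \<le> length vs \<and> P' = cyclic_edges vs"
      using dvs lvs cyc by (intro exI[of _ vs]) simp
    show "\<forall>e\<in>P'. \<forall>f\<in>P'. e \<noteq> f \<longrightarrow> convex hull e \<inter> convex hull f = e \<inter> f"
      using P_meet unfolding P' hulls_meet_def by blast
  qed
  have "\<Union> P' = set vs"
  proof -
    have ne: "vs \<noteq> []" using lvs by auto
    have "{last vs, hd vs} \<subseteq> set vs" using ne by simp
    then show ?thesis
      unfolding cyc cyclic_edges_path_edges[OF ne] using Union_path_edges[of vs] lvs by auto
  qed
  then show V: "\<Union> P' = u ` pos e ` {..<N + 2} \<union> l ` pos f ` {..<N + 2}"
    using svs by (simp add: image_image)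
  have "card (\<Union> P') = 2 * (N + 2)"
    using \<open>\<Union> P' = set vs\<close> distinct_card[OF dvs] lvs by simp
  moreover have "\<Union> P' \<subseteq> u ` {..<M} \<union> l ` {..<M}" unfolding V using eM fM by auto
  ultimately have gon: "k_gon (u ` {..<M} \<union> l ` {..<M}) (2 * (N + 2)) P'"
    using simple unfolding k_gon_def by simp
  have bdV: "v \<in> polygon_boundary P'" if "v \<in> \<Union> P'" for v
    using that unfolding polygon_boundary_def by (auto intro: hull_inc)
  have out_u: "u h \<notin> inside (polygon_boundary P')" if h: "h < M" for h
  proof (cases "h \<in> pos e ` {..<N + 2}")
    case True
    then have "u h \<in> polygon_boundary P'" by (intro bdV) (auto simp: V)
    then show ?thesis using inside_no_overlap by blast
  next
    case False
    have es: "e \<in> slots (Suc (N + 2)) (upper_slots t) a'" using e by (simp add: numeral_3_eq_3)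
    obtain k where k: "k \<in> upper_slots t" "k \<le> N + 2" "\<And>x. x < N + 2 \<Longrightarrow> pos e x < h \<longleftrightarrow> x < k"
      by (rule pos_gap[OF es _ _ False]) (use h M in auto)
    have "{p \<in> ?B. fst p < h} = map_prod (pos e) (pos f) ` {p \<in> set (bridges t s). fst p < k}"
      using k(3) bridges_bounds by fastforce
    also have "card \<dots> = card {p \<in> set (bridges t s). fst p < k}"
      by (rule card_image) (auto simp: inj_on_def posi)
    finally have "even (card {p \<in> ?B. fst p < h})" using even_upper[OF k(1)] by simp
    moreover have "u h \<notin> \<Union> P'"
    proof
      assume "u h \<in> \<Union> P'"
      then obtain i where i: "i < N + 2" "u h = u (pos e i) \<or> u h = l (pos f i)" unfolding V by auto
      then show False using False u_inj[OF h eM[OF i(1)]] u_neq_l[OF h fM[OF i(1)]] by auto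
    qed
    ultimately show ?thesis using u_not_inside[of h] simple h unfolding P' by blast
  qed
  have out_l: "l h \<notin> inside (polygon_boundary P')" if h: "h < M" for h
  proof (cases "h \<in> pos f ` {..<N + 2}")
    case True
    then have "l h \<in> polygon_boundary P'" by (intro bdV) (auto simp: V)
    then show ?thesis using inside_no_overlap by blast
  next
    case False
    have fs: "f \<in> slots (Suc (N + 2)) (lower_slots s) a'" using f by (simp add: numeral_3_eq_3)
    obtain k where k: "k \<in> lower_slots s" "k \<le> N + 2" "\<And>x. x < N + 2 \<Longrightarrow> pos f x < h \<longleftrightarrow> x < k"
      by (rule pos_gap[OF fs _ _ False]) (use h M in auto)
    have "{p \<in> ?B. snd p < h} = map_prod (pos e) (pos f) ` {p \<in> set (bridges t s). snd p < k}"
      using k(3) bridges_bounds by fastforce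
    also have "card \<dots> = card {p \<in> set (bridges t s). snd p < k}"
      by (rule card_image) (auto simp: inj_on_def posi)
    finally have "even (card {p \<in> ?B. snd p < h})" using even_lower[OF k(1)] by simp
    moreover have "l h \<notin> \<Union> P'"
    proof
      assume "l h \<in> \<Union> P'"
      then obtain i where i: "i < N + 2" "l h = u (pos e i) \<or> l h = l (pos f i)" unfolding V by auto
      then show False using False l_inj[OF h fM[OF i(1)]] u_neq_l[OF eM[OF i(1)] h, THEN not_sym] by auto
    qed
    ultimately show ?thesis using l_not_inside[of h] simple h unfolding P' by blast
  qed
  show "k_hole (u ` {..<M} \<union> l ` {..<M}) (2 * (N + 2)) P'"
    using gon out_u out_l unfolding k_hole_def by auto
qed

lemma vertices_inject:
  assumes "I \<subseteq> {..<M}" "J \<subseteq> {..<M}" "I' \<subseteq> {..<M}" "J' \<subseteq> {..<M}" "u ` I \<union> l ` J = u ` I' \<union> l ` J'"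
  shows "I = I' \<and> J = J'"
proof -
  have "i \<in> I \<longleftrightarrow> i < M \<and> u i \<in> u ` I \<union> l ` J" "i \<in> J \<longleftrightarrow> i < M \<and> l i \<in> u ` I \<union> l ` J"
    if "I \<subseteq> {..<M}" "J \<subseteq> {..<M}" for I J i
    using that u_inj[of i] l_inj[of i] u_neq_l[of i] u_neq_l[of _ i] by (auto simp: image_iff subset_iff) metis+
  note mem = this
  show ?thesis
  proof (intro conjI set_eqI)
    fix i
    show "i \<in> I \<longleftrightarrow> i \<in> I'"
      unfolding mem(1)[OF assms(1,2), of i] mem(1)[OF assms(3,4), of i] assms(5) ..
    show "i \<in> J \<longleftrightarrow> i \<in> J'"
      unfolding mem(2)[OF assms(1,2), of i] mem(2)[OF assms(3,4), of i] assms(5) ..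
  qed
qed

text \<open>The chains are disjoint, so the endpoints of an edge show whether it runs within a chain
  and within which one.\<close>

lemma chain_edges_inject:
  assumes EU: "EU \<subseteq> arcs 0 M" "EU' \<subseteq> arcs 0 M" and EL: "EL \<subseteq> arcs 0 M" "EL' \<subseteq> arcs 0 M"
    and B: "B \<subseteq> {..<M} \<times> {..<M}" "B' \<subseteq> {..<M} \<times> {..<M}"
    and eq: "chain_edges EU EL B = chain_edges EU' EL' B'"
  shows "EU = EU'" "EL = EL'"
proof -
  let ?U = "u ` {..<M}" and ?L = "l ` {..<M}"
  have dis: "?U \<inter> ?L = {}" using u_neq_l by auto
  have inj_u: "inj_on u {..<M}" and inj_l: "inj_on l {..<M}"
    using u_inj l_inj by (auto simp: inj_on_def)
  have split: "{e \<in> chain_edges EU EL B. e \<subseteq> ?U} = (\<lambda>(i, j). {u i, u j}) ` EU \<and>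
      {e \<in> chain_edges EU EL B. e \<subseteq> ?L} = (\<lambda>(i, j). {l i, l j}) ` EL"
    if "EU \<subseteq> arcs 0 M" "EL \<subseteq> arcs 0 M" "B \<subseteq> {..<M} \<times> {..<M}" for EU EL B
  proof -
    have 1: "e \<subseteq> ?U \<and> \<not> e \<subseteq> ?L" if "e \<in> (\<lambda>(i, j). {u i, u j}) ` EU" for e
    proof -
      obtain i j where ij: "(i, j) \<in> EU" "e = {u i, u j}" using \<open>e \<in> _\<close> by auto
      have "i < M" "j < M" using arcs_bounds[OF \<open>EU \<subseteq> arcs 0 M\<close> ij(1)] by auto
      then show ?thesis using ij(2) dis by blast
    qed
    have 2: "e \<subseteq> ?L \<and> \<not> e \<subseteq> ?U" if "e \<in> (\<lambda>(i, j). {l i, l j}) ` EL" for e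
    proof -
      obtain i j where ij: "(i, j) \<in> EL" "e = {l i, l j}" using \<open>e \<in> _\<close> by auto
      have "i < M" "j < M" using arcs_bounds[OF \<open>EL \<subseteq> arcs 0 M\<close> ij(1)] by auto
      then show ?thesis using ij(2) dis by blast
    qed
    have 3: "\<not> e \<subseteq> ?L \<and> \<not> e \<subseteq> ?U" if "e \<in> (\<lambda>(x, y). {u x, l y}) ` B" for e
    proof -
      obtain i j where ij: "(i, j) \<in> B" "e = {u i, l j}" using \<open>e \<in> _\<close> by auto
      have "i < M" "j < M" using \<open>B \<subseteq> _\<close> ij(1) by auto
      then show ?thesis using ij(2) dis by blast
    qed
    have filt: "{e \<in> X \<union> Y \<union> Z. p e} = X \<and> {e \<in> X \<union> Y \<union> Z. q e} = Y"
      if "\<And>e. e \<in> X \<Longrightarrow> p e \<and> \<not> q e" "\<And>e. e \<in> Y \<Longrightarrow> q e \<and> \<not> p e" "\<And>e. e \<in> Z \<Longrightarrow> \<not> q e \<and> \<not> p e"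
      for X Y Z :: "complex set set" and p q
      using that by blast
    show ?thesis unfolding chain_edges_def by (rule filt[OF 1 2 3])
  qed
  have "(\<lambda>(i, j). {u i, u j}) ` EU = (\<lambda>(i, j). {u i, u j}) ` EU'"
    "(\<lambda>(i, j). {l i, l j}) ` EL = (\<lambda>(i, j). {l i, l j}) ` EL'"
    using split[OF EU(1) EL(1) B(1)] split[OF EU(2) EL(2) B(2)] eq by metis+
  then show "EU = EU'" "EL = EL'"
    using pair_edges_inject[OF EU inj_u] pair_edges_inject[OF EU(2,1) inj_u]
      pair_edges_inject[OF EL inj_l] pair_edges_inject[OF EL(2,1) inj_l]
    by (metis order_refl subset_antisym)+
qed

lemma map_prod_pos_inject: "map_prod (pos e) (pos e) ` E = map_prod (pos e) (pos e) ` E' \<Longrightarrow> E = E'"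
proof -
  have "inj (pos e)" by (rule injI) (metis linorder_neqE_nat pos_less_iff less_irrefl)
  then have "inj (map_prod (pos e) (pos e))" by (simp add: prod.inj_map)
  then show "map_prod (pos e) (pos e) ` E = map_prod (pos e) (pos e) ` E' \<Longrightarrow> E = E'"
    by (simp add: inj_image_eq_iff)
qed

text \<open>The vertex set of the polygon determines \<open>e\<close> and \<open>f\<close>. Once
  they are known, the edges within each chain give back the arcs and hence the codes.\<close>

lemma hole_edges_inject:
  assumes M: "M = N + 2 + a'"
    and 1: "sys_pair t s N" "e \<in> slots (N + 3) (upper_slots t) a'" "f \<in> slots (N + 3) (lower_slots s) a'"
    and 2: "sys_pair t' s' N" "e' \<in> slots (N + 3) (upper_slots t') a'" "f' \<in> slots (N + 3) (lower_slots s') a'"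
    and eq: "hole_edges (t, s, e, f) = hole_edges (t', s', e', f')"
  shows "t = t' \<and> s = s' \<and> e = e' \<and> f = f'"
proof -
  have NN: "ssize t = N" "ssize s = N" "ssize t' = N" "ssize s' = N" using 1(1) 2(1) by (auto simp: sys_pair_def)
  have sum: "sum_list e = a'" "sum_list f = a'" "sum_list e' = a'" "sum_list f' = a'"
    using 1 2 by (auto simp: slots_def)
  have pM: "pos g i < M" if "sum_list g = a'" "i < N + 2" for g i using pos_bound[OF that(2,1)] M by simp
  have V: "u ` pos e ` {..<N + 2} \<union> l ` pos f ` {..<N + 2} = u ` pos e' ` {..<N + 2} \<union> l ` pos f' ` {..<N + 2}"
    using hole(1)[OF 1(1) M 1(2,3)] hole(1)[OF 2(1) M 2(2,3)] eq by simp
  have "pos e ` {..<N + 2} = pos e' ` {..<N + 2} \<and> pos f ` {..<N + 2} = pos f' ` {..<N + 2}"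
    by (rule vertices_inject[OF _ _ _ _ V]) (use pM sum in auto)
  then have ef: "e = e'" "f = f'"
    using pos_inject[of e "N + 2" "upper_slots t" a' e' "upper_slots t'"]
      pos_inject[of f "N + 2" "lower_slots s" a' f' "lower_slots s'"] 1 2 by (simp_all add: numeral_3_eq_3)
  have ar: "map_prod (pos g) (pos g) ` upper_arcs t \<subseteq> arcs 0 M" "map_prod (pos g) (pos g) ` lower_arcs t \<subseteq> arcs 0 M"
    if "ssize t = N" "sum_list g = a'" for t g
    using arcs_map_prod[OF upper_arcs_bounds[of t] pos_less_iff, of g M]
      arcs_map_prod[OF lower_arcs_bounds[of t] pos_less_iff, of g M] pM[OF that(2)] that(1) by simp_all
  have br: "map_prod (pos e) (pos f) ` set (bridges t s) \<subseteq> {..<M} \<times> {..<M}"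
    if "sys_pair t s N" "sum_list e = a'" "sum_list f = a'" for t s e f
    using sys_pair.bridges_bounds[OF that(1)] pM that(2,3) by fastforce
  have "map_prod (pos e) (pos e) ` upper_arcs t = map_prod (pos e) (pos e) ` upper_arcs t'"
    "map_prod (pos f) (pos f) ` lower_arcs s = map_prod (pos f) (pos f) ` lower_arcs s'"
    by (rule chain_edges_inject[OF ar(1) ar(1) ar(2) ar(2) br[OF 1(1)] br[OF 2(1)]];
      use eq NN sum ef in \<open>simp add: hole_edges_def\<close>)+
  then show ?thesis
    using map_prod_pos_inject upper_arcs_inject lower_arcs_inject NN ef by metis
qed

lemma many_holes:
  assumes M: "M = N + 2 + a'" and d: "d \<le> N"
  shows "card (sys_class N r d) ^ 2 * (((a' + N) choose a') * (a' + 1)) \<le>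
     card {P'. k_hole (u ` {..<M} \<union> l ` {..<M}) (2 * (N + 2)) P'}"
proof -
  let ?T = "sys_class N r d"
  let ?D = "SIGMA t:?T. SIGMA s:?T. slots (N + 3) (upper_slots t) a' \<times> slots (N + 3) (lower_slots s) a'"
  let ?H = "{P'. k_hole (u ` {..<M} \<union> l ` {..<M}) (2 * (N + 2)) P'}"
  have pair: "sys_pair t s N" if "t \<in> ?T" "s \<in> ?T" for t s
    using that unfolding sys_pair_def sys_class_def paths_1 by simp
  have finT: "finite ?T" by (rule finite_subset[OF _ finite_sys_eq[of N]]) (auto simp: sys_class_def)
  have "inj_on hole_edges ?D"
  proof (rule inj_onI)
    fix x y assume xy: "x \<in> ?D" "y \<in> ?D" "hole_edges x = hole_edges y"
    obtain t s e f where x: "x = (t, s, e, f)" by (cases x) auto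
    obtain t' s' e' f' where y: "y = (t', s', e', f')" by (cases y) auto
    show "x = y"
      using hole_edges_inject[OF M, of t s e f t' s' e' f'] xy pair unfolding x y by auto
  qed
  then have "card ?D = card (hole_edges ` ?D)" by (simp add: card_image)
  also have "\<dots> \<le> card ?H"
  proof (rule card_mono)
    have "?H \<subseteq> Pow (Pow (u ` {..<M} \<union> l ` {..<M}))" unfolding k_hole_def k_gon_def by auto
    then show "finite ?H" by (rule finite_subset) simp
    show "hole_edges ` ?D \<subseteq> ?H" using hole(2)[OF pair M] by auto
  qed
  finally have DH: "card ?D \<le> card ?H" .
  \<comment> \<open>There are \<open>N - d + 2\<close> admissible slots above and
    \<open>d + 2\<close> below, two of them at the ends of each chain; stars and bars lowers both
    numbers by one.\<close>
  have sl: "((a' + (N - d) + 1) choose a') * ((a' + d + 1) choose a') \<le>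
      card (slots (N + 3) (upper_slots t) a' \<times> slots (N + 3) (lower_slots s) a')"
    if "t \<in> ?T" "s \<in> ?T" for t s
  proof -
    have ts: "ssize t = N" "ssize s = N" "card (inner_gaps (paths 0 t)) = d" "card (inner_gaps (paths 0 s)) = d"
      using that by (auto simp: sys_class_def)
    show ?thesis
      using card_slots[of a' "upper_slots t" "N + 3"] card_slots[of a' "lower_slots s" "N + 3"]
        card_upper_slots[OF ts(3)] card_lower_slots[OF ts(4)] ts(1,2)
      by (simp add: card_cartesian_product mult_le_mono)
  qed
  have fs: "finite (slots (N + 3) (upper_slots t) a' \<times> slots (N + 3) (lower_slots s) a')" for t s
    by (simp add: finite_slots)
  have "((a' + N) choose a') * (a' + 1) \<le> ((a' + (N - d) + 1) choose a') * ((a' + d + 1) choose a')"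
    using binomial_product_lower[of a' "N - d" d] d by simp
  then have "card ?T ^ 2 * (((a' + N) choose a') * (a' + 1)) \<le>
      card ?T ^ 2 * (((a' + (N - d) + 1) choose a') * ((a' + d + 1) choose a'))"
    by (rule mult_le_mono2)
  also have "\<dots> = (\<Sum>t\<in>?T. \<Sum>s\<in>?T. ((a' + (N - d) + 1) choose a') * ((a' + d + 1) choose a'))"
    by (simp add: power2_eq_square)
  also have "\<dots> \<le> (\<Sum>t\<in>?T. \<Sum>s\<in>?T. card (slots (N + 3) (upper_slots t) a' \<times> slots (N + 3) (lower_slots s) a'))"
    by (intro sum_mono sl)
  also have "\<dots> = card ?D"
    using finT fs by (simp add: card_SigmaI finite_SigmaI del: card_cartesian_product)
  finally show ?thesis using DH by linarith
qed

end

theorem theorem2: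
  "\<exists>(g :: nat \<Rightarrow> real) (c :: real). c > 0 \<and> (\<forall>k. g k \<ge> c * 4.64 ^ k) \<and>
     (\<forall>(n :: nat) (k :: nat) (S :: complex set).
        even n \<and> even k \<and> 3 \<le> k \<and> k \<le> n \<and> double_chain n S \<longrightarrow>
        real (card {P. k_hole S k P}) \<ge>
          real (((n - 4) div 2) choose ((n - k) div 2)) * ((real n - real k + 2) / 2) * g k)"
proof -
  obtain c :: real where c: "c > 0" "\<And>N. c * 4.64 ^ (2 * N) * (real N + 1) ^ 4 \<le> real (num_sys N) ^ 2"
    using num_sys_growth4 by blast
  \<comment> \<open>Since \<open>k = 2 * N + 4\<close>, the four auxiliary vertices cost the
    constant \<open>4.64 ^ 4\<close>.\<close>
  define c' where "c' = c / 4.64 ^ 4"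
  have main: "real (((n - 4) div 2) choose ((n - k) div 2)) * ((real n - real k + 2) / 2) * (c' * 4.64 ^ k)
      \<le> real (card {P. k_hole S k P})"
    if nk: "even n" "even k" "3 \<le> k" "k \<le> n" "double_chain n S" for n k S
  proof -
    define N where "N = k div 2 - 2"
    define a' where "a' = (n - k) div 2"
    obtain k' n' where k'n': "k = 2 * k'" "n = 2 * n'" using nk by (auto elim!: evenE)
    have k: "k = 2 * (N + 2)" and n: "n div 2 = N + 2 + a'" "n = k + 2 * a'"
      using nk k'n' by (auto simp: N_def a'_def)
    obtain u l a b where ul: "facing_chains u l (n div 2) a b" "S = u ` {..<n div 2} \<union> l ` {..<n div 2}"
      by (rule double_chain_facing[OF nk(5)])
    obtain r d where rd: "d \<le> N" "num_sys N \<le> (N + 1)\<^sup>2 * card (sys_class N r d)"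
      by (rule large_class)
    define T where "T = real (card (sys_class N r d))"
    have "real (num_sys N) \<le> real ((N + 1)\<^sup>2 * card (sys_class N r d))" using rd(2) by (simp only: of_nat_le_iff)
    then have "real (num_sys N) \<le> (real N + 1)\<^sup>2 * T" by (simp add: T_def add.commute)
    then have "real (num_sys N) ^ 2 \<le> ((real N + 1)\<^sup>2 * T) ^ 2" by (rule power_mono) simp
    also have "\<dots> = T\<^sup>2 * (real N + 1) ^ 4" by (simp add: power_mult_distrib)
    finally have "c * 4.64 ^ (2 * N) * (real N + 1) ^ 4 \<le> T\<^sup>2 * (real N + 1) ^ 4"
      using c(2)[of N] by linarith
    then have "c * 4.64 ^ (2 * N) \<le> T\<^sup>2" by (rule mult_right_le_imp_le) simp
    moreover have "c' * 4.64 ^ k = c * 4.64 ^ (2 * N)"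
    proof -
      have "k = 4 + 2 * N" using k by simp
      then have "(4.64 :: real) ^ k = 4.64 ^ 4 * 4.64 ^ (2 * N)" by (simp only: power_add)
      moreover have "c / p * (p * q) = c * q" if "p \<noteq> 0" for p q :: real using that by simp
      ultimately show ?thesis unfolding c'_def by (metis power_not_zero zero_neq_numeral divide_eq_0_iff)
    qed
    ultimately have T: "c' * 4.64 ^ k \<le> T\<^sup>2" by simp
    have b: "((n - 4) div 2) choose ((n - k) div 2) = (a' + N) choose a'"
      unfolding n(2) k by (simp add: add.commute)
    have h: "(real n - real k + 2) / 2 = real (a' + 1)" unfolding n(2) by simp
    have "real (((n - 4) div 2) choose ((n - k) div 2)) * ((real n - real k + 2) / 2) * (c' * 4.64 ^ k)
        \<le> real ((a' + N) choose a') * real (a' + 1) * T\<^sup>2"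
      unfolding b h by (intro mult_left_mono T) simp
    also have "\<dots> = real (card (sys_class N r d) ^ 2 * (((a' + N) choose a') * (a' + 1)))"
      by (simp add: T_def algebra_simps)
    also have "\<dots> \<le> real (card {P. k_hole S k P})"
      using facing_chains.many_holes[OF ul(1) n(1) rd(1), of r] unfolding ul(2) k by (simp only: of_nat_le_iff)
    finally show ?thesis .
  qed
  show ?thesis
    by (intro exI[of _ "\<lambda>k. c' * 4.64 ^ k"] exI[of _ c']) (use c main in \<open>auto simp: c'_def\<close>)
qed

end
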